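(* Let $\varrho$ be a primitive inflation rule in one dimension, with multiplier $\lambda$ and Fourier matrix $B(k)$, where it is assumed that $\det(B(k))\neq0$ for some $k$. Let $B^{(n)}(k)$ be the Fourier matrix cocycle and $\chi^B(k)$ its maximal Lyapunov exponent. If the diffraction measure of the hull defined by $\varrho$ comprises a non-trivial absolutely continuous component, then $\chi^B(k)=\log\sqrt\lambda$ holds for all $k$ in a subset of $\mathbb R$ of positive Lebesgue measure, and for a.e. $k\in\mathbb R$ whenever $\chi^B(k)$ is almost surely constant.
   Context: Let $\mathcal A=\{a_1,\dots,a_{n_a}\}$ be a finite alphabet and $\varrho$ a primitive substitution on $\mathcal A$: each letter is mapped to a non-empty finite word, and the substitution matrix $M_\varrho=(M_{ij})$, with $M_{ij}$ the number of letters $a_i$ in $\varrho(a_j)$, is primitive. Let $\lambda>1$ be its Perron–Frobenius (PF) eigenvalue, called the inflation multiplier. The associated (geometric) inflation rule, also denoted $\varrho$, uses intervals (prototiles) of natural lengths $\ell_1,\dots,\ell_{n_a}>0$, where $(\ell_1,\dots,\ell_{n_a})$ is a fixed left PF eigenvector of $M_\varrho$; a tile of type $a_i$ is expanded by $\lambda$ and then dissected into tiles of the original sizes in the order specified by $\varrho(a_i)$. Tiles of different type but equal length are distinguished by colour. Hull: Starting from a tiling of $\mathbb R$ that is a fixed point of $\varrho$ (or of a suitable power), the hull $\mathbb Y$ is the closure of its translation orbit in the local topology. Each tiling is identified with the coloured point set $\Lambda=\bigcup_i\Lambda_i$, where $\Lambda_i$ is the set of left endpoints of tiles of type $a_i$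 (disjoint union). The system $(\mathbb Y,\mathbb R)$ is strictly ergodic. Displacement sets and Fourier matrix: $T_{ij}$ is the set of all relative positions (left endpoints, relative to the left endpoint of the patch) of tiles of type $a_i$ in the patch $\varrho(a_j)$ (an interval of length $\lambda\ell_j$ dissected into tiles). $B(k)=(B_{ij}(k))$ with $B_{ij}(k)=\sum_{t\in T_{ij}}\mathrm e^{2\pi\mathrm i tk}$. The Fourier matrix cocycle is $B^{(n)}(k)=B(k)B(\lambda k)\cdots B(\lambda^{n-1}k)$, and $\chi^B(k)=\limsup_{n\to\infty}\frac1n\log\|B^{(n)}(k)\|$ with any matrix norm. Diffraction: with $\nu_{ij}(z)=\operatorname{dens}(\Lambda_i\cap(\Lambda_j-z))/\operatorname{dens}(\Lambda)$ (independent of $\Lambda\in\mathbb Y$) and $\Upsilon_{ij}=\sum_{z\in\Lambda-\Lambda}\nu_{ij}(z)\delta_z$, the weighted Dirac comb $\sum_i u_i\delta_{\Lambda_i}$, with weights $u\in\mathbb C^{n_a}$, has autocorrelation $\gamma_u=\operatorname{dens}(\Lambda)\sum_{i,j}\overline{u_i}\,\Upsilon_{ij}\,u_j$; its Fourier transform $\widehat{\gamma_u}$ is a positive measure, called the diffraction measure. A non-trivial absolutely continuous component means that the absolutely continuous part (in the Lebesgue decomposition) of $\widehat{\gamma_u}$ is non-zero for some choice of weights $u$. *)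

theory Defs
  imports "HOL-Analysis.Analysis"
begin

section \<open>Primitive substitutions and inflation rules\<close>

definition subst_matrix :: "('a::finite \<Rightarrow> 'a list) \<Rightarrow> real^'a^'a" where
  "subst_matrix \<rho> = (\<chi> i j. real (count_list (\<rho> j) i))"

definition mat_power :: "real^'n^'n \<Rightarrow> nat \<Rightarrow> real^'n^'n" where
  "mat_power A n = (((**) A) ^^ n) (mat 1)"

definition primitive_matrix :: "real^'n^'n \<Rightarrow> bool" where
  "primitive_matrix A \<longleftrightarrow> (\<forall>i j. 0 \<le> A$i$j) \<and> (\<exists>n\<ge>1. \<forall>i j. 0 < mat_power A n $ i $ j)"

definition primitive_substitution :: "('a::finite \<Rightarrow> 'a list) \<Rightarrow> bool" where
  "primitive_substitution \<rho> \<longleftrightarrow> (\<forall>a. \<rho> a \<noteq> []) \<and> primitive_matrix (subst_matrix \<rho>)"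

definition complex_eigenvalue :: "real^'n^'n \<Rightarrow> complex \<Rightarrow> bool" where
  "complex_eigenvalue A z \<longleftrightarrow> (\<exists>v::complex^'n. v \<noteq> 0 \<and> map_matrix of_real A *v v = z *s v)"

definition pf_eigenvalue :: "real^'n^'n \<Rightarrow> real \<Rightarrow> bool" where
  "pf_eigenvalue A r \<longleftrightarrow> complex_eigenvalue A (of_real r) \<and> (\<forall>z. complex_eigenvalue A z \<longrightarrow> cmod z \<le> r)"

definition left_pf_eigenvector :: "real^'n^'n \<Rightarrow> real \<Rightarrow> real^'n \<Rightarrow> bool" where
  "left_pf_eigenvector A r v \<longleftrightarrow> pf_eigenvalue A r \<and> (\<forall>i. 0 < v$i) \<and> v v* A = r *s v"

text \<open>
  \<open>lam\<close> is the inflation multiplier and \<open>len $ a\<close> the length of the prototile of type \<open>a\<close>.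
\<close>

definition primitive_inflation_rule ::
    "('a::finite \<Rightarrow> 'a list) \<Rightarrow> real \<Rightarrow> real^'a \<Rightarrow> bool" where
  "primitive_inflation_rule \<rho> lam len \<longleftrightarrow>
     primitive_substitution \<rho> \<and> 1 < lam \<and> left_pf_eigenvector (subst_matrix \<rho>) lam len"

definition displacements :: "('a::finite \<Rightarrow> 'a list) \<Rightarrow> real^'a \<Rightarrow> 'a \<Rightarrow> 'a \<Rightarrow> real set" where
  "displacements \<rho> len i j =
     {sum_list (map (\<lambda>a. len $ a) (take n (\<rho> j))) | n. n < length (\<rho> j) \<and> \<rho> j ! n = i}"


section \<open>Tilings of the line as coloured point sets, and the hull\<close>

text \<open>
  A coloured point set is a family \<open>X :: 'a \<Rightarrow> real set\<close>; for a tiling, \<open>X a\<close> is the set of left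
  endpoints of the tiles of type \<open>a\<close>. Tiles are taken half-open, so that tiling means partitioning.
\<close>

definition is_tiling :: "real^'a::finite \<Rightarrow> ('a \<Rightarrow> real set) \<Rightarrow> bool" where
  "is_tiling len X \<longleftrightarrow> (\<forall>y. \<exists>!(x, a). x \<in> X a \<and> x \<le> y \<and> y < x + len $ a)"

definition inflate ::
    "('a::finite \<Rightarrow> 'a list) \<Rightarrow> real \<Rightarrow> real^'a \<Rightarrow> ('a \<Rightarrow> real set) \<Rightarrow> 'a \<Rightarrow> real set" where
  "inflate \<rho> lam len X i = (\<Union>j. {lam * x + t | x t. x \<in> X j \<and> t \<in> displacements \<rho> len i j})"

definition fixed_point_tiling ::
    "('a::finite \<Rightarrow> 'a list) \<Rightarrow> real \<Rightarrow> real^'a \<Rightarrow> ('a \<Rightarrow> real set) \<Rightarrow> bool" where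
  "fixed_point_tiling \<rho> lam len X \<longleftrightarrow>
     is_tiling len X \<and> (\<exists>m\<ge>1. (inflate \<rho> lam len ^^ m) X = X)"

definition translate :: "real \<Rightarrow> ('a \<Rightarrow> real set) \<Rightarrow> 'a \<Rightarrow> real set" where
  "translate s X a = (\<lambda>x. x + s) ` X a"

text \<open>
  Local topology: two coloured point sets are \<open>\<epsilon>\<close>-close if, after a translation of one of them
  by at most \<open>\<epsilon>\<close>, they agree on the interval \<open>[-1/\<epsilon>, 1/\<epsilon>]\<close>.
\<close>

definition locally_close :: "real \<Rightarrow> ('a \<Rightarrow> real set) \<Rightarrow> ('a \<Rightarrow> real set) \<Rightarrow> bool" where
  "locally_close \<epsilon> X Y \<longleftrightarrow>
     (\<exists>s. \<bar>s\<bar> \<le> \<epsilon> \<and> (\<forall>a. translate s X a \<inter> {-(1/\<epsilon>)..1/\<epsilon>} = Y a \<inter> {-(1/\<epsilon>)..1/\<epsilon>}))"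

definition tiling_hull :: "('a \<Rightarrow> real set) \<Rightarrow> ('a \<Rightarrow> real set) set" where
  "tiling_hull X = {Y. \<forall>\<epsilon>>0. \<exists>s. locally_close \<epsilon> Y (translate s X)}"


section \<open>Fourier matrix cocycle and its maximal Lyapunov exponent\<close>

definition fourier_matrix :: "('a::finite \<Rightarrow> 'a list) \<Rightarrow> real^'a \<Rightarrow> real \<Rightarrow> complex^'a^'a" where
  "fourier_matrix \<rho> len k =
     (\<chi> i j. \<Sum>t\<in>displacements \<rho> len i j. exp (2 * of_real pi * \<i> * of_real t * of_real k))"

primrec fourier_cocycle ::
    "('a::finite \<Rightarrow> 'a list) \<Rightarrow> real \<Rightarrow> real^'a \<Rightarrow> nat \<Rightarrow> real \<Rightarrow> complex^'a^'a" where
  "fourier_cocycle \<rho> lam len 0 k = mat 1"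
| "fourier_cocycle \<rho> lam len (Suc n) k =
     fourier_cocycle \<rho> lam len n k ** fourier_matrix \<rho> len (lam ^ n * k)"

definition log_norm :: "'b::real_normed_vector \<Rightarrow> ereal" where
  "log_norm x = (if x = 0 then -\<infinity> else ereal (ln (norm x)))"

text \<open>
  The norm on \<^typ>\<open>complex^'n^'n\<close> is the Frobenius norm; the exponent does not depend on this choice.
\<close>

definition lyapunov_exponent ::
    "('a::finite \<Rightarrow> 'a list) \<Rightarrow> real \<Rightarrow> real^'a \<Rightarrow> real \<Rightarrow> ereal" where
  "lyapunov_exponent \<rho> lam len k =
     limsup (\<lambda>n. ereal (1 / real n) * log_norm (fourier_cocycle \<rho> lam len n k))"


section \<open>Autocorrelation and diffraction\<close>

definition dens :: "real set \<Rightarrow> real" where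
  "dens S = Lim at_top (\<lambda>R. real (card (S \<inter> {-R..R})) / (2 * R))"

definition pair_corr :: "('a \<Rightarrow> real set) \<Rightarrow> 'a \<Rightarrow> 'a \<Rightarrow> real \<Rightarrow> real" where
  "pair_corr X i j z = dens (X i \<inter> (\<lambda>y. y - z) ` X j) / dens (\<Union>a. X a)"

definition difference_set :: "real set \<Rightarrow> real set" where
  "difference_set S = {x - y | x y. x \<in> S \<and> y \<in> S}"

text \<open>
  The autocorrelation is the pure point measure on \<open>difference_set (\<Union>a. X a)\<close> that has the mass
  \<open>autocorr_coeff X u z\<close> at \<open>z\<close>.
\<close>

definition autocorr_coeff :: "('a::finite \<Rightarrow> real set) \<Rightarrow> complex^'a \<Rightarrow> real \<Rightarrow> complex" where
  "autocorr_coeff X u z =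
     of_real (dens (\<Union>a. X a)) * (\<Sum>i\<in>UNIV. \<Sum>j\<in>UNIV. cnj (u$i) * of_real (pair_corr X i j z) * u$j)"

text \<open>The function \<open>D n\<close> is the \<open>n\<close>-th derivative of \<open>\<phi>\<close>.\<close>

definition schwartz_function :: "(real \<Rightarrow> complex) \<Rightarrow> bool" where
  "schwartz_function \<phi> \<longleftrightarrow>
     (\<exists>D :: nat \<Rightarrow> real \<Rightarrow> complex. D 0 = \<phi> \<and>
        (\<forall>n x. (D n has_vector_derivative D (Suc n) x) (at x)) \<and>
        (\<forall>m n. bounded (range (\<lambda>x. of_real (x ^ m) * D n x))))"

definition fourier :: "(real \<Rightarrow> complex) \<Rightarrow> real \<Rightarrow> complex" where
  "fourier \<phi> x = (LINT k|lborel. exp (- 2 * of_real pi * \<i> * of_real k * of_real x) * \<phi> k)"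

text \<open>
  The Fourier transform of the autocorrelation \<open>\<gamma>\<close> is taken in the sense of tempered distributions:
  a positive measure \<open>\<mu>\<close> is the Fourier transform of \<open>\<gamma>\<close> if \<open>\<mu>(\<phi>) = \<gamma>(fourier \<phi>)\<close> for every
  Schwartz function \<open>\<phi>\<close>. This determines \<open>\<mu>\<close> uniquely.
\<close>

definition is_diffraction_measure ::
    "('a::finite \<Rightarrow> real set) \<Rightarrow> complex^'a \<Rightarrow> real measure \<Rightarrow> bool" where
  "is_diffraction_measure X u \<mu> \<longleftrightarrow> sets \<mu> = sets borel \<and>
     (\<forall>\<phi>. schwartz_function \<phi> \<longrightarrow>
        integrable \<mu> \<phi> \<and>
        ((\<lambda>z. autocorr_coeff X u z * fourier \<phi> z) has_sum (LINT k|\<mu>. \<phi> k))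
          (difference_set (\<Union>a. X a)))"

definition lebesgue_decomposition :: "real measure \<Rightarrow> real measure \<Rightarrow> real measure \<Rightarrow> bool" where
  "lebesgue_decomposition \<mu> \<mu>ac \<mu>s \<longleftrightarrow>
     sets \<mu>ac = sets borel \<and> sets \<mu>s = sets borel \<and>
     (\<forall>A\<in>sets borel. emeasure \<mu> A = emeasure \<mu>ac A + emeasure \<mu>s A) \<and>
     absolutely_continuous lborel \<mu>ac \<and>
     (\<exists>N\<in>null_sets lborel. emeasure \<mu>s (- N) = 0)"

definition has_nontrivial_ac_part :: "real measure \<Rightarrow> bool" where
  "has_nontrivial_ac_part \<mu> \<longleftrightarrow>
     (\<exists>\<mu>ac \<mu>s. lebesgue_decomposition \<mu> \<mu>ac \<mu>s \<and> emeasure \<mu>ac UNIV \<noteq> 0)"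

end

theory Submission
  imports Defs "HOL-Probability.Probability" "HOL-Real_Asymp.Real_Asymp"
begin

text \<open>
  The diffraction measure \<open>\<mu>\<close> is, after multiplication with a Gaussian, the weak limit of the
  intensities of the level-\<open>N\<close> supertiles, that is, of the squared moduli of linear combinations of
  the entries of the cocycle \<open>B\<^sub>N(k)\<close>, divided by the volume of order \<open>\<lambda>\<^sup>N\<close>. By orthogonality of exponential sums
  over separated sets, the Gaussian mean of \<open>\<parallel>B\<^sub>N(mk)\<parallel>\<^sup>2\<close> is \<open>O(\<lambda>\<^sup>N)\<close>, uniformly in \<open>m \<ge> 1\<close>.
  For \<open>m = 1\<close>, summation over \<open>N\<close> with weights \<open>\<lambda>\<^sup>-\<^sup>N (N + 1)\<^sup>-\<^sup>2\<close> shows that the Lyapunov exponent is at most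
  \<open>log \<surd>\<lambda>\<close> Lebesgue almost everywhere. Conversely, \<open>B\<^sub>N\<^sub>+\<^sub>n(k) = B\<^sub>n(k) B\<^sub>N(\<lambda>\<^sup>n k)\<close> and the
  case \<open>m = \<lambda>\<^sup>n\<close> show that \<open>\<mu>\<close> gives mass \<open>O(c)\<close> to the open set where \<open>\<parallel>B\<^sub>n(k)\<parallel>\<^sup>2 < c \<lambda>\<^sup>n\<close>. With
  exponentially small \<open>c\<close>, the set of \<open>k\<close> with exponent below \<open>log \<surd>\<lambda>\<close> is a \<open>\<mu>\<close>-null set. Hence an
  absolutely continuous part of \<open>\<mu>\<close> must live on the set where the exponent equals \<open>log \<surd>\<lambda>\<close>.
\<close>

section \<open>Separated sets\<close>

text \<open>The obstacle is that \<open>\<mu>\<close> may be singular to Lebesgue measure, while all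
  estimates on the cocycle are Lebesgue means. They reach \<open>\<mu>\<close> only through
  continuous test functions and a weak limit, which is why smallness of the cocycle is tested on
  open sets and why the bounds must not depend on \<open>N\<close>. The Gaussian serves three
  purposes. It makes the measures finite, so that they can be normalised to probability measures;
  its modulations \<open>std_normal_density k * cis (t * k)\<close> are Schwartz functions with
  Gaussian Fourier transforms; and the decay of these transforms, summed over a separated set,
  yields the near-orthogonality of the exponentials. Supertiles take the place of growing windows
  because their Fourier sums are exactly the entries of the cocycle. As \<open>dens\<close> is a
  \<open>Lim\<close>, the existence of pair frequencies has to be proved first: primitivity turns
  the passage to higher supertiles into an averaging process that forces a common limit.\<close>

definition separated :: "real \<Rightarrow> real set \<Rightarrow> bool" where
  "separated r S \<longleftrightarrow> (\<forall>x\<in>S. \<forall>y\<in>S. x < y \<longrightarrow> x + r \<le> y)"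

lemma separated_subset: "separated r S \<Longrightarrow> T \<subseteq> S \<Longrightarrow> separated r T"
  unfolding separated_def by blast

text \<open>Dilation by \<open>m \<ge> 1\<close> does not shrink gaps. Applied to the frequencies of
  an exponential sum at \<open>m * k\<close>, this makes the mean square bounds uniform in
  \<open>m\<close>.\<close>

lemma separated_affine:
  assumes "separated r S" "0 \<le> r" "1 \<le> m"
  shows "separated r ((\<lambda>x. c + m * x) ` S)"
  unfolding separated_def
proof (clarify)
  fix x y assume "x \<in> S" "y \<in> S" "c + m * x < c + m * y"
  then have "x < y" using assms(3) by simp
  then have "r \<le> y - x" using assms(1) \<open>x \<in> S\<close> \<open>y \<in> S\<close> by (force simp: separated_def)
  also have "\<dots> \<le> m * (y - x)"
    using mult_right_mono[of 1 m "y - x"] assms \<open>x < y\<close> by simp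
  finally show "c + m * x + r \<le> c + m * y" by (simp add: algebra_simps)
qed

text \<open>Each cell of length \<open>r\<close>, counted from \<open>c\<close>, contains at most
  one point; \<open>f\<close> is the index of the cell.\<close>

lemma separated_finite_card:
  assumes S: "separated r S" and r: "0 < r" and sub: "S \<subseteq> {c..c+h}" and h: "0 \<le> h"
  shows "finite S" "real (card S) \<le> h / r + 1"
proof -
  define f where "f x = nat \<lfloor>(x - c) / r\<rfloor>" for x
  have pos: "0 \<le> (x - c) / r" if "x \<in> S" for x using that sub r by auto
  have inj: "inj_on f S"
  proof (rule linorder_inj_onI)
    fix x y assume xy: "x < y" "x \<in> S" "y \<in> S"
    then have "x + r \<le> y" using S by (auto simp: separated_def)
    then have "(x - c + r) / r \<le> (y - c) / r" using r by (intro divide_right_mono) auto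
    then have "(x - c) / r + 1 \<le> (y - c) / r" using r by (simp add: add_divide_distrib)
    then have "\<lfloor>(x - c) / r\<rfloor> < \<lfloor>(y - c) / r\<rfloor>" by linarith
    then show "f x \<noteq> f y" using pos[OF xy(2)] pos[OF xy(3)] unfolding f_def by linarith
  qed auto
  have im: "f ` S \<subseteq> {..nat \<lfloor>h / r\<rfloor>}"
  proof
    fix n assume "n \<in> f ` S"
    then obtain x where x: "x \<in> S" "n = f x" by auto
    then have "(x - c) / r \<le> h / r" using sub r by (auto simp: divide_right_mono)
    then show "n \<in> {..nat \<lfloor>h / r\<rfloor>}" using x by (simp add: f_def floor_mono nat_mono)
  qed
  show fin: "finite S" using inj im finite_imageD finite_subset by blast
  have "card S = card (f ` S)" by (simp add: card_image inj)
  also have "\<dots> \<le> card {..nat \<lfloor>h / r\<rfloor>}" by (rule card_mono) (use im in auto)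
  also have "\<dots> = Suc (nat \<lfloor>h / r\<rfloor>)" by simp
  finally have "card S \<le> Suc (nat \<lfloor>h / r\<rfloor>)" .
  moreover have "real (nat \<lfloor>h / r\<rfloor>) \<le> h / r" using h r by (simp add: of_nat_nat)
  ultimately show "real (card S) \<le> h / r + 1" by linarith
qed

text \<open>The intervals from \<open>s\<close> to \<open>s + r\<close> do not overlap, so the
  increments of \<open>f\<close> over them add up to at most its total variation. Points are added
  in increasing order, with the sharper bound \<open>f (Max S + r) - l\<close> as the induction
  claim.\<close>

lemma sum_increments_separated:
  fixes f :: "real \<Rightarrow> real"
  assumes "finite S" "separated r S" "mono f" "\<And>x. l \<le> f x"  "\<And>x. f x \<le> u"
  shows "(\<Sum>s\<in>S. f (s + r) - f s) \<le> u - l"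
proof (cases "S = {}")
  case True then show ?thesis using assms(4)[of 0] assms(5)[of 0] by auto
next
  case False
  have "(\<Sum>s\<in>S. f (s + r) - f s) \<le> f (Max S + r) - l"
    using assms(1) False assms(2)
  proof (induction rule: finite_linorder_max_induct)
    case empty then show ?case by simp
  next
    case (insert b A)
    show ?case
    proof (cases "A = {}")
      case True then show ?thesis using assms(4)[of b] by simp
    next
      case False
      then have "Max A \<in> A" using insert by simp
      then have "Max A + r \<le> b" using insert by (auto simp: separated_def)
      then have "f (Max A + r) \<le> f b" using \<open>mono f\<close> by (simp add: monoD)
      moreover have "(\<Sum>s\<in>A. f (s + r) - f s) \<le> f (Max A + r) - l"
        using insert False separated_subset by blast
      moreover have "Max (insert b A) = b"
        using insert by (intro Max_eqI) (auto intro: less_imp_le)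
      moreover have "b \<notin> A" using insert by auto
      ultimately show ?thesis using insert by simp
    qed
  qed
  then show ?thesis using assms(5)[of "Max S + r"] by linarith
qed

lemma arctan_increment:
  assumes r: "0 < r"
  shows "r / (2 + 2 * r\<^sup>2) * (1 / (1 + s\<^sup>2)) \<le> arctan (s + r) - arctan s"
proof -
  obtain z where z: "s < z" "z < s + r" "arctan (s + r) - arctan s = (s + r - s) * inverse (1 + z\<^sup>2)"
    using MVT2[of s "s + r" arctan "\<lambda>x. inverse (1 + x\<^sup>2)"] r DERIV_arctan by (metis less_add_same_cancel1)
  \<comment> \<open>Follows from \<open>z\<^sup>2 = 2 * (z - s)\<^sup>2 + 2 * s\<^sup>2 - (z - 2 *
    s)\<^sup>2\<close>.\<close>
  have "z\<^sup>2 \<le> 2 * s\<^sup>2 + 2 * r\<^sup>2"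
  proof -
    have "(z - s)\<^sup>2 \<le> r\<^sup>2" using z r by (intro power_mono) auto
    moreover have "0 \<le> (z - 2 * s)\<^sup>2" by simp
    ultimately show ?thesis by (simp add: power2_eq_square algebra_simps)
  qed
  moreover have "(2 + 2 * r\<^sup>2) * (1 + s\<^sup>2) = 2 + 2 * r\<^sup>2 + 2 * s\<^sup>2 + 2 * r\<^sup>2 * s\<^sup>2"
    by (simp add: algebra_simps)
  moreover have "0 \<le> 2 * r\<^sup>2 * s\<^sup>2" by simp
  ultimately have "1 + z\<^sup>2 \<le> (2 + 2 * r\<^sup>2) * (1 + s\<^sup>2)" by linarith
  moreover have "0 < 1 + z\<^sup>2" by (simp add: add_pos_nonneg)
  ultimately have "r / ((2 + 2 * r\<^sup>2) * (1 + s\<^sup>2)) \<le> r / (1 + z\<^sup>2)"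
    using r by (intro divide_left_mono mult_pos_pos) (auto simp: add_pos_nonneg)
  then show ?thesis using z by (simp add: divide_inverse)
qed

text \<open>The total variation \<open>pi\<close> of arctan, divided by the constant in
  \<open>arctan_increment\<close>.\<close>

definition sep_const :: "real \<Rightarrow> real" where
  "sep_const r = pi * (2 + 2 * r\<^sup>2) / r"

lemma sep_const_nonneg: "0 < r \<Longrightarrow> 0 \<le> sep_const r"
  by (simp add: sep_const_def)

text \<open>An integral test: each summand is dominated by an increment of arctan, and the
  increments are over disjoint intervals. The bound depends neither on the number of points nor on
  \<open>x\<close>.\<close>

lemma sum_separated_le:
  assumes fin: "finite S" and S: "separated r S" and r: "0 < r"
  shows "(\<Sum>s\<in>S. 1 / (1 + (s - x)\<^sup>2)) \<le> sep_const r"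
proof -
  define c where "c = r / (2 + 2 * r\<^sup>2)"
  have c: "c > 0" unfolding c_def using r by (simp add: add_pos_nonneg)
  define f where "f t = arctan (t - x)" for t
  have "c * (\<Sum>s\<in>S. 1 / (1 + (s - x)\<^sup>2)) \<le> (\<Sum>s\<in>S. f (s + r) - f s)"
    unfolding sum_distrib_left f_def
    by (rule sum_mono, rule order.trans[OF arctan_increment[OF r, folded c_def]]) (simp add: algebra_simps)
  also have "\<dots> \<le> pi / 2 - (- pi / 2)"
    using less_imp_le[OF arctan_ubound] less_imp_le[OF arctan_lbound]
    by (intro sum_increments_separated[OF fin S]) (auto intro!: monoI simp: f_def arctan_le_iff)
  finally have "c * (\<Sum>s\<in>S. 1 / (1 + (s - x)\<^sup>2)) \<le> pi" by simp
  then have "(\<Sum>s\<in>S. 1 / (1 + (s - x)\<^sup>2)) \<le> pi / c"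
    using c by (simp add: field_simps)
  also have "pi / c = sep_const r" unfolding c_def sep_const_def by simp
  finally show ?thesis .
qed

section \<open>Tilings\<close>

definition tile_set :: "('a \<Rightarrow> real set) \<Rightarrow> (real \<times> 'a) set" where
  "tile_set Y = {(x, i). x \<in> Y i}"

lemma mem_tile_set [simp]: "(x, i) \<in> tile_set Y \<longleftrightarrow> x \<in> Y i"
  by (simp add: tile_set_def)

definition single_tile :: "'a \<Rightarrow> 'a \<Rightarrow> real set" where
  "single_tile j i = (if i = j then {0} else {})"

definition pair_count :: "('a \<Rightarrow> real set) \<Rightarrow> 'a \<Rightarrow> 'a \<Rightarrow> real \<Rightarrow> real set \<Rightarrow> nat" where
  "pair_count Y i j z W = card {x \<in> Y i. x + z \<in> Y j \<and> x \<in> W}"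

text \<open>\<open>len_inflate\<close> is the left eigenvector equation, read as a comparison of the
  expanded prototile with the tiles of its dissection.\<close>

locale inflation_rule =
  fixes \<rho> :: "'a::finite \<Rightarrow> 'a list" and lam :: real and len :: "real^'a"
  assumes lam_gt_1: "1 < lam"
    and len_pos: "0 < len $ i"
    and len_inflate: "(\<Sum>a\<leftarrow>\<rho> j. len $ a) = lam * len $ j"
    and primitive: "\<exists>q. \<forall>i j. 0 < mat_power (subst_matrix \<rho>) q $ i $ j"
begin

definition rmin :: real where "rmin = Min (range (($) len))"
definition rmax :: real where "rmax = Max (range (($) len))"

lemma rmin_pos: "0 < rmin"
  unfolding rmin_def using len_pos by (subst Min_gr_iff) auto

lemma rmin_le: "rmin \<le> len $ i"
  unfolding rmin_def by (rule Min_le) auto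

lemma rmax_ge: "len $ i \<le> rmax"
  unfolding rmax_def by (rule Max_ge) auto

lemma rmax_pos: "0 < rmax"
  using len_pos rmax_ge less_le_trans by blast

lemma lam_power_pos: "0 < lam ^ n" using lam_gt_1 by simp
lemma lam_power_ge_1: "1 \<le> lam ^ n" using lam_gt_1 by simp

text \<open>With a variable support \<open>A\<close>, one notion covers tilings of the line and
  finite patches. Disjointness is put in terms of left endpoints, because of two overlapping tiles
  one contains the left endpoint of the other; \<open>tiles_unique\<close> returns to arbitrary
  common points.\<close>

definition tiles :: "('a \<Rightarrow> real set) \<Rightarrow> real set \<Rightarrow> bool" where
  "tiles Y A \<longleftrightarrow>
     (\<forall>i. \<forall>x\<in>Y i. {x..<x + len $ i} \<subseteq> A) \<and>
     (\<forall>y\<in>A. \<exists>i. \<exists>x\<in>Y i. x \<le> y \<and> y < x + len $ i) \<and>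
     (\<forall>i j. \<forall>x\<in>Y i. \<forall>y\<in>Y j. x \<le> y \<longrightarrow> y < x + len $ i \<longrightarrow> x = y \<and> i = j)"

lemma tiles_subset: "tiles Y A \<Longrightarrow> x \<in> Y i \<Longrightarrow> {x..<x + len $ i} \<subseteq> A"
  unfolding tiles_def by blast

lemma tiles_cover:
  assumes "tiles Y A" "y \<in> A"
  obtains i x where "x \<in> Y i" "x \<le> y" "y < x + len $ i"
  using assms unfolding tiles_def by blast

lemma tiles_eq:
  assumes "tiles Y A" "x \<in> Y i" "y \<in> Y j" "x \<le> y" "y < x + len $ i"
  shows "x = y \<and> i = j"
  using assms unfolding tiles_def by blast

lemma tiles_unique:
  assumes "tiles Y A" "x \<in> Y i" "y \<in> Y j" "x \<le> p" "p < x + len $ i" "y \<le> p" "p < y + len $ j"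
  shows "x = y \<and> i = j"
proof (cases "x \<le> y")
  case True
  then show ?thesis using tiles_eq[OF assms(1-3)] assms by linarith
next
  case False
  then have "y = x \<and> j = i" using tiles_eq[OF assms(1) assms(3,2)] assms by linarith
  then show ?thesis by auto
qed

lemma is_tiling_tiles:
  assumes "is_tiling len Y" shows "tiles Y UNIV"
proof -
  have ex: "\<exists>!(x, a). x \<in> Y a \<and> x \<le> y \<and> y < x + len $ a" for y
    using assms by (simp add: is_tiling_def)
  show ?thesis unfolding tiles_def
  proof (intro conjI)
    show "\<forall>y\<in>UNIV. \<exists>i. \<exists>x\<in>Y i. x \<le> y \<and> y < x + len $ i"
      using ex by fastforce
    show "\<forall>i j. \<forall>x\<in>Y i. \<forall>y\<in>Y j. x \<le> y \<longrightarrow> y < x + len $ i \<longrightarrow> x = y \<and> i = j"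
    proof (intro allI ballI impI)
      fix i j x y assume a: "x \<in> Y i" "y \<in> Y j" "x \<le> y" "y < x + len $ i"
      have "y < y + len $ j" using len_pos by simp
      then have "(x, i) = (y, j)" using ex[of y] a by (fastforce simp: Ex1_def)
      then show "x = y \<and> i = j" by simp
    qed
  qed auto
qed

lemma tiles_separated:
  assumes "tiles Y A" shows "separated rmin (\<Union>i. Y i)"
  unfolding separated_def
proof (intro ballI impI)
  fix x y assume "x \<in> (\<Union>i. Y i)" "y \<in> (\<Union>i. Y i)" and xy: "x < y"
  then obtain i j where ij: "x \<in> Y i" "y \<in> Y j" by auto
  have "\<not> y < x + len $ i" using tiles_eq[OF assms ij] xy by auto
  then show "x + rmin \<le> y" using rmin_le[of i] by linarith
qed

lemma tiles_separated_single: "tiles Y A \<Longrightarrow> separated rmin (Y i)"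
  using tiles_separated separated_subset by blast

lemma tiles_disjoint_type: "tiles Y A \<Longrightarrow> x \<in> Y i \<Longrightarrow> x \<in> Y j \<Longrightarrow> i = j"
  using tiles_eq[of Y A x i x j] len_pos[of i] by auto

lemma tiles_finite_card:
  assumes "tiles Y A" "S \<subseteq> Y i" "S \<subseteq> {c..c + h}" "0 \<le> h"
  shows "finite S" "real (card S) \<le> h / rmin + 1"
  using separated_finite_card[OF separated_subset[OF tiles_separated_single[OF assms(1)] assms(2)] rmin_pos assms(3,4)]
  by auto

text \<open>Turns sums of tile lengths into Lebesgue measure, so that they can be compared by
  inclusion of sets.\<close>

lemma sum_len_eq_measure:
  assumes "tiles Y A" "finite Q" "Q \<subseteq> tile_set Y"
  shows "measure lborel (\<Union>(x, i)\<in>Q. {x..<x + len $ i}) = (\<Sum>(x, i)\<in>Q. len $ i)"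
proof -
  have "disjoint_family_on (\<lambda>(x, i). {x..<x + len $ i}) Q"
    unfolding disjoint_family_on_def
  proof (intro ballI impI)
    fix p q assume pq: "p \<in> Q" "q \<in> Q" "p \<noteq> q"
    obtain x i where p: "p = (x, i)" by force
    obtain y j where q: "q = (y, j)" by force
    have mem: "x \<in> Y i" "y \<in> Y j" using pq p q assms(3) by auto
    have "\<not> (z \<in> {x..<x + len $ i} \<and> z \<in> {y..<y + len $ j})" for z
      using tiles_unique[OF assms(1) mem, of z] pq p q by auto
    then show "(\<lambda>(x, i). {x..<x + len $ i}) p \<inter> (\<lambda>(x, i). {x..<x + len $ i}) q = {}"
      by (simp only: p q prod.case) blast
  qed
  then have "measure lborel (\<Union>p\<in>Q. (\<lambda>(x, i). {x..<x + len $ i}) p)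
      = (\<Sum>p\<in>Q. measure lborel ((\<lambda>(x, i). {x..<x + len $ i}) p))"
    using assms(2) by (intro measure_finite_Union) (auto simp: less_imp_le[OF len_pos])
  then show ?thesis by (simp add: split_beta less_imp_le[OF len_pos])
qed

lemma tile_end_le:
  assumes "tiles Y {a..<b}" "x \<in> Y i"
  shows "a \<le> x" "x + len $ i \<le> b" "x < b"
proof -
  have "{x..<x + len $ i} \<subseteq> {a..<b}" using tiles_subset[OF assms] .
  then show "a \<le> x" "x + len $ i \<le> b" "x < b"
    using len_pos[of i] by (auto simp: atLeastLessThan_subset_iff)
qed

text \<open>Induction from the right, since appending a letter keeps the earlier prefix sums and
  adds one tile at the end.\<close>

lemma tiles_list:
  fixes w :: "'a list"
  defines "P \<equiv> \<lambda>w i. {sum_list (map (\<lambda>a. len $ a) (take n w)) | n. n < length w \<and> w ! n = i}"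
  shows "tiles (P w) {0..<sum_list (map (\<lambda>a. len $ a) w)} \<and> (\<forall>i. finite (P w i))"
proof (induction w rule: rev_induct)
  case Nil
  show ?case by (auto simp: P_def tiles_def)
next
  case (snoc a w)
  define S where "S = sum_list (map (\<lambda>a. len $ a) w)"
  have S0: "0 \<le> S" unfolding S_def by (rule sum_list_nonneg) (auto simp: less_imp_le[OF len_pos])
  define g where "g n = sum_list (map (\<lambda>a. len $ a) (take n (w @ [a])))" for n
  have P: "P (w @ [a]) i = P w i \<union> (if i = a then {S} else {})" for i
  proof -
    have "P (w @ [a]) i = {g n | n. n < length w \<and> (w @ [a]) ! n = i} \<union> {g n | n. n = length w \<and> (w @ [a]) ! n = i}"
      unfolding P_def g_def[symmetric] by (auto simp: less_Suc_eq)
    also have "{g n | n. n < length w \<and> (w @ [a]) ! n = i} = P w i"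
      unfolding P_def g_def by (intro Collect_cong ex_cong1) (auto simp: nth_append)
    also have "{g n | n. n = length w \<and> (w @ [a]) ! n = i} = (if i = a then {S} else {})"
      by (auto simp: g_def S_def)
    finally show ?thesis .
  qed
  have fin: "\<forall>i. finite (P (w @ [a]) i)" using snoc by (auto simp: P)
  have IH: "tiles (P w) {0..<S}" using snoc by (simp add: S_def)
  have "tiles (P (w @ [a])) {0..<S + len $ a}"
    unfolding tiles_def
  proof (intro conjI allI ballI impI)
    fix i x assume "x \<in> P (w @ [a]) i"
    then show "{x..<x + len $ i} \<subseteq> {0..<S + len $ a}"
      using tiles_subset[OF IH, of x i] len_pos[of a] S0 len_pos[of i] by (auto simp: P split: if_splits)
  next
    fix y assume y: "y \<in> {0..<S + len $ a}"
    show "\<exists>i. \<exists>x\<in>P (w @ [a]) i. x \<le> y \<and> y < x + len $ i"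
    proof (cases "y < S")
      case True
      then have "y \<in> {0..<S}" using y by simp
      then show ?thesis using tiles_cover[OF IH] P by (metis UnI1)
    next
      case False
      then show ?thesis using y by (intro exI[of _ a]) (auto simp: P)
    qed
  next
    fix i j x y assume a: "x \<in> P (w @ [a]) i" "y \<in> P (w @ [a]) j" "x \<le> y" "y < x + len $ i"
    have sub: "x + len $ i \<le> S" "x < S" if "x \<in> P w i" for x i
      using tile_end_le[OF IH that] by auto
    have "x = y \<and> i = j"
      using a sub[of x i] sub[of y j] tiles_eq[OF IH, of x i y j] by (auto simp: P split: if_splits)
    then show "x = y" "i = j" by auto
  qed
  then show ?case using fin by (simp add: S_def)
qed

lemma tiles_displacements: "tiles (\<lambda>i. displacements \<rho> len i j) {0..<lam * len $ j}"
  using tiles_list[of "\<rho> j"] by (simp add: displacements_def len_inflate)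

lemma finite_displacements: "finite (displacements \<rho> len i j)"
  using tiles_list[of "\<rho> j"] by (simp add: displacements_def)

lemma tiles_inflate:
  assumes Y: "tiles Y A"
  shows "tiles (inflate \<rho> lam len Y) ((*) lam ` A)"
proof -
  note D = tile_end_le[OF tiles_displacements]
  \<comment> \<open>A point of a tile of the inflation, divided by \<open>lam\<close>, lies in the
    parent tile of \<open>Y\<close>. With this, the conditions reduce to those for \<open>Y\<close>
    and for the dissected parent.\<close>
  have par: "x0 \<le> y / lam \<and> y / lam < x0 + len $ j"
    if "s \<in> displacements \<rho> len i j" "lam * x0 + s \<le> y" "y < lam * x0 + s + len $ i" for x0 s i j y
    using D[OF that(1)] that(2,3) lam_gt_1 by (simp add: field_simps)
  show ?thesis unfolding tiles_def
  proof (intro conjI allI ballI impI)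
    fix i x assume "x \<in> inflate \<rho> lam len Y i"
    then obtain j x0 s where x: "x = lam * x0 + s" "x0 \<in> Y j" "s \<in> displacements \<rho> len i j"
      by (auto simp: inflate_def)
    show "{x..<x + len $ i} \<subseteq> (*) lam ` A"
    proof
      fix y assume "y \<in> {x..<x + len $ i}"
      then have "x0 \<le> y / lam \<and> y / lam < x0 + len $ j" using par[OF x(3)] x(1) by auto
      then have "y / lam \<in> A" using tiles_subset[OF Y x(2)] by auto
      then show "y \<in> (*) lam ` A" using lam_gt_1 by (intro image_eqI[of _ _ "y / lam"]) auto
    qed
  next
    fix y assume "y \<in> (*) lam ` A"
    then obtain a where a: "a \<in> A" "y = lam * a" by auto
    obtain j x0 where x0: "x0 \<in> Y j" "x0 \<le> a" "a < x0 + len $ j" using tiles_cover[OF Y a(1)] .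
    have "y - lam * x0 \<in> {0..<lam * len $ j}" using x0 a(2) lam_gt_1
      using mult_strict_left_mono[of a "x0 + len $ j" lam] by (auto simp: algebra_simps)
    then obtain i s where s: "s \<in> displacements \<rho> len i j" "s \<le> y - lam * x0" "y - lam * x0 < s + len $ i"
      using tiles_cover[OF tiles_displacements] by blast
    show "\<exists>i. \<exists>x\<in>inflate \<rho> lam len Y i. x \<le> y \<and> y < x + len $ i"
      by (rule exI[of _ i], rule bexI[of _ "lam * x0 + s"]) (use s x0 in \<open>auto simp: inflate_def\<close>)
  next
    fix i i' x y assume a: "x \<in> inflate \<rho> lam len Y i" "y \<in> inflate \<rho> lam len Y i'" "x \<le> y" "y < x + len $ i"
    then obtain j x0 s where x: "x = lam * x0 + s" "x0 \<in> Y j" "s \<in> displacements \<rho> len i j"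
      by (auto simp: inflate_def)
    obtain j' y0 t where y: "y = lam * y0 + t" "y0 \<in> Y j'" "t \<in> displacements \<rho> len i' j'"
      using a by (auto simp: inflate_def)
    have "x0 = y0 \<and> j = j'"
      using tiles_unique[OF Y x(2) y(2), of "y / lam"] par[OF x(3), of x0 y] par[OF y(3), of y0 y] a x(1) y(1) len_pos[of i']
      by auto
    then have "s = t \<and> i = i'" using tiles_eq[OF tiles_displacements, of s i j t i'] x y a by auto
    then show "x = y" "i = i'" using x y \<open>x0 = y0 \<and> j = j'\<close> by auto
  qed
qed

section \<open>Iterated inflation and supertiles\<close>

abbreviation infl :: "nat \<Rightarrow> ('a \<Rightarrow> real set) \<Rightarrow> 'a \<Rightarrow> real set" where
  "infl n \<equiv> inflate \<rho> lam len ^^ n"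

text \<open>The level-\<open>n\<close> supertile of type \<open>j\<close> with left end at 0. Types
  are transposed against the matrices: \<open>patch n j i\<close> belongs to the entry in row
  \<open>i\<close> and column \<open>j\<close>.\<close>

definition patch :: "nat \<Rightarrow> 'a \<Rightarrow> 'a \<Rightarrow> real set" where
  "patch n j = infl n (single_tile j)"

lemma tiles_infl: "tiles Y A \<Longrightarrow> tiles (infl n Y) ((*) (lam ^ n) ` A)"
proof (induction n)
  case (Suc n)
  have "(*) lam ` (*) (lam ^ n) ` A = (*) (lam ^ Suc n) ` A" by (auto simp: image_image mult.assoc)
  then show ?case using tiles_inflate[OF Suc.IH[OF Suc.prems]] by simp
qed simp

text \<open>The \<open>n\<close>-fold inflation consists of one level-\<open>n\<close> supertile for
  each tile of \<open>Y\<close>; in the induction, the last inflation acts inside the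
  supertiles.\<close>

lemma infl_eq: "infl n Y i = {lam ^ n * x + t | x t l. x \<in> Y l \<and> t \<in> patch n l i}"
proof (induction n arbitrary: i)
  case 0
  show ?case by (auto simp: patch_def single_tile_def split: if_splits)
next
  case (Suc n)
  have "infl (Suc n) Y i = {lam * y + s | y s j. y \<in> infl n Y j \<and> s \<in> displacements \<rho> len i j}"
    by (auto simp: inflate_def)
  also have "\<dots> = {lam * (lam ^ n * x + t) + s | x t s l j. x \<in> Y l \<and> t \<in> patch n l j \<and> s \<in> displacements \<rho> len i j}"
    unfolding Suc.IH by blast
  also have "\<dots> = {lam ^ Suc n * x + (lam * t + s) | x t s l j. x \<in> Y l \<and> t \<in> patch n l j \<and> s \<in> displacements \<rho> len i j}"
    by (simp add: algebra_simps)
  also have "\<dots> = {lam ^ Suc n * x + t | x t l. x \<in> Y l \<and> t \<in> patch (Suc n) l i}"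
    unfolding patch_def by (simp add: inflate_def) blast
  finally show ?case .
qed

lemma patch_add: "patch (n + p) j = infl n (patch p j)"
  by (simp add: patch_def funpow_add)

lemma patch_0: "patch 0 j = single_tile j" by (simp add: patch_def)

lemma patch_1: "patch (Suc 0) j i = displacements \<rho> len i j"
  by (auto simp: patch_def inflate_def single_tile_def split: if_splits)

lemma tiles_single: "tiles (single_tile j) {0..<len $ j}"
  by (auto simp: tiles_def single_tile_def)

lemma tiles_patch: "tiles (patch n j) {0..<lam ^ n * len $ j}"
proof -
  have "(*) (lam ^ n) ` {0..<len $ j} = {0..<lam ^ n * len $ j}"
  proof (intro equalityI subsetI)
    fix y assume "y \<in> {0..<lam ^ n * len $ j}"
    then have "y / lam ^ n \<in> {0..<len $ j}" using lam_gt_1 by (auto simp: field_simps)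
    moreover have "y = lam ^ n * (y / lam ^ n)" using lam_gt_1 by simp
    ultimately show "y \<in> (*) (lam ^ n) ` {0..<len $ j}" by blast
  qed (use lam_power_pos[of n] in auto)
  then show ?thesis using tiles_infl[OF tiles_single, of n j] by (simp add: patch_def)
qed

lemmas patch_bounds = tile_end_le[OF tiles_patch]

lemma finite_patch: "finite (patch n j i)"
proof (rule tiles_finite_card(1)[OF tiles_patch order.refl])
  show "patch n j i \<subseteq> {0..0 + lam ^ n * len $ j}"
  proof
    fix x assume "x \<in> patch n j i"
    from patch_bounds(1,3)[OF this] show "x \<in> {0..0 + lam ^ n * len $ j}" by simp
  qed
  show "0 \<le> lam ^ n * len $ j" using lam_gt_1 len_pos[of j] by (auto intro: less_imp_le)
qed

lemma finite_tile_set_patch: "finite (tile_set (patch n j))"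
proof -
  have "tile_set (patch n j) = (\<Union>i. (\<lambda>x. (x, i)) ` patch n j i)" by (auto simp: tile_set_def)
  then show ?thesis by (simp add: finite_patch)
qed

lemma sum_tile_set_patch:
  "(\<Sum>(x, i)\<in>tile_set (patch n j). f x i) = (\<Sum>i\<in>UNIV. \<Sum>x\<in>patch n j i. f x i)"
proof -
  have "(\<Sum>i\<in>UNIV. \<Sum>x\<in>patch n j i. f x i) = (\<Sum>(i, x)\<in>(SIGMA i:UNIV. patch n j i). f x i)"
    by (rule sum.Sigma) (auto simp: finite_patch)
  also have "\<dots> = (\<Sum>(x, i)\<in>tile_set (patch n j). f x i)"
    by (rule sum.reindex_bij_witness[of _ "\<lambda>(x, i). (i, x)" "\<lambda>(i, x). (x, i)"]) auto
  finally show ?thesis by simp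
qed

text \<open>The tiles exhaust the supertile. This is what later makes the averaging weights in
  \<open>patch_freq_converges\<close> sum to 1.\<close>

lemma sum_len_patch: "(\<Sum>i\<in>UNIV. len $ i * real (card (patch n j i))) = lam ^ n * len $ j"
proof -
  have "(\<Union>(x, i)\<in>tile_set (patch n j). {x..<x + len $ i}) = {0..<lam ^ n * len $ j}"
  proof (intro equalityI subsetI)
    fix y assume "y \<in> {0..<lam ^ n * len $ j}"
    then obtain i x where "x \<in> patch n j i" "x \<le> y" "y < x + len $ i"
      using tiles_cover[OF tiles_patch] by blast
    then show "y \<in> (\<Union>(x, i)\<in>tile_set (patch n j). {x..<x + len $ i})"
      by (intro UN_I[of "(x, i)"]) auto
  qed (use tiles_subset[OF tiles_patch] in fastforce)
  then have "(\<Sum>(x, i)\<in>tile_set (patch n j). len $ i) = lam ^ n * len $ j"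
    using sum_len_eq_measure[OF tiles_patch finite_tile_set_patch order.refl, of n j]
      lam_power_pos[of n] len_pos[of j] by simp
  then show ?thesis by (simp add: sum_tile_set_patch mult.commute)
qed

lemma card_patch_le: "real (card (tile_set (patch n j))) \<le> lam ^ n * len $ j / rmin"
proof -
  have "real (card (tile_set (patch n j))) = (\<Sum>(x, i)\<in>tile_set (patch n j). 1)" by simp
  also have "\<dots> = (\<Sum>i\<in>UNIV. real (card (patch n j i)))" by (simp only: sum_tile_set_patch) simp
  finally have "rmin * real (card (tile_set (patch n j))) = (\<Sum>i\<in>UNIV. rmin * real (card (patch n j i)))"
    by (simp add: sum_distrib_left)
  also have "\<dots> \<le> (\<Sum>i\<in>UNIV. len $ i * real (card (patch n j i)))"
    by (intro sum_mono mult_right_mono) (auto simp: rmin_le)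
  finally show ?thesis using rmin_pos by (simp add: sum_len_patch field_simps)
qed

lemma card_patch_type_le: "real (card (patch n j i)) \<le> lam ^ n * len $ j / rmin"
proof -
  have "card (patch n j i) = card ((\<lambda>x. (x, i)) ` patch n j i)" by (simp add: card_image inj_on_def)
  also have "\<dots> \<le> card (tile_set (patch n j))"
    by (rule card_mono) (auto simp: finite_tile_set_patch)
  finally show ?thesis using card_patch_le[of n j] by linarith
qed

text \<open>Division by \<open>lam ^ n\<close> reduces the claim to \<open>tiles_unique\<close> for
  \<open>Z\<close> at the point \<open>y + t / lam ^ n\<close>.\<close>

lemma supertile_unique:
  assumes Z: "tiles Z A" and "y \<in> Z l" "t \<in> patch n l i" "y' \<in> Z l'"
    "lam ^ n * y' \<le> lam ^ n * y + t" "lam ^ n * y + t < lam ^ n * y' + lam ^ n * len $ l'"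
  shows "y = y' \<and> l = l'"
proof -
  have t: "0 \<le> t" "t < lam ^ n * len $ l" using patch_bounds[OF assms(3)] by auto
  have "lam ^ n * (y + t / lam ^ n) = lam ^ n * y + t"
    using lam_gt_1 by (simp add: field_simps)
  then have "y' \<le> y + t / lam ^ n" "y + t / lam ^ n < y' + len $ l'"
    using assms(5,6) lam_power_pos[of n] by (metis mult_le_cancel_left_pos, metis distrib_left mult_less_cancel_left_pos)
  moreover have "0 \<le> t / lam ^ n" "t / lam ^ n < len $ l"
    using t lam_power_pos[of n] by (auto simp: field_simps)
  ultimately show ?thesis
    using tiles_unique[OF Z assms(2,4), of "y + t / lam ^ n"] by linarith
qed

end

section \<open>Uniform pair frequencies\<close>

text \<open>A perturbed form of the convergence of powers of a positive stochastic matrix. Up to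
  \<open>e n\<close>, the values \<open>g (n + p)\<close> are averages of \<open>g n\<close>, so
  their range can hardly widen; for \<open>p = q\<close> every average gives weight at least
  \<open>\<delta>\<close> to the index of the minimum, which shrinks the range by the factor
  \<open>1 - \<delta>\<close>. Since the error is uniform in \<open>p\<close>, errors do not
  accumulate and \<open>e\<close> only has to tend to 0.\<close>

lemma averaging_converges:
  fixes g :: "nat \<Rightarrow> 'a::finite \<Rightarrow> real" and w :: "nat \<Rightarrow> 'a \<Rightarrow> 'a \<Rightarrow> real"
  assumes w0: "\<And>p b l. 0 \<le> w p b l" and w1: "\<And>p b. (\<Sum>l\<in>UNIV. w p b l) = 1"
    and pos: "\<And>b l. 0 < w q b l"
    and step: "\<And>n p b. \<bar>g (n + p) b - (\<Sum>l\<in>UNIV. w p b l * g n l)\<bar> \<le> e n"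
    and e: "e \<longlonglongrightarrow> 0"
  shows "\<exists>\<nu>. \<forall>b. (\<lambda>n. g n b) \<longlonglongrightarrow> \<nu>"
proof -
  define M where "M n = Max (range (g n))" for n
  define m where "m n = Min (range (g n))" for n
  define \<delta> where "\<delta> = Min (range (\<lambda>(b, l). w q b l))"
  have M: "g n b \<le> M n" and m: "m n \<le> g n b" for n b
    unfolding M_def m_def by auto
  have e0: "0 \<le> e n" for n using step[of n 0] by (meson abs_ge_zero order.trans)
  have \<delta>: "0 < \<delta>" unfolding \<delta>_def by (subst Min_gr_iff) (auto simp: pos)
  have \<delta>le: "\<delta> \<le> w q b l" for b l unfolding \<delta>_def by (rule Min_le) (auto intro: rev_image_eqI[of "(b,l)"])
  have avg: "(\<Sum>l\<in>UNIV. w p b l * g n l) \<le> M n" "m n \<le> (\<Sum>l\<in>UNIV. w p b l * g n l)" for p b n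
  proof -
    have "(\<Sum>l\<in>UNIV. w p b l * g n l) \<le> (\<Sum>l\<in>UNIV. w p b l * M n)"
      by (intro sum_mono mult_left_mono M w0)
    then show "(\<Sum>l\<in>UNIV. w p b l * g n l) \<le> M n" by (simp add: sum_distrib_right[symmetric] w1)
    have "(\<Sum>l\<in>UNIV. w p b l * m n) \<le> (\<Sum>l\<in>UNIV. w p b l * g n l)"
      by (intro sum_mono mult_left_mono m w0)
    then show "m n \<le> (\<Sum>l\<in>UNIV. w p b l * g n l)" by (simp add: sum_distrib_right[symmetric] w1)
  qed
  have later: "g (n + p) b \<le> M n + e n" "m n - e n \<le> g (n + p) b" for n p b
    using avg(1)[of p b n] avg(2)[of n p b] step[of n p b] by linarith+
  have contract: "M (n + q) - m (n + q) \<le> (1 - \<delta>) * (M n - m n) + 2 * e n" for n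
  proof -
    have "m n \<in> range (g n)" unfolding m_def by (rule Min_in) auto
    then obtain l0 where l0: "g n l0 = m n" by auto
    have "(\<Sum>l\<in>UNIV. w q b l * g n l) \<le> M n - \<delta> * (M n - m n)" for b
    proof -
      have "\<delta> * (M n - m n) \<le> w q b l0 * (M n - g n l0)"
        unfolding l0 using M[of n l0] l0 by (intro mult_right_mono \<delta>le) auto
      also have "\<dots> \<le> (\<Sum>l\<in>UNIV. w q b l * (M n - g n l))"
        by (rule member_le_sum) (auto intro!: mult_nonneg_nonneg w0 simp: M)
      also have "\<dots> = M n - (\<Sum>l\<in>UNIV. w q b l * g n l)"
        by (simp add: right_diff_distrib sum_subtractf sum_distrib_right[symmetric] w1)
      finally show ?thesis by linarith
    qed
    note up = this
    have "g (n + q) b \<le> M n - \<delta> * (M n - m n) + e n" for b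
      using step[of n q b] up[of b] by linarith
    moreover have "M (n + q) \<in> range (g (n + q))" unfolding M_def by (rule Max_in) auto
    ultimately have "M (n + q) \<le> M n - \<delta> * (M n - m n) + e n" by auto
    moreover have "m (n + q) \<in> range (g (n + q))" unfolding m_def by (rule Min_in) auto
    then have "m n - e n \<le> m (n + q)" using later(2)[of n q] by auto
    ultimately show ?thesis by (simp add: algebra_simps)
  qed
  \<comment> \<open>Otherwise the range would fall by a fixed amount in every \<open>q\<close> steps
    and become negative.\<close>
  have small: "\<exists>n. M n - m n + 2 * e n < \<epsilon>" if \<epsilon>: "0 < \<epsilon>" for \<epsilon>
  proof (rule ccontr)
    assume "\<not> ?thesis"
    then have ge: "\<epsilon> \<le> M n - m n + 2 * e n" for n by (simp add: not_less)
    \<comment> \<open>Capping at 1 makes \<open>e n\<close> less than \<open>\<epsilon> / 8\<close>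
      as well, so that the range stays above \<open>\<epsilon> / 2\<close>. The gain
      \<open>\<delta>' * \<epsilon> / 2\<close> minus the error \<open>2 * e n\<close>, which is
      below \<open>\<delta>' * \<epsilon> / 4\<close>, leaves the drop used in
      \<open>dec\<close>.\<close>
    define \<delta>' where "\<delta>' = min \<delta> 1"
    have \<delta>': "0 < \<delta>'" "\<delta>' \<le> \<delta>" "\<delta>' \<le> 1" using \<delta> by (auto simp: \<delta>'_def)
    have "0 < \<delta>' * \<epsilon> / 8" using \<delta>' \<epsilon> by simp
    then obtain N where N: "\<And>n. n \<ge> N \<Longrightarrow> e n < \<delta>' * \<epsilon> / 8"
      using order_tendstoD(2)[OF e] unfolding eventually_sequentially by blast
    have dec: "M (n + q) - m (n + q) \<le> M n - m n - \<delta>' * \<epsilon> / 4" if "n \<ge> N" for n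
    proof -
      have "\<delta>' * \<epsilon> \<le> \<epsilon>" using \<delta>' \<epsilon> by simp
      then have "\<epsilon> / 2 \<le> M n - m n" using ge[of n] N[OF that] \<epsilon> by linarith
      then have "\<delta>' * (\<epsilon> / 2) \<le> \<delta> * (M n - m n)" using \<delta>' \<epsilon> by (intro mult_mono) auto
      then show ?thesis using contract[of n] N[OF that] by (simp add: algebra_simps)
    qed
    have "M (N + k * q) - m (N + k * q) \<le> M N - m N - real k * (\<delta>' * \<epsilon> / 4)" for k
    proof (induction k)
      case (Suc k)
      have "real (Suc k) * (\<delta>' * \<epsilon> / 4) = real k * (\<delta>' * \<epsilon> / 4) + \<delta>' * \<epsilon> / 4"
        by (simp only: of_nat_Suc distrib_right mult_1_left add.commute)
      moreover have "N + Suc k * q = N + k * q + q" by simp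
      moreover note dec[of "N + k * q"]
      ultimately show ?case using Suc by (smt (verit) le_add1)
    qed simp
    moreover have "0 \<le> M k - m k" for k using M[of k undefined] m[of k undefined] by linarith
    ultimately have "real k * (\<delta>' * \<epsilon> / 4) \<le> M N - m N" for k by (smt (verit))
    moreover obtain k where "M N - m N < real k * (\<delta>' * \<epsilon> / 4)"
      using ex_less_of_nat_mult[of "\<delta>' * \<epsilon> / 4" "M N - m N"] \<delta>' \<epsilon> by auto
    ultimately show False by (metis not_less)
  qed
  have close: "\<exists>n. \<forall>k\<ge>n. \<forall>k'\<ge>n. \<forall>b b'. \<bar>g k b - g k' b'\<bar> < \<epsilon>" if "0 < \<epsilon>" for \<epsilon>
  proof -
    obtain n where n: "M n - m n + 2 * e n < \<epsilon>" using small[OF \<open>0 < \<epsilon>\<close>] by auto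
    have "g k b \<le> M n + e n" "m n - e n \<le> g k b" if "k \<ge> n" for k b
      using later[of n "k - n" b] that by auto
    then show ?thesis using n by (intro exI[of _ n]) (smt (verit))
  qed
  \<comment> \<open>\<open>undefined\<close> is some fixed index; \<open>close\<close> compares all
    the others with it.\<close>
  have "Cauchy (\<lambda>n. g n undefined)"
    unfolding Cauchy_def dist_real_def using close by blast
  then obtain \<nu> where \<nu>: "(\<lambda>n. g n undefined) \<longlonglongrightarrow> \<nu>"
    using Cauchy_convergent convergent_def by blast
  have "(\<lambda>n. g n b) \<longlonglongrightarrow> \<nu>" for b
  proof (rule LIMSEQ_I)
    fix r :: real assume r: "0 < r"
    obtain n1 where "\<forall>k\<ge>n1. norm (g k undefined - \<nu>) < r / 2" using LIMSEQ_D[OF \<nu>, of "r / 2"] r by auto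
    moreover obtain n2 where "\<forall>k\<ge>n2. \<forall>k'\<ge>n2. \<forall>b b'. \<bar>g k b - g k' b'\<bar> < r / 2" using close[of "r / 2"] r by auto
    ultimately show "\<exists>no. \<forall>n\<ge>no. norm (g n b - \<nu>) < r"
      by (intro exI[of _ "max n1 n2"]) (smt (verit) max.boundedE real_norm_def field_sum_of_halves)
  qed
  then show ?thesis by blast
qed

section \<open>Counting pairs of tiles by supertiles\<close>

context inflation_rule
begin

lemma infl_in_block:
  assumes "tiles Z A" "y \<in> Z l" "x \<in> infl n Z i" "lam ^ n * y \<le> x" "x < lam ^ n * y + lam ^ n * len $ l"
  shows "x - lam ^ n * y \<in> patch n l i"
proof -
  obtain y' t l' where x: "x = lam ^ n * y' + t" "y' \<in> Z l'" "t \<in> patch n l' i"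
    using assms(3) unfolding infl_eq by blast
  then have "y' = y \<and> l' = l" using supertile_unique[OF assms(1) x(2,3) assms(2)] assms(4,5) by simp
  then show ?thesis using x by simp
qed

lemma infl_memI: "y \<in> Z l \<Longrightarrow> t \<in> patch n l i \<Longrightarrow> lam ^ n * y + t \<in> infl n Z i"
  unfolding infl_eq by blast

abbreviation patch_count :: "nat \<Rightarrow> 'a \<Rightarrow> 'a \<Rightarrow> 'a \<Rightarrow> real \<Rightarrow> nat" where
  "patch_count n l i j z \<equiv> pair_count (patch n l) i j z UNIV"

definition cross_bound :: "real \<Rightarrow> real" where
  "cross_bound z = 2 * (\<bar>z\<bar> / rmin + 1)"

text \<open>A shift by \<open>z\<close> leaves the supertile only from layers of width
  \<open>\<bar>z\<bar>\<close> at its two ends, whatever the level \<open>n\<close>.\<close>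

lemma card_cross:
  "real (card {t \<in> patch n l i. t + z \<notin> {0..<lam ^ n * len $ l}}) \<le> cross_bound z"
proof -
  define L where "L = lam ^ n * len $ l"
  define S1 where "S1 = patch n l i \<inter> {0..0 + \<bar>z\<bar>}"
  define S2 where "S2 = patch n l i \<inter> {L - \<bar>z\<bar>..L - \<bar>z\<bar> + \<bar>z\<bar>}"
  have fin: "finite S1" "finite S2" unfolding S1_def S2_def by (simp_all add: finite_patch)
  have "{t \<in> patch n l i. t + z \<notin> {0..<L}} \<subseteq> S1 \<union> S2"
  proof
    fix t assume t: "t \<in> {t \<in> patch n l i. t + z \<notin> {0..<L}}"
    then have "0 \<le> t" "t < L" using patch_bounds(1,3)[of t n l i] by (auto simp: L_def)
    then show "t \<in> S1 \<union> S2" using t unfolding S1_def S2_def by (auto simp: not_le not_less)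
  qed
  then have "card {t \<in> patch n l i. t + z \<notin> {0..<L}} \<le> card (S1 \<union> S2)"
    using fin by (intro card_mono) auto
  also have "\<dots> \<le> card S1 + card S2" by (rule card_Un_le)
  finally have "real (card {t \<in> patch n l i. t + z \<notin> {0..<L}}) \<le> real (card S1) + real (card S2)" by linarith
  moreover have "real (card S1) \<le> \<bar>z\<bar> / rmin + 1"
    by (rule tiles_finite_card(2)[OF tiles_patch]) (auto simp: S1_def)
  moreover have "real (card S2) \<le> \<bar>z\<bar> / rmin + 1"
    by (rule tiles_finite_card(2)[OF tiles_patch]) (auto simp: S2_def)
  ultimately show ?thesis unfolding cross_bound_def L_def distrib_left by linarith
qed

text \<open>
  Pairs inside a common supertile are counted by the patch counts. The remaining pairs have their
  first point near the end of a supertile, or outside of the supertiles in \<open>Q\<close>.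
\<close>

lemma supertile_count:
  assumes Z: "tiles Z A" and Q: "Q \<subseteq> tile_set Z" "finite Q"
    and W: "\<And>y l t. (y, l) \<in> Q \<Longrightarrow> t \<in> patch n l i \<Longrightarrow> lam ^ n * y + t \<in> W"
    and fin: "finite {x \<in> infl n Z i. x \<in> W}"
    and rem: "real (card {x \<in> infl n Z i. x \<in> W \<and>
        (\<forall>(y, l)\<in>Q. x \<notin> {lam ^ n * y..<lam ^ n * y + lam ^ n * len $ l})}) \<le> e"
  shows "\<bar>real (pair_count (infl n Z) i j z W) - (\<Sum>(y, l)\<in>Q. real (patch_count n l i j z))\<bar>
    \<le> real (card Q) * cross_bound z + e"
proof -
  define S where "S = {x \<in> infl n Z i. x + z \<in> infl n Z j \<and> x \<in> W}"
  define block where "block = (\<lambda>(y, l). {lam ^ n * y..<lam ^ n * y + lam ^ n * len $ l})"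
  define R where "R = {x \<in> S. \<forall>q\<in>Q. x \<notin> block q}"
  define C where "C q = {x \<in> S. x \<in> block q}" for q
  have finS: "finite S" by (rule finite_subset[OF _ fin]) (auto simp: S_def)
  have disj: "C q \<inter> C q' = {}" if "q \<in> Q" "q' \<in> Q" "q \<noteq> q'" for q q'
  proof (rule ccontr)
    assume "C q \<inter> C q' \<noteq> {}"
    then obtain x where x: "x \<in> S" "x \<in> block q" "x \<in> block q'" by (auto simp: C_def)
    obtain y l where q: "q = (y, l)" by force
    obtain y' l' where q': "q' = (y', l')" by force
    have y: "y \<in> Z l" "y' \<in> Z l'" using that Q q q' by auto
    have "x - lam ^ n * y \<in> patch n l i"
      using infl_in_block[OF Z y(1), of x n i] x by (auto simp: S_def block_def q)
    then have "y = y' \<and> l = l'" using supertile_unique[OF Z y(1) _ y(2)] x by (auto simp: block_def q')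
    then show False using that q q' by simp
  qed
  have S_eq: "S = (\<Union>q\<in>Q. C q) \<union> R" by (auto simp: C_def R_def)
  have "card S = card (\<Union>q\<in>Q. C q) + card R"
    unfolding S_eq using finS by (intro card_Un_disjoint) (auto simp: C_def R_def finite_subset Q)
  also have "card (\<Union>q\<in>Q. C q) = (\<Sum>q\<in>Q. card (C q))"
    using finS disj by (intro card_UN_disjoint) (auto simp: C_def Q)
  finally have card_S: "real (card S) = (\<Sum>q\<in>Q. real (card (C q))) + real (card R)" by simp
  have "card R \<le> card {x \<in> infl n Z i. x \<in> W \<and>
        (\<forall>(y, l)\<in>Q. x \<notin> {lam ^ n * y..<lam ^ n * y + lam ^ n * len $ l})}"
    by (rule card_mono, rule finite_subset[OF _ fin]) (auto simp: R_def S_def block_def)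
  then have R: "real (card R) \<le> e" using rem by linarith
  \<comment> \<open>A block contains a translate of every pair of the supertile. A surplus pair has
    its partner outside of the block, so \<open>card_cross\<close> bounds their number.\<close>
  have C: "real (patch_count n l i j z) \<le> real (card (C (y, l)))"
    "real (card (C (y, l))) \<le> real (patch_count n l i j z) + cross_bound z" if yl: "(y, l) \<in> Q" for y l
  proof -
    define P where "P = {t \<in> patch n l i. t + z \<in> patch n l j}"
    define B where "B = {t \<in> patch n l i. t + z \<notin> {0..<lam ^ n * len $ l}}"
    have y: "y \<in> Z l" using yl Q by auto
    have finPB: "finite P" "finite B" unfolding P_def B_def by (simp_all add: finite_patch)
    have inj: "inj_on (\<lambda>t. lam ^ n * y + t) T" for T by (simp add: inj_on_def)
    have pc: "patch_count n l i j z = card P" by (simp add: pair_count_def P_def)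
    have "(\<lambda>t. lam ^ n * y + t) ` P \<subseteq> C (y, l)"
    proof
      fix x assume "x \<in> (\<lambda>t. lam ^ n * y + t) ` P"
      then obtain t where t: "x = lam ^ n * y + t" "t \<in> patch n l i" "t + z \<in> patch n l j"
        by (auto simp: P_def)
      have "x + z \<in> infl n Z j" using infl_memI[of y Z l "t + z" n j] y t(1,3) by (simp add: add.assoc)
      then show "x \<in> C (y, l)"
        using infl_memI[of y Z l t n i] t y W[OF yl t(2)] patch_bounds(1,3)[OF t(2)] by (simp add: C_def S_def block_def)
    qed
    then have "card ((\<lambda>t. lam ^ n * y + t) ` P) \<le> card (C (y, l))"
      using finS by (intro card_mono) (auto simp: C_def)
    then show "real (patch_count n l i j z) \<le> real (card (C (y, l)))"
      by (simp add: pc card_image inj)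
    have "C (y, l) \<subseteq> (\<lambda>t. lam ^ n * y + t) ` (P \<union> B)"
    proof
      fix x assume "x \<in> C (y, l)"
      then have x: "x \<in> infl n Z i" "x + z \<in> infl n Z j" "lam ^ n * y \<le> x" "x < lam ^ n * y + lam ^ n * len $ l"
        by (auto simp: C_def S_def block_def)
      have 1: "x - lam ^ n * y \<in> patch n l i" by (rule infl_in_block[OF Z y x(1,3,4)])
      have "x - lam ^ n * y \<in> P \<union> B"
      proof (cases "x - lam ^ n * y + z \<in> {0..<lam ^ n * len $ l}")
        case True
        then have "x + z - lam ^ n * y \<in> patch n l j" by (intro infl_in_block[OF Z y x(2)]) auto
        then show ?thesis using 1 by (simp add: P_def algebra_simps)
      qed (use 1 in \<open>simp add: B_def\<close>)
      then show "x \<in> (\<lambda>t. lam ^ n * y + t) ` (P \<union> B)" by (intro image_eqI[of _ _ "x - lam ^ n * y"]) auto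
    qed
    then have "card (C (y, l)) \<le> card ((\<lambda>t. lam ^ n * y + t) ` (P \<union> B))"
      using finPB by (intro card_mono) auto
    also have "\<dots> \<le> card P + card B" by (simp add: card_image inj card_Un_le)
    finally show "real (card (C (y, l))) \<le> real (patch_count n l i j z) + cross_bound z"
      using card_cross[of n l i z] unfolding pc B_def by linarith
  qed
  have "(\<Sum>(y, l)\<in>Q. real (patch_count n l i j z)) \<le> (\<Sum>q\<in>Q. real (card (C q)))"
    by (rule sum_mono) (use C(1) in \<open>auto simp: split_beta\<close>)
  moreover have "(\<Sum>q\<in>Q. real (card (C q))) \<le> (\<Sum>(y, l)\<in>Q. real (patch_count n l i j z) + cross_bound z)"
    by (rule sum_mono) (use C(2) in \<open>auto simp: split_beta\<close>)
  moreover have "\<dots> = (\<Sum>(y, l)\<in>Q. real (patch_count n l i j z)) + real (card Q) * cross_bound z"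
    by (simp add: split_beta sum.distrib)
  moreover have "pair_count (infl n Z) i j z W = card S" by (simp add: pair_count_def S_def)
  moreover have "0 \<le> real (card R)" by simp
  moreover have "0 \<le> real (card Q) * cross_bound z"
    using rmin_pos by (simp add: cross_bound_def)
  ultimately show ?thesis using card_S R by linarith
qed

text \<open>The renormalisation of pair counts. Its error does not depend on \<open>n\<close>, hence
  is negligible after division by \<open>lam ^ (n + p)\<close>. With all tiles of
  \<open>patch p b\<close> taken as \<open>Q\<close>, no first point remains outside of the
  supertiles.\<close>

lemma patch_count_add:
  "\<bar>real (patch_count (n + p) b i j z) - (\<Sum>l\<in>UNIV. real (card (patch p b l)) * real (patch_count n l i j z))\<bar>
    \<le> lam ^ p * len $ b / rmin * cross_bound z"
proof -
  have empty: "{x \<in> infl n (patch p b) i. x \<in> UNIV \<and>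
      (\<forall>(y, l)\<in>tile_set (patch p b). x \<notin> {lam ^ n * y..<lam ^ n * y + lam ^ n * len $ l})} = {}"
  proof -
    have False if mem: "x \<in> infl n (patch p b) i"
      and out: "\<forall>(y, l)\<in>tile_set (patch p b). x \<notin> {lam ^ n * y..<lam ^ n * y + lam ^ n * len $ l}" for x
    proof -
      obtain y t l where x: "x = lam ^ n * y + t" "y \<in> patch p b l" "t \<in> patch n l i"
        using mem unfolding infl_eq by blast
      then have "(y, l) \<in> tile_set (patch p b)" by simp
      then have "x \<notin> {lam ^ n * y..<lam ^ n * y + lam ^ n * len $ l}" using out by blast
      then show False using patch_bounds(1,3)[OF x(3)] x(1) by simp
    qed
    then show ?thesis by blast
  qed
  have "\<bar>real (pair_count (infl n (patch p b)) i j z UNIV)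
      - (\<Sum>(y, l)\<in>tile_set (patch p b). real (patch_count n l i j z))\<bar>
    \<le> real (card (tile_set (patch p b))) * cross_bound z + 0"
  proof (rule supertile_count[OF tiles_patch order.refl finite_tile_set_patch])
    show "finite {x \<in> infl n (patch p b) i. x \<in> UNIV}"
      using finite_patch[of "n + p" b i] by (simp add: patch_add)
  qed (simp_all only: empty, simp_all)
  then have "\<bar>real (patch_count (n + p) b i j z) - (\<Sum>l\<in>UNIV. real (card (patch p b l)) * real (patch_count n l i j z))\<bar>
    \<le> real (card (tile_set (patch p b))) * cross_bound z"
    by (simp add: patch_add sum_tile_set_patch)
  also have "\<dots> \<le> lam ^ p * len $ b / rmin * cross_bound z"
    by (intro mult_right_mono card_patch_le) (use rmin_pos in \<open>simp add: cross_bound_def\<close>)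
  finally show ?thesis .
qed

text \<open>Only positivity is followed through the induction, so the entries of the matrix power
  need not be identified with numbers of tiles.\<close>

lemma patch_nonempty_primitive: "\<exists>q. \<forall>b l. patch q b l \<noteq> {}"
proof -
  define M where "M = subst_matrix \<rho>"
  \<comment> \<open>\<open>mat_power\<close> multiplies on the left, whereas
    \<open>patch_add\<close> splits off the first inflation, which is the factor on the
    right.\<close>
  have mat_power_Suc: "mat_power M (Suc n) = mat_power M n ** M" for n
    by (induction n) (simp_all add: mat_power_def matrix_mul_assoc)
  have "0 \<le> mat_power M n $ l $ b \<and> (0 < mat_power M n $ l $ b \<longrightarrow> patch n b l \<noteq> {})" for n l b
  proof (induction n arbitrary: l b)
    case 0
    show ?case by (simp add: mat_power_def patch_0 single_tile_def mat_def)
  next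
    case (Suc n)
    have eq: "mat_power M (Suc n) $ l $ b = (\<Sum>k\<in>UNIV. mat_power M n $ l $ k * M $ k $ b)"
      unfolding mat_power_Suc by (simp add: matrix_matrix_mult_def)
    have M0: "0 \<le> M $ k $ b" for k by (simp add: M_def subst_matrix_def)
    have "patch (Suc n) b l \<noteq> {}" if pos: "0 < mat_power M (Suc n) $ l $ b"
    proof -
      have "\<exists>k. 0 < mat_power M n $ l $ k * M $ k $ b"
        using pos unfolding eq by (meson not_less sum_nonpos)
      then obtain k where k: "0 < mat_power M n $ l $ k * M $ k $ b" by auto
      then have "0 < mat_power M n $ l $ k" "0 < M $ k $ b"
        using Suc.IH[of l k] M0[of k] by (auto simp: zero_less_mult_iff)
      then obtain t where t: "t \<in> patch n k l" using Suc.IH by auto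
      have "k \<in> set (\<rho> b)" using \<open>0 < M $ k $ b\<close>
        by (auto simp: M_def subst_matrix_def) (metis count_notin less_irrefl)
      then obtain m where "m < length (\<rho> b)" "\<rho> b ! m = k" by (auto simp: in_set_conv_nth)
      then obtain s where "s \<in> displacements \<rho> len k b" unfolding displacements_def by blast
      then have "lam ^ n * s + t \<in> infl n (patch (Suc 0) b) l" using t by (intro infl_memI) (auto simp: patch_1)
      then show ?thesis using patch_add[of n "Suc 0" b] by auto
    qed
    then show ?case unfolding eq using Suc.IH M0 by (auto intro!: sum_nonneg mult_nonneg_nonneg)
  qed
  then show ?thesis using primitive unfolding M_def by meson
qed

text \<open>\<open>w p b l\<close> is the fraction of the length of the level-\<open>p\<close>
  supertile of type \<open>b\<close> that is covered by tiles of type \<open>l\<close>. For pair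
  counts per unit length, \<open>patch_count_add\<close> becomes an averaging step with error of
  order \<open>(1 / lam) ^ n\<close>, and primitivity makes all weights positive at some level
  \<open>q\<close>.\<close>

lemma patch_freq_converges:
  "\<exists>\<nu>. \<forall>b. (\<lambda>n. real (patch_count n b i j z) / (lam ^ n * len $ b)) \<longlonglongrightarrow> \<nu>"
proof -
  obtain q where q: "\<And>b l. patch q b l \<noteq> {}" using patch_nonempty_primitive by auto
  define w where "w p b l = real (card (patch p b l)) * len $ l / (lam ^ p * len $ b)" for p b l
  define e where "e n = cross_bound z / rmin * (1 / lam) ^ n" for n
  have lp: "0 < lam ^ n * len $ b" for n b using lam_power_pos len_pos by simp
  show ?thesis
  proof (rule averaging_converges[where w = w and q = q and e = e])
    show "0 \<le> w p b l" for p b l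
      using lp[of p b] len_pos[of l] by (simp add: w_def less_imp_le)
    show "(\<Sum>l\<in>UNIV. w p b l) = 1" for p b
      using sum_len_patch[of p b] less_imp_neq[OF lp[of p b]]
      unfolding w_def sum_divide_distrib[symmetric] by (simp add: mult.commute[of "real _"])
    show "0 < w q b l" for b l
    proof -
      have "0 < card (patch q b l)" using q finite_patch by (simp add: card_gt_0_iff)
      then show ?thesis unfolding w_def using lp[of q b] len_pos[of l] by (intro divide_pos_pos mult_pos_pos[of "real _"]) auto
    qed
    have "(\<lambda>n. (1 / lam) ^ n) \<longlonglongrightarrow> 0" using lam_gt_1 by (intro LIMSEQ_realpow_zero) auto
    then show "e \<longlonglongrightarrow> 0" unfolding e_def by (rule tendsto_mult_right_zero)
    fix n p b
    let ?g = "\<lambda>n b. real (patch_count n b i j z) / (lam ^ n * len $ b)"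
    have "?g (n + p) b - (\<Sum>l\<in>UNIV. w p b l * ?g n l) =
      (real (patch_count (n + p) b i j z) - (\<Sum>l\<in>UNIV. real (card (patch p b l)) * real (patch_count n l i j z)))
        / (lam ^ (n + p) * len $ b)"
    proof -
      have "w p b l * ?g n l = real (card (patch p b l)) * real (patch_count n l i j z) / (lam ^ (n + p) * len $ b)" for l
        using len_pos[of l] by (simp add: w_def power_add)
      then show ?thesis by (simp add: diff_divide_distrib sum_divide_distrib)
    qed
    also have "\<bar>\<dots>\<bar> \<le> lam ^ p * len $ b / rmin * cross_bound z / (lam ^ (n + p) * len $ b)"
      unfolding abs_divide abs_of_pos[OF lp] using lp[of "n + p" b]
      by (intro divide_right_mono patch_count_add) simp
    also have "\<dots> = e n" using lam_gt_1 len_pos[of b] by (simp add: e_def power_add power_divide)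
    finally show "\<bar>?g (n + p) b - (\<Sum>l\<in>UNIV. w p b l * ?g n l)\<bar> \<le> e n" .
  qed
qed

definition freq :: "'a \<Rightarrow> 'a \<Rightarrow> real \<Rightarrow> real" where
  "freq i j z = (SOME \<nu>. \<forall>b. (\<lambda>n. real (patch_count n b i j z) / (lam ^ n * len $ b)) \<longlonglongrightarrow> \<nu>)"

lemma patch_freq: "(\<lambda>n. real (patch_count n b i j z) / (lam ^ n * len $ b)) \<longlonglongrightarrow> freq i j z"
  using someI_ex[OF patch_freq_converges[of i j z]] unfolding freq_def by blast

text \<open>Weighted with the tile lengths, the frequencies add up to 1. Positivity is needed to
  cancel the density against the denominator in \<open>pair_corr\<close>.\<close>

lemma sum_freq_pos: "0 < (\<Sum>i\<in>UNIV. freq i i 0)"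
proof -
  have lim: "(\<lambda>n. \<Sum>i\<in>UNIV. len $ i * (real (patch_count n b i i 0) / (lam ^ n * len $ b)))
     \<longlonglongrightarrow> (\<Sum>i\<in>UNIV. len $ i * freq i i 0)" for b
    by (intro tendsto_intros patch_freq)
  have "(\<Sum>i\<in>UNIV. len $ i * (real (patch_count n b i i 0) / (lam ^ n * len $ b))) = 1" for n b
  proof -
    have "lam ^ n * len $ b \<noteq> 0" using lam_gt_1 len_pos[of b] by simp
    then show ?thesis using sum_len_patch[of n b]
      by (simp add: pair_count_def sum_divide_distrib[symmetric])
  qed
  then have "(\<Sum>i\<in>UNIV. len $ i * freq i i 0) = 1" using LIMSEQ_unique[OF lim, of undefined 1] by simp
  moreover have nonneg: "0 \<le> freq i i 0" for i
    by (rule LIMSEQ_le_const[OF patch_freq]) (use lam_gt_1 len_pos in \<open>auto intro!: exI[of _ 0] simp: less_imp_le\<close>)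
  moreover have "(\<Sum>i\<in>UNIV. len $ i * freq i i 0) \<le> (\<Sum>i\<in>UNIV. rmax * freq i i 0)"
    by (intro sum_mono mult_right_mono rmax_ge nonneg)
  ultimately have "1 \<le> rmax * (\<Sum>i\<in>UNIV. freq i i 0)" by (simp add: sum_distrib_left)
  then show ?thesis using rmax_pos by (metis less_le_trans zero_less_mult_pos zero_less_one)
qed

text \<open>The supertiles that meet a window, but are not contained in it, are negligible for large windows.\<close>

lemma window_freq:
  assumes Z: "tiles Z UNIV" and m: "1 \<le> m" and fp: "infl m Z = Z" and \<epsilon>: "0 < \<epsilon>"
  shows "\<exists>R0. \<forall>R\<ge>R0. \<forall>c. \<bar>real (pair_count Z i j z {c - R..c + R}) - 2 * R * freq i j z\<bar> \<le> \<epsilon> * (2 * R)"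
proof -
  define \<nu> where "\<nu> = freq i j z"
  define g where "g n b = real (patch_count n b i j z) / (lam ^ n * len $ b)" for n b
  have g: "\<forall>\<^sub>F n in sequentially. \<bar>g n b - \<nu>\<bar> < \<epsilon> / 4" for b
    using tendstoD[OF patch_freq[of b i j z], of "\<epsilon> / 4"] \<epsilon> by (simp add: g_def \<nu>_def dist_real_def)
  have "(\<lambda>n. (1 / lam) ^ n) \<longlonglongrightarrow> 0" using lam_gt_1 by (intro LIMSEQ_realpow_zero) auto
  then have "(\<lambda>n. cross_bound z / rmin * (1 / lam) ^ n) \<longlonglongrightarrow> 0" by (rule tendsto_mult_right_zero)
  then have "\<forall>\<^sub>F n in sequentially. cross_bound z / rmin * (1 / lam) ^ n < \<epsilon> / 4"
    by (rule order_tendstoD(2)) (use \<epsilon> in simp)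
  then have "\<forall>\<^sub>F n in sequentially. (\<forall>b\<in>UNIV. \<bar>g n b - \<nu>\<bar> < \<epsilon> / 4) \<and> cross_bound z / rmin * (1 / lam) ^ n < \<epsilon> / 4"
    using g by (intro eventually_conj eventually_ball_finite) simp_all
  then obtain N where N: "\<And>n b. n \<ge> N \<Longrightarrow> \<bar>g n b - \<nu>\<bar> < \<epsilon> / 4"
    "\<And>n. n \<ge> N \<Longrightarrow> cross_bound z / rmin * (1 / lam) ^ n < \<epsilon> / 4"
    unfolding eventually_sequentially by blast
  \<comment> \<open>A multiple of \<open>m\<close>, so that \<open>Z\<close> is its own
    \<open>n\<close>-fold inflation and is thus composed of level-\<open>n\<close>
    supertiles.\<close>
  define n where "n = m * N"
  have "N \<le> n" using m by (simp add: n_def)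
  note gn = N(1)[OF this] and en = N(2)[OF this]
  have fpn: "infl n Z = Z"
  proof -
    have "(infl m ^^ k) Z = Z" for k by (induction k) (simp_all add: fp)
    then show ?thesis by (simp add: n_def funpow_mult)
  qed
  define L where "L = lam ^ n"
  have L: "1 \<le> L" "0 < L" using lam_power_ge_1 lam_power_pos by (auto simp: L_def)
  define H where "H = L * rmax"
  have H: "0 < H" using L rmax_pos by (simp add: H_def)
  have Hlen: "L * len $ b \<le> H" for b using L rmax_ge by (simp add: H_def)
  \<comment> \<open>The errors that do not grow with \<open>R\<close>: a length of at most
    \<open>2 * H\<close> that the supertiles inside the window leave uncovered, and first points in
    two end layers of width \<open>H\<close>.\<close>
  define K where "K = \<bar>\<nu>\<bar> * (2 * H) + 2 * (H / rmin + 1)"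
  have K: "0 \<le> K" unfolding K_def using H rmin_pos by (intro add_nonneg_nonneg) auto
  have "\<bar>real (pair_count Z i j z {c - R..c + R}) - 2 * R * \<nu>\<bar> \<le> \<epsilon> * (2 * R)"
    if R: "K / \<epsilon> + H \<le> R" for R c
  proof -
    have RH: "H \<le> R" "K \<le> \<epsilon> * R"
    proof -
      have "0 \<le> K / \<epsilon>" using K \<epsilon> by simp
      then show "H \<le> R" using R by linarith
      have "K / \<epsilon> \<le> R" using R H by linarith
      then show "K \<le> \<epsilon> * R" using \<epsilon> by (simp add: field_simps)
    qed
    define W where "W = {c - R..c + R}"
    define Q where "Q = {(y, l) \<in> tile_set Z. c - R \<le> L * y \<and> L * y + L * len $ l \<le> c + R}"
    have Q: "(y, l) \<in> Q \<longleftrightarrow> y \<in> Z l \<and> c - R \<le> L * y \<and> L * y + L * len $ l \<le> c + R" for y l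
      by (auto simp: Q_def)
    have finZ: "finite (Z a \<inter> {u..v})" for a u v
    proof (cases "u \<le> v")
      case True
      then show ?thesis by (intro tiles_finite_card(1)[OF Z, of _ a u "v - u"]) auto
    qed simp
    have "Q \<subseteq> (\<Union>l. (\<lambda>y. (y, l)) ` (Z l \<inter> {(c - R) / L..(c + R) / L}))"
    proof
      fix q assume q: "q \<in> Q"
      obtain y l where yl: "q = (y, l)" by force
      have *: "y \<in> Z l" "c - R \<le> L * y" "L * y + L * len $ l \<le> c + R" using q Q yl by auto
      have "0 < L * len $ l" using L len_pos by simp
      then have "L * y \<le> c + R" using * by linarith
      then have "y \<in> Z l \<inter> {(c - R) / L..(c + R) / L}"
        using * L by (simp add: divide_le_eq pos_le_divide_eq mult.commute)
      then show "q \<in> (\<Union>l. (\<lambda>y. (y, l)) ` (Z l \<inter> {(c - R) / L..(c + R) / L}))" unfolding yl by blast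
    qed
    then have finQ: "finite Q" by (rule finite_subset) (simp add: finZ)
    have QZ: "Q \<subseteq> tile_set Z" by (auto simp: Q_def)
    \<comment> \<open>The base tiles of the supertiles in \<open>Q\<close>. They are disjoint, so
      the total supertile length \<open>T\<close> is \<open>L\<close> times the measure of
      \<open>U\<close>, which is enclosed between the measures of two intervals.\<close>
    define U where "U = (\<Union>(y, l)\<in>Q. {y..<y + len $ l})"
    define T where "T = (\<Sum>(y, l)\<in>Q. L * len $ l)"
    have TU: "T = L * measure lborel U"
      unfolding U_def sum_len_eq_measure[OF Z finQ QZ] T_def
      by (simp add: sum_distrib_left split_beta)
    have Usub: "U \<subseteq> {(c - R) / L..(c + R) / L}"
    proof
      fix p assume "p \<in> U"
      then obtain y l where yl: "(y, l) \<in> Q" "y \<le> p" "p < y + len $ l" by (auto simp: U_def)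
      have "L * y \<le> L * p" "L * p \<le> L * (y + len $ l)" using yl L by (auto intro!: mult_left_mono)
      then have "c - R \<le> L * p" "L * p \<le> c + R" using yl(1) Q by (auto simp: algebra_simps)
      then show "p \<in> {(c - R) / L..(c + R) / L}"
        using L by (simp add: divide_le_eq pos_le_divide_eq mult.commute)
    qed
    have Usup: "{(c - R + H) / L..(c + R - H) / L} \<subseteq> U"
    proof
      fix p assume "p \<in> {(c - R + H) / L..(c + R - H) / L}"
      then have p: "c - R + H \<le> L * p" "L * p \<le> c + R - H"
        using L by (auto simp: divide_le_eq pos_le_divide_eq mult.commute)
      obtain l y where yl: "y \<in> Z l" "y \<le> p" "p < y + len $ l" using tiles_cover[OF Z] by blast
      have "L * y \<le> L * p" "L * p \<le> L * (y + len $ l)" using yl L by (auto intro!: mult_left_mono)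
      then have "(y, l) \<in> Q" using p yl Hlen[of l] by (simp add: Q distrib_left)
      then show "p \<in> U" using yl unfolding U_def by (intro UN_I[of "(y, l)"]) auto
    qed
    have Umeas: "U \<in> sets lborel" unfolding U_def using finQ by (auto intro!: sets.finite_UN)
    have Ifm: "{(c - R) / L..(c + R) / L} \<in> fmeasurable lborel"
      by (rule fmeasurableI) (simp_all add: emeasure_lborel_Icc_eq)
    have "measure lborel U \<le> measure lborel {(c - R) / L..(c + R) / L}"
      by (rule measure_mono_fmeasurable[OF Usub Umeas Ifm])
    also have "\<dots> = 2 * R / L"
      using L RH H by (simp add: divide_right_mono diff_divide_distrib[symmetric])
    finally have T_le: "T \<le> 2 * R" using L by (simp add: TU field_simps)
    have "(2 * R - 2 * H) / L \<le> measure lborel {(c - R + H) / L..(c + R - H) / L}"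
      using L RH H by (simp add: divide_right_mono diff_divide_distrib[symmetric])
    also have "\<dots> \<le> measure lborel U"
    proof (rule measure_mono_fmeasurable[OF Usup])
      show "U \<in> fmeasurable lborel"
        by (rule fmeasurableI2[OF Ifm Usub Umeas])
    qed simp
    finally have T_ge: "2 * R - 2 * H \<le> T" using L by (simp add: TU field_simps)
    have T0: "0 \<le> T" unfolding TU using L by simp
    have rem: "real (card {x \<in> infl n Z i. x \<in> W \<and>
        (\<forall>(y, l)\<in>Q. x \<notin> {lam ^ n * y..<lam ^ n * y + lam ^ n * len $ l})}) \<le> 2 * (H / rmin + 1)"
    proof -
      define S1 where "S1 = Z i \<inter> {c - R..c - R + H}"
      define S2 where "S2 = Z i \<inter> {c + R - H..c + R - H + H}"
      have sub: "{x \<in> infl n Z i. x \<in> W \<and>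
        (\<forall>(y, l)\<in>Q. x \<notin> {lam ^ n * y..<lam ^ n * y + lam ^ n * len $ l})} \<subseteq> S1 \<union> S2"
      proof (rule subsetI)
        fix x assume "x \<in> {x \<in> infl n Z i. x \<in> W \<and>
          (\<forall>(y, l)\<in>Q. x \<notin> {lam ^ n * y..<lam ^ n * y + lam ^ n * len $ l})}"
        then have x: "x \<in> infl n Z i" "x \<in> W" and
          out: "\<And>y l. (y, l) \<in> Q \<Longrightarrow> x \<notin> {L * y..<L * y + L * len $ l}"
          by (auto simp: L_def)
        obtain y t l where yt: "x = L * y + t" "y \<in> Z l" "t \<in> patch n l i"
          using x(1) unfolding infl_eq L_def by blast
        have t: "0 \<le> t" "t < L * len $ l" using patch_bounds(1,3)[OF yt(3)] by (auto simp: L_def)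
        then have "(y, l) \<notin> Q" using out[of y l] yt by auto
        then have "L * y < c - R \<or> c + R < L * y + L * len $ l" using yt Q by auto
        then show "x \<in> S1 \<union> S2"
          using t yt(1) x Hlen[of l] unfolding S1_def S2_def fpn W_def by auto
      qed
      have "card {x \<in> infl n Z i. x \<in> W \<and>
        (\<forall>(y, l)\<in>Q. x \<notin> {lam ^ n * y..<lam ^ n * y + lam ^ n * len $ l})} \<le> card (S1 \<union> S2)"
        by (rule card_mono[OF _ sub]) (auto simp: S1_def S2_def finZ)
      also have "\<dots> \<le> card S1 + card S2" by (rule card_Un_le)
      finally have "real (card {x \<in> infl n Z i. x \<in> W \<and>
        (\<forall>(y, l)\<in>Q. x \<notin> {lam ^ n * y..<lam ^ n * y + lam ^ n * len $ l})}) \<le> real (card S1) + real (card S2)"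
        by linarith
      moreover have "real (card S1) \<le> H / rmin + 1"
        by (rule tiles_finite_card(2)[OF Z]) (use H in \<open>auto simp: S1_def\<close>)
      moreover have "real (card S2) \<le> H / rmin + 1"
        by (rule tiles_finite_card(2)[OF Z]) (use H in \<open>auto simp: S2_def\<close>)
      ultimately show ?thesis unfolding distrib_left by linarith
    qed
    have "\<bar>real (pair_count (infl n Z) i j z W) - (\<Sum>(y, l)\<in>Q. real (patch_count n l i j z))\<bar>
      \<le> real (card Q) * cross_bound z + 2 * (H / rmin + 1)"
    proof (rule supertile_count[OF Z QZ finQ _ _ rem])
      fix y l t assume yl: "(y, l) \<in> Q" "t \<in> patch n l i"
      then show "lam ^ n * y + t \<in> W"
        using patch_bounds(1,3)[OF yl(2)] by (auto simp: Q W_def L_def)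
    next
      show "finite {x \<in> infl n Z i. x \<in> W}"
        unfolding fpn using finZ[of i "c - R" "c + R"] by (simp add: W_def Int_def)
    qed
    then have 1: "\<bar>real (pair_count Z i j z W) - (\<Sum>(y, l)\<in>Q. real (patch_count n l i j z))\<bar>
      \<le> real (card Q) * cross_bound z + 2 * (H / rmin + 1)" by (simp only: fpn)
    have 2: "real (card Q) * cross_bound z \<le> \<epsilon> / 4 * (2 * R)"
    proof -
      have "real (card Q) * (L * rmin) = (\<Sum>(y, l)\<in>Q. L * rmin)" by (simp add: split_beta)
      also have "\<dots> \<le> T" unfolding T_def
        by (intro sum_mono) (use L rmin_le in \<open>auto simp: split_beta\<close>)
      also note T_le
      finally have "real (card Q) \<le> 2 * R / (L * rmin)" using L rmin_pos by (simp add: field_simps)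
      then have "real (card Q) * cross_bound z \<le> 2 * R / (L * rmin) * cross_bound z"
        using rmin_pos by (intro mult_right_mono) (auto simp: cross_bound_def)
      also have "\<dots> = (cross_bound z / rmin * (1 / lam) ^ n) * (2 * R)"
        by (simp add: L_def power_divide mult_ac)
      also have "\<dots> \<le> \<epsilon> / 4 * (2 * R)" using en RH H by (intro mult_right_mono) auto
      finally show ?thesis .
    qed
    have 3: "\<bar>(\<Sum>(y, l)\<in>Q. real (patch_count n l i j z)) - \<nu> * T\<bar> \<le> \<epsilon> / 4 * (2 * R)"
    proof -
      have "(\<Sum>(y, l)\<in>Q. real (patch_count n l i j z)) - \<nu> * T
        = (\<Sum>(y, l)\<in>Q. (g n l - \<nu>) * (L * len $ l))"
      proof -
        have "real (patch_count n l i j z) = g n l * (L * len $ l)" for l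
          using lam_gt_1 len_pos[of l] by (simp add: g_def L_def)
        then show ?thesis
          by (simp add: T_def split_beta left_diff_distrib sum_subtractf sum_distrib_left)
      qed
      also have "\<bar>\<dots>\<bar> \<le> (\<Sum>(y, l)\<in>Q. \<epsilon> / 4 * (L * len $ l))"
      proof (rule order.trans[OF sum_abs sum_mono])
        fix q assume "q \<in> Q"
        show "\<bar>case q of (y, l) \<Rightarrow> (g n l - \<nu>) * (L * len $ l)\<bar> \<le> (case q of (y, l) \<Rightarrow> \<epsilon> / 4 * (L * len $ l))"
          using gn[of "snd q"] L len_pos[of "snd q"] by (auto simp: split_beta abs_mult intro!: mult_right_mono less_imp_le)
      qed
      also have "\<dots> = \<epsilon> / 4 * T" by (simp add: T_def sum_distrib_left split_beta)
      also have "\<dots> \<le> \<epsilon> / 4 * (2 * R)" using T_le \<epsilon> by (intro mult_left_mono) auto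
      finally show ?thesis .
    qed
    have 4: "\<bar>\<nu> * T - 2 * R * \<nu>\<bar> \<le> \<bar>\<nu>\<bar> * (2 * H)"
    proof -
      have "\<nu> * T - 2 * R * \<nu> = \<nu> * (T - 2 * R)" by (simp add: algebra_simps)
      also have "\<bar>\<dots>\<bar> \<le> \<bar>\<nu>\<bar> * (2 * H)" unfolding abs_mult using T_le T_ge by (intro mult_left_mono) auto
      finally show ?thesis .
    qed
    \<comment> \<open>The first two errors use one half of the allowance
      \<open>\<epsilon> * (2 * R)\<close>; the other half absorbs
      \<open>K \<le> \<epsilon> * R\<close>.\<close>
    have "\<bar>real (pair_count Z i j z W) - 2 * R * \<nu>\<bar> \<le> \<epsilon> / 4 * (2 * R) + \<epsilon> / 4 * (2 * R) + K"
      using 1 2 3 4 unfolding K_def by linarith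
    also have "\<dots> \<le> \<epsilon> * (2 * R)" using RH by (simp add: algebra_simps)
    finally show ?thesis by (simp add: W_def)
  qed
  then show ?thesis unfolding \<nu>_def by blast
qed

section \<open>Transfer of frequencies to the hull\<close>

lemma hull_window:
  assumes "X \<in> tiling_hull X0"
  shows "\<exists>c. \<forall>a x. \<bar>x\<bar> \<le> K \<longrightarrow> (x \<in> X a \<longleftrightarrow> x + c \<in> X0 a)"
proof -
  \<comment> \<open>The window of radius \<open>1 / \<epsilon> = \<bar>K\<bar> + 1\<close> leaves
    room for the shift \<open>s'\<close>, which is at most 1 in modulus.\<close>
  define \<epsilon> where "\<epsilon> = 1 / (\<bar>K\<bar> + 1)"
  have \<epsilon>: "0 < \<epsilon>" "\<epsilon> \<le> 1" "1 / \<epsilon> = \<bar>K\<bar> + 1" by (auto simp: \<epsilon>_def)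
  obtain s s' where s': "\<bar>s'\<bar> \<le> \<epsilon>"
    and eq: "\<And>a. translate s' X a \<inter> {-(1/\<epsilon>)..1/\<epsilon>} = translate s X0 a \<inter> {-(1/\<epsilon>)..1/\<epsilon>}"
    using assms \<epsilon> unfolding tiling_hull_def locally_close_def by blast
  have tr: "x \<in> translate u Y a \<longleftrightarrow> x - u \<in> Y a" for x u Y a
    unfolding translate_def by (auto intro: image_eqI[of _ _ "x - u"])
  have "x \<in> X a \<longleftrightarrow> x + (s' - s) \<in> X0 a" if "\<bar>x\<bar> \<le> K" for x a
  proof -
    have "x + s' \<in> {-(1/\<epsilon>)..1/\<epsilon>}" using that s' \<epsilon> by (auto simp: abs_le_iff)
    then have "x + s' \<in> translate s' X a \<longleftrightarrow> x + s' \<in> translate s X0 a" using eq[of a] by blast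
    then show ?thesis by (simp add: tr algebra_simps)
  qed
  then show ?thesis by blast
qed

end

locale inflation_hull = inflation_rule \<rho> lam len
  for \<rho> :: "'a::finite \<Rightarrow> 'a list" and lam :: real and len :: "real^'a" +
  fixes X0 X :: "'a \<Rightarrow> real set"
  assumes fixed: "fixed_point_tiling \<rho> lam len X0" and in_hull: "X \<in> tiling_hull X0"
begin

lemma tiles_X0: "tiles X0 UNIV"
  using fixed is_tiling_tiles by (auto simp: fixed_point_tiling_def)

text \<open>The translation that matches \<open>X\<close> with \<open>X0\<close> depends on
  \<open>R\<close>; this is why \<open>window_freq\<close> is uniform in the centre
  \<open>c\<close>. The matched window has radius \<open>R + \<bar>z\<bar>\<close> in order to
  contain the partners.\<close>

lemma hull_window_freq:
  assumes \<epsilon>: "0 < \<epsilon>"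
  shows "\<exists>R0. \<forall>R\<ge>R0. \<bar>real (pair_count X i j z {-R..R}) - 2 * R * freq i j z\<bar> \<le> \<epsilon> * (2 * R)"
proof -
  obtain m where m: "1 \<le> m" "infl m X0 = X0" using fixed by (auto simp: fixed_point_tiling_def)
  obtain R0 where R0: "\<And>R c. R \<ge> R0 \<Longrightarrow> \<bar>real (pair_count X0 i j z {c - R..c + R}) - 2 * R * freq i j z\<bar> \<le> \<epsilon> * (2 * R)"
    using window_freq[OF tiles_X0 m \<epsilon>] by blast
  have "\<bar>real (pair_count X i j z {-R..R}) - 2 * R * freq i j z\<bar> \<le> \<epsilon> * (2 * R)" if "R \<ge> R0" for R
  proof -
    obtain c where c: "\<And>a x. \<bar>x\<bar> \<le> R + \<bar>z\<bar> \<Longrightarrow> x \<in> X a \<longleftrightarrow> x + c \<in> X0 a"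
      using hull_window[OF in_hull] by blast
    have "pair_count X0 i j z {c - R..c + R} = card ((\<lambda>x. x + c) ` {x \<in> X i. x + z \<in> X j \<and> x \<in> {-R..R}})"
      unfolding pair_count_def
    proof (rule arg_cong[where f = card], intro equalityI subsetI)
      fix x assume x: "x \<in> {x \<in> X0 i. x + z \<in> X0 j \<and> x \<in> {c - R..c + R}}"
      then have b: "\<bar>x - c\<bar> \<le> R + \<bar>z\<bar>" "\<bar>x - c + z\<bar> \<le> R + \<bar>z\<bar>" by auto
      have "x - c \<in> X i" "x - c + z \<in> X j"
        using x c[OF b(1), of i] c[OF b(2), of j] by (auto simp: algebra_simps)
      then show "x \<in> (\<lambda>x. x + c) ` {x \<in> X i. x + z \<in> X j \<and> x \<in> {-R..R}}"
        using x by (intro image_eqI[of _ _ "x - c"]) auto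
    next
      fix x' assume "x' \<in> (\<lambda>x. x + c) ` {x \<in> X i. x + z \<in> X j \<and> x \<in> {-R..R}}"
      then obtain x where x: "x' = x + c" "x \<in> X i" "x + z \<in> X j" "-R \<le> x" "x \<le> R" by auto
      then have b: "\<bar>x\<bar> \<le> R + \<bar>z\<bar>" "\<bar>x + z\<bar> \<le> R + \<bar>z\<bar>" by auto
      show "x' \<in> {x \<in> X0 i. x + z \<in> X0 j \<and> x \<in> {c - R..c + R}}"
        using x c[OF b(1), of i] c[OF b(2), of j] by (auto simp: algebra_simps)
    qed
    also have "\<dots> = pair_count X i j z {-R..R}"
      unfolding pair_count_def by (rule card_image) (simp add: inj_on_def)
    finally show ?thesis using R0[OF that, of c] by simp
  qed
  then show ?thesis by blast
qed

lemma pair_freq_tendsto: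
  "((\<lambda>R. real (pair_count X i j z {-R..R}) / (2 * R)) \<longlongrightarrow> freq i j z) at_top"
proof (rule tendstoI)
  fix e :: real assume e: "0 < e"
  obtain R0 where R0: "\<And>R. R \<ge> R0 \<Longrightarrow> \<bar>real (pair_count X i j z {-R..R}) - 2 * R * freq i j z\<bar> \<le> e / 2 * (2 * R)"
    using hull_window_freq[of "e / 2" i j z] e by (meson half_gt_zero)
  show "\<forall>\<^sub>F R in at_top. dist (real (pair_count X i j z {-R..R}) / (2 * R)) (freq i j z) < e"
    using eventually_ge_at_top[of R0] eventually_gt_at_top[of 0]
  proof eventually_elim
    case (elim R)
    have "real (pair_count X i j z {-R..R}) / (2 * R) - freq i j z
      = (real (pair_count X i j z {-R..R}) - 2 * R * freq i j z) / (2 * R)"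
      using elim by (simp add: field_simps)
    also have "\<bar>\<dots>\<bar> \<le> e / 2 * (2 * R) / (2 * R)"
      unfolding abs_divide using R0[OF elim(1)] elim(2) by (simp only: abs_of_pos) (intro divide_right_mono, auto)
    also have "\<dots> < e" using elim e by simp
    finally show ?case by (simp add: dist_real_def)
  qed
qed

lemma dens_pair: "dens (X i \<inter> (\<lambda>y. y - z) ` X j) = freq i j z"
proof -
  have "card (X i \<inter> (\<lambda>y. y - z) ` X j \<inter> {-R..R}) = pair_count X i j z {-R..R}" for R
    unfolding pair_count_def
    by (rule arg_cong[where f = card]) (auto intro: image_eqI[of _ _ "x + z" for x])
  then show ?thesis unfolding dens_def
    using pair_freq_tendsto[of i j z] by (intro tendsto_Lim) auto
qed

lemma dens_union: "dens (\<Union>a. X a) = (\<Sum>i\<in>UNIV. freq i i 0)"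
proof -
  have fin: "finite (X a \<inter> {-R..R})" and disj: "a \<noteq> b \<Longrightarrow> (X a \<inter> {-R..R}) \<inter> (X b \<inter> {-R..R}) = {}" for a b R
  proof -
    obtain c where c: "\<And>a x. \<bar>x\<bar> \<le> R \<Longrightarrow> x \<in> X a \<longleftrightarrow> x + c \<in> X0 a"
      using hull_window[OF in_hull] by blast
    have "(\<lambda>x. x + c) ` (X a \<inter> {-R..R}) \<subseteq> X0 a \<inter> {c - R..c - R + 2 * \<bar>R\<bar>}" using c by fastforce
    moreover have "finite (X0 a \<inter> {c - R..c - R + 2 * \<bar>R\<bar>})"
      by (rule tiles_finite_card(1)[OF tiles_X0]) auto
    ultimately have "finite ((\<lambda>x. x + c) ` (X a \<inter> {-R..R}))" by (rule finite_subset)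
    then show "finite (X a \<inter> {-R..R})" by (rule finite_imageD) (simp add: inj_on_def)
    show "(X a \<inter> {-R..R}) \<inter> (X b \<inter> {-R..R}) = {}" if "a \<noteq> b"
      using c tiles_disjoint_type[OF tiles_X0] that by (fastforce simp: abs_le_iff)
  qed
  have "real (card ((\<Union>a. X a) \<inter> {-R..R})) / (2 * R) = (\<Sum>i\<in>UNIV. real (pair_count X i i 0 {-R..R}) / (2 * R))" for R
  proof -
    have "(\<Union>a. X a) \<inter> {-R..R} = (\<Union>a. X a \<inter> {-R..R})" by auto
    then have "card ((\<Union>a. X a) \<inter> {-R..R}) = (\<Sum>a\<in>UNIV. card (X a \<inter> {-R..R}))"
      using card_UN_disjoint[of UNIV "\<lambda>a. X a \<inter> {-R..R}"] fin disj by simp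
    also have "\<dots> = (\<Sum>a\<in>UNIV. pair_count X a a 0 {-R..R})"
      unfolding pair_count_def by (intro sum.cong refl arg_cong[where f = card]) auto
    finally show ?thesis by (simp add: sum_divide_distrib)
  qed
  moreover have "((\<lambda>R. \<Sum>i\<in>UNIV. real (pair_count X i i 0 {-R..R}) / (2 * R)) \<longlongrightarrow> (\<Sum>i\<in>UNIV. freq i i 0)) at_top"
    by (intro tendsto_intros pair_freq_tendsto)
  ultimately show ?thesis unfolding dens_def by (intro tendsto_Lim) auto
qed

lemma autocorr_coeff_eq:
  "autocorr_coeff X u z = (\<Sum>i\<in>UNIV. \<Sum>j\<in>UNIV. cnj (u$i) * of_real (freq i j z) * u$j)"
proof -
  have "dens (\<Union>a. X a) \<noteq> 0" using dens_union sum_freq_pos by simp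
  then show ?thesis unfolding autocorr_coeff_def pair_corr_def dens_pair
    by (simp add: sum_distrib_left)
qed

text \<open>Extends the sum over the difference set, in the definition of the diffraction measure,
  to all reals.\<close>

lemma autocorr_coeff_0:
  assumes "z \<notin> difference_set (\<Union>a. X a)" shows "autocorr_coeff X u z = 0"
proof -
  have "freq i j z = 0" for i j
  proof -
    have "X i \<inter> (\<lambda>y. y - z) ` X j = {}"
      using assms by (auto simp: difference_set_def) (metis diff_diff_eq2 add_diff_cancel_left' diff_add_cancel)
    then have "freq i j z = dens {}" using dens_pair[of i z j] by simp
    also have "\<dots> = 0" unfolding dens_def by (intro tendsto_Lim) auto
    finally show ?thesis .
  qed
  then show ?thesis by (simp add: autocorr_coeff_eq)
qed

end

section \<open>Gaussian means of exponential sums\<close>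

text \<open>The Fourier transform at \<open>z\<close> of the standard normal density modulated by
  \<open>cis (t * k)\<close>; the parameter \<open>t\<close> becomes the argument of characteristic
  functions.\<close>

definition gauss_hat :: "real \<Rightarrow> real \<Rightarrow> real" where
  "gauss_hat t z = exp (- (t - 2 * pi * z)\<^sup>2 / 2)"

lemma cis_measurable [measurable]: "cis \<in> borel_measurable borel"
  by (intro borel_measurable_continuous_onI continuous_intros)

lemma gauss_cis:
  shows "integrable lborel (\<lambda>k. of_real (std_normal_density k) * cis (t * k))" (is ?int)
    and "(LINT k|lborel. of_real (std_normal_density k) * cis (t * k)) = of_real (exp (- t\<^sup>2 / 2))" (is ?eq)
proof -
  have "integrable lborel (\<lambda>k. std_normal_density k)" using integrable_std_normal_moment[of 0] by simp
  then show ?int by (rule Bochner_Integration.integrable_bound) (auto simp: norm_mult)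
  have "char std_normal_distribution t = (LINT k|lborel. std_normal_density k *\<^sub>R iexp (t * k))"
    unfolding char_def by (rule integral_density) auto
  then show ?eq by (simp add: char_std_normal_distribution cis_conv_exp scaleR_conv_of_real)
qed

text \<open>Expanding the square leaves Gaussian integrals at the frequency differences. The case
  \<open>t = 0\<close> gives mean squares, general \<open>t\<close> the characteristic function of
  the intensity.\<close>

lemma gauss_exp_sum:
  assumes fin: "finite P"
  shows "integrable lborel (\<lambda>k. cis (t * k) * of_real (std_normal_density k * (cmod (\<Sum>p\<in>P. c p * cis (2 * pi * x p * k)))\<^sup>2))"
      (is "integrable lborel ?f")
    and "(LINT k|lborel. cis (t * k) * of_real (std_normal_density k * (cmod (\<Sum>p\<in>P. c p * cis (2 * pi * x p * k)))\<^sup>2))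
      = (\<Sum>p\<in>P. \<Sum>q\<in>P. c p * cnj (c q) * of_real (gauss_hat t (x q - x p)))"
proof -
  have f: "?f = (\<lambda>k. \<Sum>p\<in>P. \<Sum>q\<in>P. c p * cnj (c q) * (of_real (std_normal_density k) * cis ((t - 2 * pi * (x q - x p)) * k)))"
  proof
    fix k
    have "complex_of_real ((cmod (\<Sum>p\<in>P. c p * cis (2 * pi * x p * k)))\<^sup>2) =
      (\<Sum>p\<in>P. c p * cis (2 * pi * x p * k)) * (\<Sum>q\<in>P. cnj (c q) * cis (- (2 * pi * x q * k)))"
      by (simp only: complex_norm_square cnj_sum complex_cnj_mult cis_cnj)
    also have "\<dots> = (\<Sum>p\<in>P. \<Sum>q\<in>P. c p * cnj (c q) * (cis (2 * pi * x p * k) * cis (- (2 * pi * x q * k))))"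
      by (simp add: sum_product mult_ac)
    finally have "?f k = of_real (std_normal_density k) * (cis (t * k) *
      (\<Sum>p\<in>P. \<Sum>q\<in>P. c p * cnj (c q) * (cis (2 * pi * x p * k) * cis (- (2 * pi * x q * k)))))"
      by (simp add: mult_ac)
    also have "\<dots> = (\<Sum>p\<in>P. \<Sum>q\<in>P. c p * cnj (c q) * (of_real (std_normal_density k) *
        (cis (t * k) * (cis (2 * pi * x p * k) * cis (- (2 * pi * x q * k))))))"
      by (simp only: sum_distrib_left mult_ac)
    also have "\<dots> = (\<Sum>p\<in>P. \<Sum>q\<in>P. c p * cnj (c q) * (of_real (std_normal_density k) * cis ((t - 2 * pi * (x q - x p)) * k)))"
      by (simp add: cis_mult algebra_simps)
    finally show "?f k = \<dots>" .
  qed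
  show "integrable lborel ?f" unfolding f
    by (intro Bochner_Integration.integrable_sum integrable_mult_right gauss_cis)
  show "integral\<^sup>L lborel ?f = (\<Sum>p\<in>P. \<Sum>q\<in>P. c p * cnj (c q) * of_real (gauss_hat t (x q - x p)))"
    unfolding f
    by (simp add: Bochner_Integration.integral_sum integrable_mult_right gauss_cis gauss_hat_def del: of_real_exp)
qed

lemma gauss_hat_0_le: "gauss_hat 0 z \<le> 1 / (1 + z\<^sup>2)"
proof -
  have "1 \<le> pi" using pi_gt3 by simp
  then have "1 * 1 \<le> pi * pi" by (intro mult_mono) auto
  then have "1 * z\<^sup>2 \<le> 2 * (pi * pi) * z\<^sup>2" by (intro mult_right_mono) auto
  then have "1 + z\<^sup>2 \<le> 1 + (2 * pi * z)\<^sup>2 / 2" by (simp add: power2_eq_square algebra_simps)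
  also have "\<dots> \<le> exp ((2 * pi * z)\<^sup>2 / 2)" by (rule exp_ge_add_one_self)
  finally have "1 / exp ((2 * pi * z)\<^sup>2 / 2) \<le> 1 / (1 + z\<^sup>2)"
    by (intro divide_left_mono) (auto intro!: add_pos_nonneg mult_pos_pos)
  then show ?thesis by (simp add: gauss_hat_def exp_minus field_simps)
qed

text \<open>Smallness relative to \<open>1 / (1 + z\<^sup>2)\<close> is what
  \<open>sum_separated_le\<close> turns into smallness of a sum over a separated set.\<close>

lemma gauss_hat_tail:
  assumes "0 < e"
  shows "\<exists>h. \<forall>z. h < \<bar>z\<bar> \<longrightarrow> gauss_hat t z \<le> e * (1 / (1 + z\<^sup>2))"
proof -
  have "((\<lambda>z. exp (- (t - 2 * pi * z)\<^sup>2 / 2) * (1 + z\<^sup>2)) \<longlongrightarrow> 0) at_top" by real_asymp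
  moreover have "((\<lambda>z. exp (- (t - 2 * pi * z)\<^sup>2 / 2) * (1 + z\<^sup>2)) \<longlongrightarrow> 0) at_bot" by real_asymp
  ultimately have "\<forall>\<^sub>F z in at_top. gauss_hat t z * (1 + z\<^sup>2) < e" "\<forall>\<^sub>F z in at_bot. gauss_hat t z * (1 + z\<^sup>2) < e"
    unfolding gauss_hat_def using assms by (auto dest: order_tendstoD(2))
  then obtain h1 h2 where h: "\<And>z. h1 \<le> z \<Longrightarrow> gauss_hat t z * (1 + z\<^sup>2) < e" "\<And>z. z \<le> h2 \<Longrightarrow> gauss_hat t z * (1 + z\<^sup>2) < e"
    unfolding eventually_at_top_linorder eventually_at_bot_linorder by blast
  have "gauss_hat t z \<le> e * (1 / (1 + z\<^sup>2))" if "max \<bar>h1\<bar> \<bar>h2\<bar> < \<bar>z\<bar>" for z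
  proof -
    have "h1 \<le> z \<or> z \<le> h2" using that by linarith
    then have "gauss_hat t z * (1 + z\<^sup>2) \<le> e" using h by (meson less_imp_le)
    moreover have "0 < 1 + z\<^sup>2" by (simp add: add_pos_nonneg)
    ultimately show ?thesis by (simp add: pos_le_divide_eq)
  qed
  then show ?thesis by blast
qed

text \<open>In the expanded double sum, the inner sum over \<open>q\<close> runs over a separated
  set and costs only a constant, so the mean square is of the order of the number of terms. Passing
  from \<open>k\<close> to \<open>m * k\<close> dilates the frequencies and keeps them
  separated.\<close>

lemma gauss_exp_sum_le:
  assumes fin: "finite T" and T: "separated r T" and r: "0 < r" and m: "1 \<le> m"
  shows "(\<integral>\<^sup>+k. ennreal (std_normal_density k * (cmod (\<Sum>s\<in>T. cis (2 * pi * s * (m * k))))\<^sup>2) \<partial>lborel)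
    \<le> ennreal (sep_const r * real (card T))"
proof -
  define f where "f k = std_normal_density k * (cmod (\<Sum>s\<in>T. cis (2 * pi * s * (m * k))))\<^sup>2" for k
  have f: "complex_of_real (f k) = cis (0 * k) * of_real (std_normal_density k * (cmod (\<Sum>s\<in>T. 1 * cis (2 * pi * (m * s) * k)))\<^sup>2)" for k
    by (simp add: f_def mult_ac)
  have int: "integrable lborel (\<lambda>k. complex_of_real (f k))"
    unfolding f by (rule gauss_exp_sum(1)[OF fin])
  from integrable_Re[OF this] have int': "integrable lborel f" by simp
  have "complex_of_real (integral\<^sup>L lborel f) = (LINT k|lborel. complex_of_real (f k))" by simp
  also have "\<dots> = (\<Sum>p\<in>T. \<Sum>q\<in>T. 1 * cnj 1 * of_real (gauss_hat 0 (m * q - m * p)))"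
    unfolding f by (rule gauss_exp_sum(2)[OF fin])
  also have "\<dots> = complex_of_real (\<Sum>p\<in>T. \<Sum>q\<in>T. gauss_hat 0 (m * q - m * p))" by simp
  finally have "integral\<^sup>L lborel f = (\<Sum>p\<in>T. \<Sum>q\<in>T. gauss_hat 0 (m * q - m * p))"
    using of_real_eq_iff by blast
  also have "\<dots> \<le> (\<Sum>p\<in>T. sep_const r)"
  proof (rule sum_mono)
    fix p assume "p \<in> T"
    have sep: "separated r ((\<lambda>x. 0 + m * x) ` T)" using separated_affine[OF T _ m, of 0] r by simp
    have "(\<Sum>q\<in>T. gauss_hat 0 (m * q - m * p)) \<le> (\<Sum>q\<in>T. 1 / (1 + (m * q - m * p)\<^sup>2))"
      by (intro sum_mono gauss_hat_0_le)
    also have "\<dots> = (\<Sum>s\<in>(\<lambda>x. 0 + m * x) ` T. 1 / (1 + (s - m * p)\<^sup>2))"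
      using m by (subst sum.reindex) (auto simp: inj_on_def)
    also have "\<dots> \<le> sep_const r" by (rule sum_separated_le[OF _ sep r]) (simp add: fin)
    finally show "(\<Sum>q\<in>T. gauss_hat 0 (m * q - m * p)) \<le> sep_const r" .
  qed
  finally have le: "integral\<^sup>L lborel f \<le> sep_const r * real (card T)" by (simp add: mult.commute)
  have "(\<integral>\<^sup>+k. ennreal (f k) \<partial>lborel) = ennreal (integral\<^sup>L lborel f)"
    by (rule nn_integral_eq_integral[OF int']) (simp add: f_def)
  then show ?thesis using le by (simp add: f_def ennreal_leI)
qed

lemma norm_matrix_sq: "(norm (A :: complex^'n^'m))\<^sup>2 = (\<Sum>i\<in>UNIV. \<Sum>j\<in>UNIV. (cmod (A $ i $ j))\<^sup>2)"
  by (simp add: norm_vec_def L2_set_def sum_nonneg)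

section \<open>The Fourier matrix cocycle\<close>

context inflation_rule
begin

abbreviation cocycle :: "nat \<Rightarrow> real \<Rightarrow> complex^'a^'a" where
  "cocycle \<equiv> fourier_cocycle \<rho> lam len"

text \<open>A tile of a supertile of level \<open>Suc n\<close> is addressed by the
  level-\<open>n\<close> supertile around it, of type \<open>l\<close> and displacement
  \<open>s\<close>, and by its place \<open>t\<close> in there. Injectivity comes from
  \<open>supertile_unique\<close>.\<close>

lemma patch_Suc_bij:
  "bij_betw (\<lambda>(l, s, t). lam ^ n * s + t) (SIGMA l:UNIV. displacements \<rho> len l j \<times> patch n l i) (patch (Suc n) j i)"
  unfolding bij_betw_def
proof
  have tD: "tiles (\<lambda>i. displacements \<rho> len i j) {0..<lam * len $ j}" by (rule tiles_displacements)
  show "inj_on (\<lambda>(l, s, t). lam ^ n * s + t) (SIGMA l:UNIV. displacements \<rho> len l j \<times> patch n l i)"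
  proof (rule inj_onI)
    fix p p' assume mem: "p \<in> (SIGMA l:UNIV. displacements \<rho> len l j \<times> patch n l i)"
      "p' \<in> (SIGMA l:UNIV. displacements \<rho> len l j \<times> patch n l i)"
      and eq: "(\<lambda>(l, s, t). lam ^ n * s + t) p = (\<lambda>(l, s, t). lam ^ n * s + t) p'"
    obtain l s t where p: "p = (l, s, t)" by (cases p)
    obtain l' s' t' where p': "p' = (l', s', t')" by (cases p')
    have a: "s \<in> displacements \<rho> len l j" "t \<in> patch n l i" "s' \<in> displacements \<rho> len l' j" "t' \<in> patch n l' i"
      "lam ^ n * s + t = lam ^ n * s' + t'"
      using mem eq by (auto simp: p p')
    have "s = s' \<and> l = l'"
      using supertile_unique[OF tD a(1,2,3)] a(5) patch_bounds(1,3)[OF a(4)] by auto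
    then show "p = p'" using a(5) by (simp add: p p')
  qed
  have "patch (Suc n) j i = infl n (patch (Suc 0) j) i" using patch_add[of n "Suc 0" j] by simp
  also have "\<dots> = {lam ^ n * s + t | s t l. s \<in> displacements \<rho> len l j \<and> t \<in> patch n l i}"
    unfolding infl_eq patch_1 by simp
  also have "\<dots> = (\<lambda>(l, s, t). lam ^ n * s + t) ` (SIGMA l:UNIV. displacements \<rho> len l j \<times> patch n l i)"
    by force
  finally show "(\<lambda>(l, s, t). lam ^ n * s + t) ` (SIGMA l:UNIV. displacements \<rho> len l j \<times> patch n l i) = patch (Suc n) j i" ..
qed

lemma fourier_matrix_entry:
  "fourier_matrix \<rho> len k $ i $ j = (\<Sum>s\<in>displacements \<rho> len i j. cis (2 * pi * s * k))"
  by (simp add: fourier_matrix_def cis_conv_exp mult_ac)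

text \<open>The right factor at \<open>lam ^ n * k\<close> supplies the phases of the places
  \<open>lam ^ n * s\<close> of the level-\<open>n\<close> supertiles, the left factor those of the
  tiles inside them.\<close>

lemma cocycle_entry: "cocycle n k $ i $ j = (\<Sum>t\<in>patch n j i. cis (2 * pi * t * k))"
proof (induction n arbitrary: i j)
  case 0
  show ?case by (simp add: patch_0 single_tile_def mat_def)
next
  case (Suc n)
  have "(\<Sum>t\<in>patch (Suc n) j i. cis (2 * pi * t * k))
    = (\<Sum>(l, s, t)\<in>(SIGMA l:UNIV. displacements \<rho> len l j \<times> patch n l i). cis (2 * pi * (lam ^ n * s + t) * k))"
    by (subst sum.reindex_bij_betw[OF patch_Suc_bij, symmetric]) (simp add: split_beta)
  also have "\<dots> = (\<Sum>l\<in>UNIV. \<Sum>(s, t)\<in>displacements \<rho> len l j \<times> patch n l i. cis (2 * pi * (lam ^ n * s + t) * k))"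
    by (subst sum.Sigma) (auto simp: finite_displacements finite_patch)
  also have "\<dots> = (\<Sum>l\<in>UNIV. (\<Sum>t\<in>patch n l i. cis (2 * pi * t * k)) *
      (\<Sum>s\<in>displacements \<rho> len l j. cis (2 * pi * s * (lam ^ n * k))))"
  proof (rule sum.cong[OF refl])
    fix l
    have "(\<Sum>(s, t)\<in>displacements \<rho> len l j \<times> patch n l i. cis (2 * pi * (lam ^ n * s + t) * k))
      = (\<Sum>s\<in>displacements \<rho> len l j. \<Sum>t\<in>patch n l i. cis (2 * pi * t * k) * cis (2 * pi * s * (lam ^ n * k)))"
      by (simp add: sum.cartesian_product cis_mult algebra_simps)
    then show "(\<Sum>(s, t)\<in>displacements \<rho> len l j \<times> patch n l i. cis (2 * pi * (lam ^ n * s + t) * k))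
      = (\<Sum>t\<in>patch n l i. cis (2 * pi * t * k)) * (\<Sum>s\<in>displacements \<rho> len l j. cis (2 * pi * s * (lam ^ n * k)))"
      by (simp add: sum_product sum.swap[of _ "patch n l i"])
  qed
  also have "\<dots> = cocycle (Suc n) k $ i $ j"
    by (simp add: matrix_matrix_mult_def Suc.IH fourier_matrix_entry)
  finally show ?case ..
qed

lemma cocycle_add: "cocycle (n + N) k = cocycle n k ** cocycle N (lam ^ n * k)"
  by (induction N) (simp_all add: matrix_mul_assoc power_add mult_ac)

lemma continuous_cocycle: "continuous_on A (\<lambda>k. cocycle n k)"
proof -
  have "cocycle n = (\<lambda>k. \<chi> i j. \<Sum>t\<in>patch n j i. cis (2 * pi * t * k))"
    by (auto simp: vec_eq_iff cocycle_entry)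
  moreover have "continuous_on A (\<lambda>k. \<chi> i j. \<Sum>t\<in>patch n j i. cis (2 * pi * t * k))"
    by (intro continuous_intros continuous_on_vec_lambda)
  ultimately show ?thesis by simp
qed

lemma cocycle_measurable [measurable]: "(\<lambda>k. cocycle n (m * k)) \<in> borel_measurable borel"
  by (intro borel_measurable_continuous_onI continuous_on_compose2[OF continuous_cocycle[of UNIV]] continuous_intros) auto

section \<open>Mean growth of the cocycle and the upper bound for the exponent\<close>

definition mean_const :: real where
  "mean_const = sep_const rmin * rmax / rmin * real CARD('a) * real CARD('a)"

lemma mean_const_nonneg: "0 \<le> mean_const"
  unfolding mean_const_def using sep_const_nonneg[OF rmin_pos] rmin_pos rmax_pos by simp

lemma gauss_mean_cocycle:
  assumes m: "1 \<le> m"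
  shows "(\<integral>\<^sup>+k. ennreal (std_normal_density k * (norm (cocycle n (m * k)))\<^sup>2) \<partial>lborel) \<le> ennreal (mean_const * lam ^ n)"
proof -
  define C where "C = sep_const rmin * rmax / rmin * lam ^ n"
  have C0: "0 \<le> C" unfolding C_def using sep_const_nonneg[OF rmin_pos] rmin_pos rmax_pos lam_power_pos[of n] by simp
  have entry: "(\<integral>\<^sup>+k. ennreal (std_normal_density k * (cmod (cocycle n (m * k) $ i $ j))\<^sup>2) \<partial>lborel) \<le> ennreal C" for i j
  proof -
    have "(\<integral>\<^sup>+k. ennreal (std_normal_density k * (cmod (cocycle n (m * k) $ i $ j))\<^sup>2) \<partial>lborel)
      \<le> ennreal (sep_const rmin * real (card (patch n j i)))"
      unfolding cocycle_entry
      by (rule gauss_exp_sum_le[OF finite_patch tiles_separated_single[OF tiles_patch] rmin_pos m])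
    also have "\<dots> \<le> ennreal C"
    proof (rule ennreal_leI)
      have "real (card (patch n j i)) \<le> lam ^ n * len $ j / rmin" by (rule card_patch_type_le)
      also have "\<dots> \<le> lam ^ n * rmax / rmin"
        using rmin_pos lam_power_pos[of n] rmax_ge by (intro divide_right_mono mult_left_mono) auto
      finally have "sep_const rmin * real (card (patch n j i)) \<le> sep_const rmin * (lam ^ n * rmax / rmin)"
        using sep_const_nonneg[OF rmin_pos] by (intro mult_left_mono)
      then show "sep_const rmin * real (card (patch n j i)) \<le> C" by (simp add: C_def mult_ac)
    qed
    finally show ?thesis .
  qed
  have "(\<integral>\<^sup>+k. ennreal (std_normal_density k * (norm (cocycle n (m * k)))\<^sup>2) \<partial>lborel)
    = (\<integral>\<^sup>+k. (\<Sum>i\<in>UNIV. \<Sum>j\<in>UNIV. ennreal (std_normal_density k * (cmod (cocycle n (m * k) $ i $ j))\<^sup>2)) \<partial>lborel)"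
    by (simp add: norm_matrix_sq sum_distrib_left sum_nonneg)
  also have "\<dots> = (\<Sum>i\<in>UNIV. \<Sum>j\<in>UNIV. (\<integral>\<^sup>+k. ennreal (std_normal_density k * (cmod (cocycle n (m * k) $ i $ j))\<^sup>2) \<partial>lborel))"
    unfolding cocycle_entry by (subst nn_integral_sum, measurable)+
  also have "\<dots> \<le> (\<Sum>i\<in>(UNIV::'a set). \<Sum>j\<in>(UNIV::'a set). ennreal C)"
    by (intro sum_mono entry)
  also have "\<dots> = ennreal (mean_const * lam ^ n)"
    using C0 by (simp only: sum_ennreal sum_nonneg) (simp add: mean_const_def C_def mult_ac)
  finally show ?thesis .
qed

lemma lyapunov_exponent_le:
  assumes S: "0 \<le> S" and bound: "\<And>n. (norm (cocycle n k))\<^sup>2 \<le> S * (lam ^ n * (real n + 1)\<^sup>2)"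
  shows "lyapunov_exponent \<rho> lam len k \<le> ereal (ln (sqrt lam))"
proof -
  \<comment> \<open>One half of the logarithm of
    \<open>(S + 1) * (lam ^ n * (real n + 1)\<^sup>2)\<close>, divided by \<open>n\<close>. The
    constant is \<open>S + 1\<close> because \<open>S\<close> may be 0.\<close>
  define b where "b n = (ln (S + 1) / 2 + ln (real n + 1)) / real n + ln lam / 2" for n
  have "(\<lambda>n. (ln (S + 1) / 2 + ln (real n + 1)) / real n + ln lam / 2) \<longlonglongrightarrow> 0 + ln lam / 2"
  proof (intro tendsto_add tendsto_const)
    show "(\<lambda>n. (ln (S + 1) / 2 + ln (real n + 1)) / real n) \<longlonglongrightarrow> 0" by real_asymp
  qed
  then have b: "(\<lambda>n. ereal (b n)) \<longlonglongrightarrow> ereal (ln (sqrt lam))"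
    using lam_gt_1 by (simp add: b_def[abs_def] ln_sqrt)
  have "\<forall>\<^sub>F n in sequentially. ereal (1 / real n) * log_norm (cocycle n k) \<le> ereal (b n)"
    using eventually_gt_at_top[of 0]
  proof eventually_elim
    case (elim n)
    show ?case
    proof (cases "cocycle n k = 0")
      case True
      then show ?thesis using elim by (simp add: log_norm_def)
    next
      case False
      then have pos: "0 < norm (cocycle n k)" by simp
      have "S * (lam ^ n * (real n + 1)\<^sup>2) \<le> (S + 1) * (lam ^ n * (real n + 1)\<^sup>2)"
        using lam_power_pos[of n] by (intro mult_right_mono) auto
      then have "(norm (cocycle n k))\<^sup>2 \<le> (S + 1) * (lam ^ n * (real n + 1)\<^sup>2)" using bound[of n] by linarith
      then have "ln ((norm (cocycle n k))\<^sup>2) \<le> ln ((S + 1) * (lam ^ n * (real n + 1)\<^sup>2))"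
        using pos S lam_power_pos[of n] by (subst ln_le_cancel_iff) (auto intro!: mult_pos_pos)
      also have "\<dots> = ln (S + 1) + (real n * ln lam + 2 * ln (real n + 1))"
        using S lam_gt_1 by (simp add: ln_mult ln_realpow)
      finally have "ln (norm (cocycle n k)) \<le> (ln (S + 1) + (real n * ln lam + 2 * ln (real n + 1))) / 2"
        using pos by (simp add: ln_realpow)
      then have "1 / real n * ln (norm (cocycle n k)) \<le> 1 / real n * ((ln (S + 1) + (real n * ln lam + 2 * ln (real n + 1))) / 2)"
        by (intro mult_left_mono) auto
      also have "\<dots> = b n" using elim by (simp add: b_def field_simps)
      finally show ?thesis using False by (simp add: log_norm_def)
    qed
  qed
  then have "lyapunov_exponent \<rho> lam len k \<le> limsup (\<lambda>n. ereal (b n))"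
    unfolding lyapunov_exponent_def by (rule Limsup_mono)
  also have "\<dots> = ereal (ln (sqrt lam))" by (rule lim_imp_Limsup[OF _ b]) simp
  finally show ?thesis .
qed

lemma AE_lyapunov_exponent_le: "AE k in lborel. lyapunov_exponent \<rho> lam len k \<le> ereal (ln (sqrt lam))"
proof -
  define f where "f n k = ennreal (1 / (lam ^ n * (real n + 1)\<^sup>2)) * ennreal (std_normal_density k * (norm (cocycle n (1 * k)))\<^sup>2)" for n k
  have [measurable]: "f n \<in> borel_measurable lborel" for n unfolding f_def by measurable
  have "(\<integral>\<^sup>+k. (\<Sum>n. f n k) \<partial>lborel) = (\<Sum>n. \<integral>\<^sup>+k. f n k \<partial>lborel)"
    by (rule nn_integral_suminf) simp
  also have "\<dots> \<le> (\<Sum>n. ennreal (mean_const * (1 / (real n + 1)\<^sup>2)))"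
  proof (rule suminf_le)
    fix n
    have "(\<integral>\<^sup>+k. f n k \<partial>lborel) = ennreal (1 / (lam ^ n * (real n + 1)\<^sup>2)) *
        (\<integral>\<^sup>+k. ennreal (std_normal_density k * (norm (cocycle n (1 * k)))\<^sup>2) \<partial>lborel)"
      unfolding f_def by (rule nn_integral_cmult) measurable
    also have "\<dots> \<le> ennreal (1 / (lam ^ n * (real n + 1)\<^sup>2)) * ennreal (mean_const * lam ^ n)"
      by (intro mult_left_mono gauss_mean_cocycle) auto
    also have "\<dots> = ennreal (mean_const * (1 / (real n + 1)\<^sup>2))"
      using lam_gt_1 mean_const_nonneg by (simp add: ennreal_mult[symmetric])
    finally show "(\<integral>\<^sup>+k. f n k \<partial>lborel) \<le> \<dots>" .
  qed auto
  also have "\<dots> < top"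
  proof -
    have "summable (\<lambda>n. 1 / (real (Suc n))\<^sup>2)"
      by (subst summable_Suc_iff) (use inverse_power_summable[of 2, where 'a = real] in \<open>simp add: divide_inverse\<close>)
    then have "summable (\<lambda>n. mean_const * (1 / (real n + 1)\<^sup>2))" by (intro summable_mult) (simp add: add.commute)
    then show ?thesis using mean_const_nonneg by (simp add: suminf_ennreal2)
  qed
  finally have "(\<integral>\<^sup>+k. (\<Sum>n. f n k) \<partial>lborel) \<noteq> \<infinity>" by simp
  then have "AE k in lborel. (\<Sum>n. f n k) \<noteq> \<infinity>" by (intro nn_integral_noteq_infinite) measurable
  then show ?thesis
  proof eventually_elim
    case (elim k)
    \<comment> \<open>Each term is at most the finite sum, as all terms are non-negative. Division
      by the positive density gives the constant for \<open>lyapunov_exponent_le\<close>, which may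
      depend on \<open>k\<close>.\<close>
    define S where "S = enn2real (\<Sum>n. f n k)"
    have S: "(\<Sum>n. f n k) = ennreal S" "0 \<le> S" using elim by (auto simp: S_def less_top)
    show ?case
    proof (rule lyapunov_exponent_le[of "S / std_normal_density k"])
      show "0 \<le> S / std_normal_density k" using S by simp
      fix n
      have D: "0 < lam ^ n * (real n + 1)\<^sup>2" using lam_power_pos[of n] by simp
      have "f n k \<le> (\<Sum>n. f n k)" using sum_le_suminf[of "\<lambda>n. f n k" "{n}"] by (simp add: summableI)
      also have "f n k = ennreal (1 / (lam ^ n * (real n + 1)\<^sup>2) * (std_normal_density k * (norm (cocycle n k))\<^sup>2))"
        unfolding f_def using D by (subst ennreal_mult[symmetric]) auto
      also note S(1)
      finally have "ennreal (1 / (lam ^ n * (real n + 1)\<^sup>2) * (std_normal_density k * (norm (cocycle n k))\<^sup>2)) \<le> ennreal S" .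
      then have "1 / (lam ^ n * (real n + 1)\<^sup>2) * (std_normal_density k * (norm (cocycle n k))\<^sup>2) \<le> S"
        using S by simp
      then have "std_normal_density k * (norm (cocycle n k))\<^sup>2 \<le> S * (lam ^ n * (real n + 1)\<^sup>2)"
        using D by (simp add: divide_le_eq)
      then show "(norm (cocycle n k))\<^sup>2 \<le> S / std_normal_density k * (lam ^ n * (real n + 1)\<^sup>2)"
        using normal_density_pos[of 1 0 k] by (simp add: pos_le_divide_eq mult.commute)
    qed
  qed
qed

text \<open>The gap below \<open>ln (sqrt lam)\<close> is measured by natural numbers
  \<open>q\<close> and \<open>n0\<close>, so that the exceptional set is contained in a countable
  union.\<close>

lemma lyapunov_less_imp:
  assumes "lyapunov_exponent \<rho> lam len k < ereal (ln (sqrt lam))"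
  shows "\<exists>q n0. \<forall>n\<ge>n0. (norm (cocycle n k))\<^sup>2 < exp (- (1 / (real q + 1))) ^ n * lam ^ n"
proof -
  obtain r where r: "lyapunov_exponent \<rho> lam len k < ereal r" "r < ln (sqrt lam)"
    using ereal_dense2[OF assms] by auto
  have "0 < ln lam - 2 * r" using r(2) lam_gt_1 by (simp add: ln_sqrt)
  then obtain q where q: "1 / (real q + 1) < ln lam - 2 * r"
    using reals_Archimedean[of "ln lam - 2 * r"] by (auto simp: inverse_eq_divide add.commute)
  have "\<forall>\<^sub>F n in sequentially. ereal (1 / real n) * log_norm (cocycle n k) < ereal r"
    using r(1) unfolding lyapunov_exponent_def by (rule Limsup_lessD)
  then have "\<forall>\<^sub>F n in sequentially. (norm (cocycle n k))\<^sup>2 < exp (- (1 / (real q + 1))) ^ n * lam ^ n"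
    using eventually_gt_at_top[of 0]
  proof eventually_elim
    case (elim n)
    have R: "exp (- (1 / (real q + 1))) ^ n * lam ^ n = exp (real n * (ln lam - 1 / (real q + 1)))"
    proof -
      have "lam ^ n = exp (real n * ln lam)" using lam_gt_1 by (simp add: exp_of_nat_mult)
      then show ?thesis by (simp add: exp_of_nat_mult[symmetric] exp_add[symmetric] algebra_simps)
    qed
    show ?case
    proof (cases "cocycle n k = 0")
      case True
      then show ?thesis unfolding R by simp
    next
      case False
      then have pos: "0 < norm (cocycle n k)" by simp
      have "1 / real n * ln (norm (cocycle n k)) < r" using elim False by (simp add: log_norm_def)
      then have "ln (norm (cocycle n k)) < real n * r" using elim by (simp add: field_simps)
      then have "2 * ln (norm (cocycle n k)) < real n * (2 * r)" by simp
      also have "\<dots> \<le> real n * (ln lam - 1 / (real q + 1))" using q by (intro mult_left_mono) auto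
      finally have "exp (2 * ln (norm (cocycle n k))) < exp (real n * (ln lam - 1 / (real q + 1)))" by simp
      moreover have "exp (2 * ln (norm (cocycle n k))) = (norm (cocycle n k))\<^sup>2"
        using pos exp_of_nat_mult[of 2 "ln (norm (cocycle n k))"] by simp
      ultimately show ?thesis unfolding R by simp
    qed
  qed
  then show ?thesis unfolding eventually_sequentially by blast
qed

lemma lyapunov_measurable [measurable]: "lyapunov_exponent \<rho> lam len \<in> borel_measurable borel"
proof -
  have [measurable]: "(\<lambda>k. cocycle n k) \<in> borel_measurable borel" for n using cocycle_measurable[of n 1] by simp
  show ?thesis unfolding lyapunov_exponent_def[abs_def] log_norm_def by measurable
qed

section \<open>Finite local complexity\<close>

primrec len_sums :: "nat \<Rightarrow> real set" where
  "len_sums 0 = {0}"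
| "len_sums (Suc n) = (\<lambda>(i, w). len $ i + w) ` (UNIV \<times> len_sums n)"

lemma finite_len_sums: "finite (len_sums n)"
  by (induction n) auto

text \<open>A walk from \<open>x\<close> to \<open>y\<close>, tile by tile; \<open>m\<close> limits
  the number of steps and drives the induction. Every step has length at least \<open>rmin\<close>,
  which bounds the number \<open>n\<close> of tiles by the distance.\<close>

lemma tile_difference:
  assumes Y: "tiles Y {a..<b}" and y: "y \<in> Y j"
  shows "x \<in> Y i \<Longrightarrow> x \<le> y \<Longrightarrow> y - x < real m * rmin \<Longrightarrow>
    \<exists>n. real n * rmin \<le> y - x \<and> y - x \<in> len_sums n"
proof (induction m arbitrary: x i)
  case 0
  then show ?case by simp
next
  case (Suc m)
  show ?case
  proof (cases "x = y")
    case True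
    then show ?thesis by (intro exI[of _ 0]) simp
  next
    case False
    define p where "p = x + len $ i"
    have "\<not> y < x + len $ i" using tiles_eq[OF Y Suc.prems(1) y Suc.prems(2)] False by auto
    then have py: "p \<le> y" by (simp add: p_def)
    have "p \<in> {a..<b}"
      using tile_end_le[OF Y Suc.prems(1)] tile_end_le[OF Y y] py len_pos[of i] by (auto simp: p_def)
    then obtain i' x' where x': "x' \<in> Y i'" "x' \<le> p" "p < x' + len $ i'"
      using tiles_cover[OF Y] by blast
    \<comment> \<open>The tile that contains the right end \<open>p\<close> of the current tile must
      begin there, since beginning earlier would make the two overlap.\<close>
    have "x' = p"
    proof (cases "x \<le> x'")
      case True
      have "\<not> x' < p"
      proof
        assume "x' < p"
        then have "x = x' \<and> i = i'" using tiles_eq[OF Y Suc.prems(1) x'(1) True] by (simp add: p_def)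
        then show False using x'(3) by (simp add: p_def)
      qed
      then show ?thesis using x'(2) by simp
    next
      case False
      then have "x' = x"
        using tiles_eq[OF Y x'(1) Suc.prems(1)] x'(3) len_pos[of i] by (simp add: p_def)
      then show ?thesis using False by simp
    qed
    moreover have "y - p < real m * rmin"
      using Suc.prems(3) rmin_le[of i] unfolding p_def of_nat_Suc distrib_right by linarith
    ultimately obtain n where n: "real n * rmin \<le> y - p" "y - p \<in> len_sums n"
      using Suc.IH[of p i'] x'(1) py by blast
    have "y - x = len $ i + (y - p)" by (simp add: p_def)
    then have "y - x \<in> len_sums (Suc n)" using n(2) by (auto intro!: rev_image_eqI[of "(i, y - p)"])
    moreover have "real (Suc n) * rmin \<le> y - x"
      using n(1) rmin_le[of i] unfolding p_def of_nat_Suc distrib_right by linarith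
    ultimately show ?thesis by blast
  qed
qed

text \<open>At most \<open>h / rmin\<close> tiles fit between two points at distance at most
  \<open>h\<close>, and there are finitely many sums of so many tile lengths. One set serves all
  levels and types.\<close>

lemma finite_patch_differences:
  "\<exists>F. finite F \<and> (\<forall>N b i j x y. x \<in> patch N b i \<longrightarrow> y \<in> patch N b j \<longrightarrow> \<bar>y - x\<bar> \<le> h \<longrightarrow> y - x \<in> F)"
proof -
  define F0 where "F0 = (\<Union>n\<le>nat \<lceil>h / rmin\<rceil>. len_sums n)"
  have pos: "y - x \<in> F0"
    if x: "x \<in> patch N b i" and y: "y \<in> patch N b j" and xy: "x \<le> y" "y - x \<le> h" for x y N b i j
  proof -
    obtain m where "y - x < real m * rmin" using ex_less_of_nat_mult[OF rmin_pos] by blast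
    then obtain n where n: "real n * rmin \<le> y - x" "y - x \<in> len_sums n"
      using tile_difference[OF tiles_patch y x xy(1)] by blast
    have "real n * rmin \<le> h" using n(1) xy(2) by linarith
    then have "real n \<le> h / rmin" using rmin_pos by (simp add: pos_le_divide_eq)
    then have "n \<le> nat \<lceil>h / rmin\<rceil>" using nat_mono[OF ceiling_mono] by fastforce
    then show ?thesis using n(2) by (auto simp: F0_def)
  qed
  have "finite (F0 \<union> uminus ` F0)" by (simp add: F0_def finite_len_sums)
  moreover have "y - x \<in> F0 \<union> uminus ` F0"
    if "x \<in> patch N b i" "y \<in> patch N b j" "\<bar>y - x\<bar> \<le> h" for N b i j x y
  proof (cases "x \<le> y")
    case True
    then show ?thesis using pos[OF that(1,2) True] that(3) by simp
  next
    case False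
    then have "x - y \<in> F0" using pos[OF that(2,1)] that(3) by simp
    then show ?thesis by (intro UnI2 image_eqI[of _ _ "x - y"]) auto
  qed
  ultimately show ?thesis by (intro exI[of _ "F0 \<union> uminus ` F0"] conjI allI impI)
qed

section \<open>Diffraction of large supertiles\<close>

text \<open>The complex conjugate of the Fourier transform of the weighted Dirac comb of a
  supertile, so that its squared modulus is the intensity.\<close>

definition amplitude :: "complex^'a \<Rightarrow> 'a \<Rightarrow> nat \<Rightarrow> real \<Rightarrow> complex" where
  "amplitude u b N k = (\<Sum>i\<in>UNIV. cnj (u $ i) * cocycle N k $ i $ b)"

text \<open>The unnormalised autocorrelation of a supertile, integrated against
  \<open>gauss_hat t\<close>.\<close>

definition pair_sum :: "complex^'a \<Rightarrow> 'a \<Rightarrow> nat \<Rightarrow> real \<Rightarrow> complex" where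
  "pair_sum u b N t = (\<Sum>(x, i)\<in>tile_set (patch N b). \<Sum>(y, j)\<in>tile_set (patch N b).
      cnj (u $ i) * u $ j * of_real (gauss_hat t (y - x)))"

lemma amplitude_gauss:
  shows "integrable lborel (\<lambda>k. cis (t * k) * of_real (std_normal_density k * (cmod (amplitude u b N k))\<^sup>2))"
    and "(LINT k|lborel. cis (t * k) * of_real (std_normal_density k * (cmod (amplitude u b N k))\<^sup>2)) = pair_sum u b N t"
proof -
  have amp: "amplitude u b N k = (\<Sum>p\<in>tile_set (patch N b). cnj (u $ snd p) * cis (2 * pi * fst p * k))" for k
    using sum_tile_set_patch[of "\<lambda>x i. cnj (u $ i) * cis (2 * pi * x * k)" N b]
    by (simp add: amplitude_def cocycle_entry sum_distrib_left split_beta)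
  show "integrable lborel (\<lambda>k. cis (t * k) * of_real (std_normal_density k * (cmod (amplitude u b N k))\<^sup>2))"
    unfolding amp by (rule gauss_exp_sum(1)[OF finite_tile_set_patch])
  show "(LINT k|lborel. cis (t * k) * of_real (std_normal_density k * (cmod (amplitude u b N k))\<^sup>2)) = pair_sum u b N t"
    unfolding amp by (subst gauss_exp_sum(2)[OF finite_tile_set_patch]) (simp add: pair_sum_def split_beta)
qed

text \<open>Grouping pairs by their difference brings in the pair counts, whose limits per unit
  length are known.\<close>

lemma pair_sum_restrict:
  assumes F: "finite F"
  shows "(\<Sum>(x, i)\<in>tile_set (patch N b). \<Sum>(y, j)\<in>tile_set (patch N b).
      if y - x \<in> F then cnj (u $ i) * u $ j * of_real (gauss_hat t (y - x)) else 0)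
    = (\<Sum>z\<in>F. (\<Sum>i\<in>UNIV. \<Sum>j\<in>UNIV. cnj (u $ i) * of_real (real (patch_count N b i j z)) * u $ j) * of_real (gauss_hat t z))"
proof -
  define g where "g i j z = cnj (u $ i) * u $ j * complex_of_real (gauss_hat t z)" for i j z
  have fold: "(\<Sum>(x, i)\<in>tile_set (patch N b). \<Sum>(y, j)\<in>tile_set (patch N b). f x i y j)
    = (\<Sum>i\<in>UNIV. \<Sum>j\<in>UNIV. \<Sum>x\<in>patch N b i. \<Sum>y\<in>patch N b j. f x i y j)" for f :: "real \<Rightarrow> 'a \<Rightarrow> real \<Rightarrow> 'a \<Rightarrow> complex"
    unfolding sum_tile_set_patch by (intro sum.cong refl sum.swap)
  have inner: "(\<Sum>x\<in>patch N b i. \<Sum>y\<in>patch N b j. if y - x \<in> F then g i j (y - x) else 0)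
    = (\<Sum>z\<in>F. of_real (real (patch_count N b i j z)) * g i j z)" for i j
  proof -
    have "(\<Sum>x\<in>patch N b i. \<Sum>y\<in>patch N b j. if y - x \<in> F then g i j (y - x) else 0)
      = (\<Sum>x\<in>patch N b i. \<Sum>y\<in>patch N b j. \<Sum>z\<in>F. if y = x + z then g i j z else 0)"
    proof (intro sum.cong refl)
      fix x y
      have "(\<Sum>z\<in>F. if y = x + z then g i j z else 0) = (\<Sum>z\<in>F. if y - x = z then g i j z else 0)"
        by (intro sum.cong) auto
      then show "(if y - x \<in> F then g i j (y - x) else 0) = (\<Sum>z\<in>F. if y = x + z then g i j z else 0)"
        using F by simp
    qed
    also have "\<dots> = (\<Sum>x\<in>patch N b i. \<Sum>z\<in>F. \<Sum>y\<in>patch N b j. if y = x + z then g i j z else 0)"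
      by (intro sum.cong refl sum.swap)
    also have "\<dots> = (\<Sum>z\<in>F. \<Sum>x\<in>patch N b i. \<Sum>y\<in>patch N b j. if y = x + z then g i j z else 0)"
      by (rule sum.swap)
    also have "\<dots> = (\<Sum>z\<in>F. \<Sum>x\<in>patch N b i. if x + z \<in> patch N b j then g i j z else 0)"
      by (simp add: finite_patch)
    also have "\<dots> = (\<Sum>z\<in>F. of_real (real (patch_count N b i j z)) * g i j z)"
      by (simp add: sum.inter_filter[symmetric] finite_patch pair_count_def)
    finally show ?thesis .
  qed
  have "(\<Sum>(x, i)\<in>tile_set (patch N b). \<Sum>(y, j)\<in>tile_set (patch N b).
      if y - x \<in> F then cnj (u $ i) * u $ j * of_real (gauss_hat t (y - x)) else 0)
    = (\<Sum>i\<in>UNIV. \<Sum>j\<in>UNIV. \<Sum>z\<in>F. of_real (real (patch_count N b i j z)) * g i j z)"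
    unfolding fold g_def[symmetric] inner ..
  also have "\<dots> = (\<Sum>i\<in>UNIV. \<Sum>z\<in>F. \<Sum>j\<in>UNIV. of_real (real (patch_count N b i j z)) * g i j z)"
    by (intro sum.cong refl sum.swap)
  also have "\<dots> = (\<Sum>z\<in>F. \<Sum>i\<in>UNIV. \<Sum>j\<in>UNIV. of_real (real (patch_count N b i j z)) * g i j z)"
    by (rule sum.swap)
  finally show ?thesis by (simp add: g_def sum_distrib_left sum_distrib_right mult_ac)
qed

definition weight_bound :: "complex^'a \<Rightarrow> real" where
  "weight_bound u = (\<Sum>i\<in>UNIV. cmod (u $ i))"

lemma weight_le: "cmod (u $ i) \<le> weight_bound u"
  unfolding weight_bound_def by (rule member_le_sum) auto

lemma weight_bound_nonneg: "0 \<le> weight_bound u"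
  unfolding weight_bound_def by (rule sum_nonneg) simp

lemma pair_sum_tail:
  assumes e: "0 \<le> e" and h: "\<And>z. h < \<bar>z\<bar> \<Longrightarrow> gauss_hat t z \<le> e * (1 / (1 + z\<^sup>2))"
    and F: "\<And>i j x y. x \<in> patch N b i \<Longrightarrow> y \<in> patch N b j \<Longrightarrow> \<bar>y - x\<bar> \<le> h \<Longrightarrow> y - x \<in> F"
  shows "cmod (\<Sum>(x, i)\<in>tile_set (patch N b). \<Sum>(y, j)\<in>tile_set (patch N b).
      if y - x \<in> F then 0 else cnj (u $ i) * u $ j * of_real (gauss_hat t (y - x)))
    \<le> (weight_bound u)\<^sup>2 * e * sep_const rmin * real (card (tile_set (patch N b)))"
proof -
  define P where "P = tile_set (patch N b)"
  define U where "U = weight_bound u"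
  have fin: "finite P" by (simp add: P_def finite_tile_set_patch)
  \<comment> \<open>Tiles of different type never share a left endpoint, so sums over tiles become
    sums over separated positions.\<close>
  have inj: "inj_on fst P"
  proof (rule inj_onI)
    fix p q assume pq: "p \<in> P" "q \<in> P" "fst p = fst q"
    then have "snd p = snd q"
      using tiles_disjoint_type[OF tiles_patch, of "fst p" N b "snd p" "snd q"] by (simp add: P_def tile_set_def split_beta)
    then show "p = q" using pq by (simp add: prod_eq_iff)
  qed
  have sep: "separated rmin (fst ` P)"
    by (rule separated_subset[OF tiles_separated[OF tiles_patch]]) (auto simp: P_def tile_set_def)
  have "cmod (\<Sum>p\<in>P. \<Sum>q\<in>P. if fst q - fst p \<in> F then 0 else cnj (u $ snd p) * u $ snd q * of_real (gauss_hat t (fst q - fst p)))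
    \<le> (\<Sum>p\<in>P. \<Sum>q\<in>P. U\<^sup>2 * e * (1 / (1 + (fst q - fst p)\<^sup>2)))"
  proof (intro sum_norm_le)
    fix p q assume pq: "p \<in> P" "q \<in> P"
    let ?d = "fst q - fst p"
    have pos: "0 \<le> U\<^sup>2 * e * (1 / (1 + ?d\<^sup>2))" using e by (simp add: add_nonneg_nonneg)
    show "cmod (if ?d \<in> F then 0 else cnj (u $ snd p) * u $ snd q * of_real (gauss_hat t ?d)) \<le> U\<^sup>2 * e * (1 / (1 + ?d\<^sup>2))"
    proof (cases "?d \<in> F")
      case False
      have "fst p \<in> patch N b (snd p)" "fst q \<in> patch N b (snd q)" using pq by (auto simp: P_def tile_set_def)
      then have "h < \<bar>?d\<bar>" using F False by (meson not_less)
      then have "gauss_hat t ?d \<le> e * (1 / (1 + ?d\<^sup>2))" by (rule h)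
      then have "cmod (u $ snd p) * cmod (u $ snd q) * gauss_hat t ?d \<le> U * U * (e * (1 / (1 + ?d\<^sup>2)))"
        by (intro mult_mono) (auto simp: U_def weight_le weight_bound_nonneg gauss_hat_def)
      moreover have "\<bar>gauss_hat t ?d\<bar> = gauss_hat t ?d" by (simp add: gauss_hat_def)
      ultimately show ?thesis using False by (simp add: norm_mult power2_eq_square mult_ac)
    qed (use pos in simp)
  qed
  also have "\<dots> \<le> (\<Sum>p\<in>P. U\<^sup>2 * e * sep_const rmin)"
  proof (rule sum_mono)
    fix p
    have "(\<Sum>q\<in>P. 1 / (1 + (fst q - fst p)\<^sup>2)) = (\<Sum>s\<in>fst ` P. 1 / (1 + (s - fst p)\<^sup>2))"
      by (simp add: sum.reindex[OF inj])
    also have "\<dots> \<le> sep_const rmin" by (rule sum_separated_le[OF _ sep rmin_pos]) (simp add: fin)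
    finally show "(\<Sum>q\<in>P. U\<^sup>2 * e * (1 / (1 + (fst q - fst p)\<^sup>2))) \<le> U\<^sup>2 * e * sep_const rmin"
      unfolding sum_distrib_left[symmetric] using e by (intro mult_left_mono) auto
  qed
  finally show ?thesis by (simp add: P_def U_def split_beta mult.commute)
qed

text \<open>
  Tannery's argument: finite local complexity reduces small differences to finitely many, and the
  contribution of large differences is uniformly small by separatedness.
\<close>

lemma pair_sum_tendsto:
  assumes L: "((\<lambda>z. (\<Sum>i\<in>UNIV. \<Sum>j\<in>UNIV. cnj (u $ i) * of_real (freq i j z) * u $ j) * of_real (gauss_hat t z)) has_sum L) UNIV"
  shows "(\<lambda>N. pair_sum u b N t / of_real (lam ^ N * len $ b)) \<longlonglongrightarrow> L"
proof (rule LIMSEQ_I)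
  fix r :: real assume r: "0 < r"
  define A where "A z = (\<Sum>i\<in>UNIV. \<Sum>j\<in>UNIV. cnj (u $ i) * of_real (freq i j z) * u $ j) * complex_of_real (gauss_hat t z)" for z
  define B where "B N z = (\<Sum>i\<in>UNIV. \<Sum>j\<in>UNIV. cnj (u $ i) * of_real (real (patch_count N b i j z) / (lam ^ N * len $ b)) * u $ j) * complex_of_real (gauss_hat t z)" for N z
  \<comment> \<open>Per unit length of the supertile, the tail is at most \<open>e * C\<close>, and
    \<open>e\<close> is chosen to make this less than \<open>r / 3\<close>. Dividing by
    \<open>C + 1\<close> covers the case \<open>C = 0\<close>.\<close>
  define C where "C = (weight_bound u)\<^sup>2 * sep_const rmin / rmin"
  have C: "0 \<le> C" unfolding C_def using rmin_pos sep_const_nonneg[OF rmin_pos] by simp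
  define e where "e = r / 3 / (C + 1)"
  have e: "0 < e" "e * C < r / 3"
  proof -
    show "0 < e" using r C by (simp add: e_def)
    have "e * C < e * (C + 1)" using \<open>0 < e\<close> by simp
    also have "e * (C + 1) = r / 3"
    proof -
      have "C + 1 \<noteq> 0" using C by linarith
      then show ?thesis unfolding e_def by (rule nonzero_eq_divide_eq[THEN iffD1, OF _ refl])
    qed
    finally show "e * C < r / 3" .
  qed
  obtain h where h: "\<And>z. h < \<bar>z\<bar> \<Longrightarrow> gauss_hat t z \<le> e * (1 / (1 + z\<^sup>2))" using gauss_hat_tail[OF e(1)] by blast
  obtain D where D: "finite D"
    "\<And>N b i j x y. x \<in> patch N b i \<Longrightarrow> y \<in> patch N b j \<Longrightarrow> \<bar>y - x\<bar> \<le> h \<Longrightarrow> y - x \<in> D"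
    using finite_patch_differences[of h] by blast
  have "(sum A \<longlongrightarrow> L) (finite_subsets_at_top UNIV)" using L by (simp add: has_sum_def A_def[abs_def])
  then have "\<forall>\<^sub>F F in finite_subsets_at_top UNIV. dist (sum A F) L < r / 3" using r by (intro tendstoD) auto
  then obtain F0 where F0: "finite F0" "\<And>F. finite F \<Longrightarrow> F0 \<subseteq> F \<Longrightarrow> dist (sum A F) L < r / 3"
    unfolding eventually_finite_subsets_at_top by auto
  \<comment> \<open>\<open>F0\<close> brings the partial sum close to \<open>L\<close>;
    \<open>D\<close> contains all differences up to \<open>h\<close> in all supertiles, so that
    whatever \<open>F\<close> misses belongs to the tail.\<close>
  define F where "F = F0 \<union> D"
  have F: "finite F" "dist (sum A F) L < r / 3" using F0 D by (auto simp: F_def)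
  have "(\<lambda>N. \<Sum>z\<in>F. B N z) \<longlonglongrightarrow> (\<Sum>z\<in>F. A z)"
    unfolding A_def B_def by (intro tendsto_intros patch_freq)
  then have "\<forall>\<^sub>F N in sequentially. dist (\<Sum>z\<in>F. B N z) (\<Sum>z\<in>F. A z) < r / 3" using r by (intro tendstoD) auto
  then obtain N0 where N0: "\<And>N. N0 \<le> N \<Longrightarrow> dist (\<Sum>z\<in>F. B N z) (\<Sum>z\<in>F. A z) < r / 3"
    unfolding eventually_sequentially by blast
  have "norm (pair_sum u b N t / of_real (lam ^ N * len $ b) - L) < r" if N: "N0 \<le> N" for N
  proof -
    define V where "V = lam ^ N * len $ b"
    have V: "0 < V" using lam_power_pos len_pos by (simp add: V_def)
    let ?f = "\<lambda>x i y j. cnj (u $ i) * u $ j * complex_of_real (gauss_hat t (y - x))"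
    define T where "T = (\<Sum>(x, i)\<in>tile_set (patch N b). \<Sum>(y, j)\<in>tile_set (patch N b). if y - x \<in> F then 0 else ?f x i y j)"
    have "pair_sum u b N t = (\<Sum>(x, i)\<in>tile_set (patch N b). \<Sum>(y, j)\<in>tile_set (patch N b). if y - x \<in> F then ?f x i y j else 0) + T"
      unfolding pair_sum_def T_def split_beta sum.distrib[symmetric] by (intro sum.cong refl) auto
    then have "pair_sum u b N t / of_real V = (\<Sum>z\<in>F. B N z) + T / of_real V"
      unfolding pair_sum_restrict[OF F(1)]
      by (simp add: add_divide_distrib B_def V_def sum_divide_distrib sum_distrib_left sum_distrib_right)
    moreover have "cmod (T / of_real V) < r / 3"
    proof -
      have "cmod T \<le> (weight_bound u)\<^sup>2 * e * sep_const rmin * real (card (tile_set (patch N b)))"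
        unfolding T_def
      proof (rule pair_sum_tail)
        show "0 \<le> e" using e by simp
        show "gauss_hat t z \<le> e * (1 / (1 + z\<^sup>2))" if "h < \<bar>z\<bar>" for z using h[OF that] .
        show "y - x \<in> F" if "x \<in> patch N b i" "y \<in> patch N b j" "\<bar>y - x\<bar> \<le> h" for i j x y
          using D(2)[OF that] by (simp add: F_def)
      qed
      also have "\<dots> \<le> (weight_bound u)\<^sup>2 * e * sep_const rmin * (V / rmin)"
        using card_patch_le[of N b] e sep_const_nonneg[OF rmin_pos] unfolding V_def by (intro mult_left_mono) auto
      also have "\<dots> = e * C * V" by (simp add: C_def)
      finally have "cmod (T / of_real V) \<le> e * C" using V by (simp add: norm_divide divide_le_eq)
      then show ?thesis using e by simp
    qed
    moreover have "norm ((\<Sum>z\<in>F. B N z) - (\<Sum>z\<in>F. A z)) < r / 3" using N0[OF N] by (simp add: dist_norm)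
    moreover have "norm ((\<Sum>z\<in>F. A z) - L) < r / 3" using F(2) by (simp add: dist_norm)
    moreover have "(\<Sum>z\<in>F. B N z) + T / of_real V - L = T / of_real V + (((\<Sum>z\<in>F. B N z) - (\<Sum>z\<in>F. A z)) + ((\<Sum>z\<in>F. A z) - L))"
      by simp
    ultimately show ?thesis unfolding V_def[symmetric]
      using norm_triangle_ineq[of "T / of_real V" "((\<Sum>z\<in>F. B N z) - (\<Sum>z\<in>F. A z)) + ((\<Sum>z\<in>F. A z) - L)"]
        norm_triangle_ineq[of "(\<Sum>z\<in>F. B N z) - (\<Sum>z\<in>F. A z)" "(\<Sum>z\<in>F. A z) - L"] by (simp add: add_diff_eq add.commute)
  qed
  then show "\<exists>N0. \<forall>N\<ge>N0. norm (pair_sum u b N t / of_real (lam ^ N * len $ b) - L) < r" by blast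
qed

section \<open>Intensity on the set where the cocycle is small\<close>

lemma cocycle_entry_le:
  "cmod (cocycle (N + n) k $ i $ b) \<le> real CARD('a) * (norm (cocycle n k) * norm (cocycle N (lam ^ n * k)))"
proof -
  have le: "cmod (A $ i $ j) \<le> norm A" for A :: "complex^'a^'a" and i j
    by (rule order.trans[OF Finite_Cartesian_Product.norm_nth_le[of "A $ i"] Finite_Cartesian_Product.norm_nth_le])
  have "cmod (cocycle (N + n) k $ i $ b) = cmod (\<Sum>l\<in>UNIV. cocycle n k $ i $ l * cocycle N (lam ^ n * k) $ l $ b)"
    using cocycle_add[of n N k] by (simp add: add.commute matrix_matrix_mult_def)
  also have "\<dots> \<le> (\<Sum>l\<in>(UNIV::'a set). norm (cocycle n k) * norm (cocycle N (lam ^ n * k)))"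
    by (rule sum_norm_le) (auto simp: norm_mult intro!: mult_mono le)
  finally show ?thesis by simp
qed

lemma amplitude_le:
  "(cmod (amplitude u b (N + n) k))\<^sup>2 \<le> (weight_bound u * real CARD('a))\<^sup>2 * ((norm (cocycle n k))\<^sup>2 * (norm (cocycle N (lam ^ n * k)))\<^sup>2)"
proof -
  have "cmod (amplitude u b (N + n) k) \<le> (\<Sum>i\<in>UNIV. cmod (u $ i) * (real CARD('a) * (norm (cocycle n k) * norm (cocycle N (lam ^ n * k)))))"
    unfolding amplitude_def by (rule sum_norm_le) (auto simp: norm_mult intro!: mult_left_mono cocycle_entry_le)
  also have "\<dots> = weight_bound u * real CARD('a) * (norm (cocycle n k) * norm (cocycle N (lam ^ n * k)))"
    by (simp add: weight_bound_def sum_distrib_right[symmetric] mult.assoc)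
  finally have "(cmod (amplitude u b (N + n) k))\<^sup>2 \<le> \<dots>\<^sup>2" by (rule power_mono) simp
  then show ?thesis by (simp add: power_mult_distrib)
qed

lemma amplitude_measurable [measurable]: "amplitude u b N \<in> borel_measurable borel"
  unfolding amplitude_def[abs_def] cocycle_entry by measurable

definition amp_const :: "complex^'a \<Rightarrow> 'a \<Rightarrow> real" where
  "amp_const u b = (weight_bound u * real CARD('a))\<^sup>2 * mean_const / len $ b"

text \<open>Where \<open>f\<close> is non-zero, level \<open>n\<close> contributes at most
  \<open>c * lam ^ n\<close>; the remaining factor at \<open>lam ^ n * k\<close> contributes order
  \<open>lam ^ N\<close> in the mean. Together they cancel the volume, so the bound is free of
  \<open>N\<close> and survives the limit.\<close>

lemma amplitude_integral_le:
  assumes f: "f \<in> borel_measurable borel" "\<And>k. 0 \<le> f k" "\<And>k. f k \<le> 1"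
    and c: "0 \<le> c" "\<And>k. f k \<noteq> 0 \<Longrightarrow> (norm (cocycle n k))\<^sup>2 \<le> c * lam ^ n"
  shows "(\<integral>\<^sup>+k. ennreal (f k * (std_normal_density k * (cmod (amplitude u b (N + n) k))\<^sup>2 / (lam ^ (N + n) * len $ b))) \<partial>lborel)
    \<le> ennreal (c * amp_const u b)"
proof -
  define W where "W = (weight_bound u * real CARD('a))\<^sup>2"
  have W: "0 \<le> W" by (simp add: W_def)
  define K where "K = W * c / (lam ^ N * len $ b)"
  have K: "0 \<le> K" using W c lam_power_pos[of N] len_pos[of b] by (simp add: K_def)
  have "f k * (std_normal_density k * (cmod (amplitude u b (N + n) k))\<^sup>2 / (lam ^ (N + n) * len $ b))
    \<le> K * (std_normal_density k * (norm (cocycle N (lam ^ n * k)))\<^sup>2)" for k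
  proof (cases "f k = 0")
    case True
    then show ?thesis using K by simp
  next
    case False
    define V where "V = lam ^ (N + n) * len $ b"
    have V: "0 < V" using lam_power_pos len_pos by (simp add: V_def)
    have "(cmod (amplitude u b (N + n) k))\<^sup>2 \<le> W * ((norm (cocycle n k))\<^sup>2 * (norm (cocycle N (lam ^ n * k)))\<^sup>2)"
      unfolding W_def by (rule amplitude_le)
    also have "\<dots> \<le> W * ((c * lam ^ n) * (norm (cocycle N (lam ^ n * k)))\<^sup>2)"
      using c(2)[OF False] W by (intro mult_left_mono mult_right_mono) auto
    finally have "std_normal_density k * (cmod (amplitude u b (N + n) k))\<^sup>2 / V
      \<le> std_normal_density k * (W * ((c * lam ^ n) * (norm (cocycle N (lam ^ n * k)))\<^sup>2)) / V"
      using V by (intro divide_right_mono mult_left_mono) auto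
    also have "\<dots> = K * (std_normal_density k * (norm (cocycle N (lam ^ n * k)))\<^sup>2)"
      using lam_gt_1 by (simp add: K_def V_def power_add)
    finally have le: "std_normal_density k * (cmod (amplitude u b (N + n) k))\<^sup>2 / V
      \<le> K * (std_normal_density k * (norm (cocycle N (lam ^ n * k)))\<^sup>2)" .
    have "f k * (std_normal_density k * (cmod (amplitude u b (N + n) k))\<^sup>2 / V)
      \<le> 1 * (std_normal_density k * (cmod (amplitude u b (N + n) k))\<^sup>2 / V)"
      using V f by (intro mult_right_mono) auto
    then show ?thesis using le unfolding V_def by linarith
  qed
  then have "(\<integral>\<^sup>+k. ennreal (f k * (std_normal_density k * (cmod (amplitude u b (N + n) k))\<^sup>2 / (lam ^ (N + n) * len $ b))) \<partial>lborel)
    \<le> (\<integral>\<^sup>+k. ennreal (K * (std_normal_density k * (norm (cocycle N (lam ^ n * k)))\<^sup>2)) \<partial>lborel)"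
    by (intro nn_integral_mono ennreal_leI)
  also have "\<dots> = ennreal K * (\<integral>\<^sup>+k. ennreal (std_normal_density k * (norm (cocycle N (lam ^ n * k)))\<^sup>2) \<partial>lborel)"
    using K by (simp add: ennreal_mult' nn_integral_cmult)
  also have "\<dots> \<le> ennreal K * ennreal (mean_const * lam ^ N)"
    by (intro mult_left_mono gauss_mean_cocycle lam_power_ge_1) simp
  also have "\<dots> = ennreal (c * amp_const u b)"
    using K mean_const_nonneg lam_gt_1 by (simp add: ennreal_mult[symmetric] K_def amp_const_def W_def mult_ac)
  finally show ?thesis .
qed

end

section \<open>Modulated Gaussians as test functions\<close>

text \<open>\<open>\<bar>x\<bar> ^ i / fact i\<close> is a term of the exponential series, and
  \<open>\<bar>x\<bar> - x\<^sup>2 / 2\<close> is at most \<open>1 / 2\<close>.\<close>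

lemma power_gauss_bounded:
  fixes x :: real
  shows "\<bar>x\<bar> ^ i * exp (- x\<^sup>2 / 2) \<le> fact i * exp (1 / 2)"
proof -
  have "\<bar>x\<bar> ^ i / fact i = (\<Sum>n\<in>{i}. inverse (fact n) *\<^sub>R \<bar>x\<bar> ^ n)"
    by (simp add: divide_inverse_commute)
  also have "\<dots> \<le> (\<Sum>n. inverse (fact n) *\<^sub>R \<bar>x\<bar> ^ n)"
    by (rule sum_le_suminf[OF summable_exp_generic]) auto
  also have "\<dots> = exp \<bar>x\<bar>" by (simp add: exp_def)
  finally have "\<bar>x\<bar> ^ i \<le> fact i * exp \<bar>x\<bar>" by (simp add: divide_le_eq mult.commute)
  then have "\<bar>x\<bar> ^ i * exp (- x\<^sup>2 / 2) \<le> fact i * exp \<bar>x\<bar> * exp (- x\<^sup>2 / 2)"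
    by (intro mult_right_mono) auto
  also have "\<dots> = fact i * exp (\<bar>x\<bar> - x\<^sup>2 / 2)" by (simp add: exp_add[symmetric])
  also have "\<bar>x\<bar> - x\<^sup>2 / 2 \<le> 1 / 2"
    using sum_squares_bound[of "\<bar>x\<bar>" 1] by simp
  finally show ?thesis by simp
qed

lemma poly_gauss_bounded:
  fixes p :: "complex poly"
  shows "bounded (range (\<lambda>x::real. poly p (of_real x) * of_real (exp (- x\<^sup>2 / 2))))"
proof -
  have "norm (poly p (of_real x) * of_real (exp (- x\<^sup>2 / 2))) \<le> (\<Sum>i\<le>degree p. cmod (coeff p i) * (fact i * exp (1 / 2)))" for x
  proof -
    have "norm (poly p (of_real x) * of_real (exp (- x\<^sup>2 / 2)))
      \<le> (\<Sum>i\<le>degree p. cmod (coeff p i * of_real x ^ i)) * exp (- x\<^sup>2 / 2)"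
      unfolding poly_altdef norm_mult[of "sum _ _"] by (intro mult_mono norm_sum sum_nonneg) auto
    also have "\<dots> = (\<Sum>i\<le>degree p. cmod (coeff p i) * (\<bar>x\<bar> ^ i * exp (- x\<^sup>2 / 2)))"
      by (simp add: norm_mult norm_power sum_distrib_right mult.assoc)
    also have "\<dots> \<le> (\<Sum>i\<le>degree p. cmod (coeff p i) * (fact i * exp (1 / 2)))"
      by (intro sum_mono mult_left_mono power_gauss_bounded) auto
    finally show ?thesis .
  qed
  then show ?thesis unfolding bounded_iff by blast
qed

lemma schwartz_gauss_cis: "schwartz_function (\<lambda>k. of_real (std_normal_density k) * cis (t * k))"
proof -
  define \<phi> where "\<phi> k = complex_of_real (std_normal_density k) * cis (t * k)" for k
  \<comment> \<open>Every derivative is a polynomial times \<open>\<phi>\<close>, because the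
    derivative of \<open>\<phi>\<close> is \<open>(\<i> * t - k) * \<phi> k\<close>;
    \<open>p\<close> follows the product rule.\<close>
  define p :: "nat \<Rightarrow> complex poly" where "p = rec_nat 1 (\<lambda>_ q. pderiv q + [:\<i> * of_real t, -1:] * q)"
  have p0: "p 0 = 1" and pS: "p (Suc n) = pderiv (p n) + [:\<i> * of_real t, -1:] * p n" for n
    by (simp_all add: p_def)
  define D where "D n k = poly (p n) (of_real k) * \<phi> k" for n k
  \<comment> \<open>This exhibits \<open>\<phi>\<close> as the restriction of an entire function, to
    which the rules for complex derivatives apply.\<close>
  have \<phi>: "\<phi> k = of_real (1 / sqrt (2 * pi)) * exp (\<i> * of_real t * of_real k - (of_real k)\<^sup>2 / 2)" for k
    by (simp add: \<phi>_def std_normal_density_def cis_conv_exp exp_of_real[symmetric] exp_add[symmetric] exp_diff exp_minus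
        divide_simps mult_ac)
  have d\<phi>: "(\<phi> has_vector_derivative (\<i> * of_real t - of_real k) * \<phi> k) (at k)" for k
  proof -
    define a where "a = complex_of_real (1 / sqrt (2 * pi))"
    have "((\<lambda>z. a * exp (\<i> * of_real t * z - z\<^sup>2 / 2)) has_field_derivative
       (\<i> * of_real t - z) * (a * exp (\<i> * of_real t * z - z\<^sup>2 / 2))) (at z)" for z :: complex
      by (auto intro!: derivative_eq_intros simp: algebra_simps)
    from has_vector_derivative_real_field[OF this]
    show ?thesis unfolding \<phi>[abs_def] a_def .
  qed
  have "(D n has_vector_derivative D (Suc n) k) (at k)" for n k
  proof -
    have "((\<lambda>x. poly (p n) (of_real x)) has_vector_derivative poly (pderiv (p n)) (of_real k)) (at k)"
      by (rule has_vector_derivative_real_field[OF poly_DERIV])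
    from has_vector_derivative_mult[OF this d\<phi>]
    show ?thesis unfolding D_def by (rule back_subst) (simp add: pS algebra_simps)
  qed
  moreover have "bounded (range (\<lambda>x. of_real (x ^ m) * D n x))" for m n
  proof -
    have "cmod (of_real (x ^ m) * D n x) \<le> cmod (poly (monom 1 m * p n) (of_real x) * of_real (exp (- x\<^sup>2 / 2)))" for x
    proof -
      have "std_normal_density x \<le> exp (- x\<^sup>2 / 2)"
      proof -
        have "1 \<le> sqrt (2 * pi)" using pi_gt3 by simp
        then have "1 / sqrt (2 * pi) * exp (- x\<^sup>2 / 2) \<le> 1 * exp (- x\<^sup>2 / 2)" by (intro mult_right_mono) auto
        then show ?thesis by (simp add: std_normal_density_def)
      qed
      then show ?thesis
        by (simp add: D_def \<phi>_def norm_mult norm_power poly_monom mult.assoc mult_left_mono)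
    qed
    moreover obtain B where "\<And>x. cmod (poly (monom 1 m * p n) (of_real x) * of_real (exp (- x\<^sup>2 / 2))) \<le> B"
      using poly_gauss_bounded[of "monom 1 m * p n"] unfolding bounded_iff by blast
    ultimately have "cmod (of_real (x ^ m) * D n x) \<le> B" for x by (meson order.trans)
    then show ?thesis unfolding bounded_iff by blast
  qed
  moreover have "D 0 = \<phi>" by (simp add: D_def p0 fun_eq_iff)
  ultimately show ?thesis unfolding schwartz_function_def \<phi>_def[symmetric] by blast
qed

lemma fourier_gauss_cis: "fourier (\<lambda>k. of_real (std_normal_density k) * cis (t * k)) z = of_real (gauss_hat t z)"
proof -
  have "exp (- 2 * of_real pi * \<i> * of_real k * of_real z) * (of_real (std_normal_density k) * cis (t * k))
    = of_real (std_normal_density k) * cis ((t - 2 * pi * z) * k)" for k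
  proof -
    have "exp (- 2 * of_real pi * \<i> * of_real k * of_real z) = cis (- 2 * pi * k * z)"
      by (simp add: cis_conv_exp mult_ac)
    moreover have "cis (- 2 * pi * k * z) * cis (t * k) = cis ((t - 2 * pi * z) * k)"
      by (simp add: cis_mult algebra_simps)
    ultimately show ?thesis by (simp only: mult.left_commute[of _ "of_real (std_normal_density k)"])
  qed
  note eq = this
  show ?thesis unfolding fourier_def eq gauss_cis(2) gauss_hat_def by simp
qed

section \<open>Weak convergence to the diffraction measure\<close>

lemma real_distribution_density:
  fixes M :: "real measure"
  assumes "sets M = sets borel" "integrable M f" "\<And>k. 0 \<le> f k" "0 < integral\<^sup>L M f"
  shows "real_distribution (density M (\<lambda>k. ennreal (f k / integral\<^sup>L M f)))"
proof -
  have sp: "space M = UNIV" using sets_eq_imp_space_eq[OF assms(1)] by simp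
  have [measurable]: "f \<in> borel_measurable M" using assms(2) by simp
  have "emeasure (density M (\<lambda>k. ennreal (f k / integral\<^sup>L M f))) (space (density M (\<lambda>k. ennreal (f k / integral\<^sup>L M f))))
    = (\<integral>\<^sup>+k. ennreal (f k / integral\<^sup>L M f) \<partial>M)"
    by (subst emeasure_density) (auto intro!: nn_integral_cong simp: indicator_def)
  also have "\<dots> = ennreal (LINT k|M. f k / integral\<^sup>L M f)"
    using assms by (intro nn_integral_eq_integral) auto
  also have "(LINT k|M. f k / integral\<^sup>L M f) = 1" using assms(4) by simp
  finally have "prob_space (density M (\<lambda>k. ennreal (f k / integral\<^sup>L M f)))"
    by (intro prob_spaceI) simp
  then show ?thesis using assms(1) by (simp add: real_distribution_def real_distribution_axioms_def)
qed

context inflation_hull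
begin

text \<open>Modulated Gaussians suffice as test functions: as \<open>t\<close> varies, their
  integrals form the characteristic function of the Gaussian-weighted \<open>\<mu>\<close>, up to
  its total mass.\<close>

lemma diffraction_gauss:
  assumes "is_diffraction_measure X u \<mu>"
  shows "integrable \<mu> (\<lambda>k. of_real (std_normal_density k) * cis (t * k))"
    and "(\<lambda>N. pair_sum u b N t / of_real (lam ^ N * len $ b)) \<longlonglongrightarrow> (LINT k|\<mu>. of_real (std_normal_density k) * cis (t * k))"
proof -
  let ?\<phi> = "\<lambda>k. complex_of_real (std_normal_density k) * cis (t * k)"
  have *: "integrable \<mu> ?\<phi>" "((\<lambda>z. autocorr_coeff X u z * fourier ?\<phi> z) has_sum (LINT k|\<mu>. ?\<phi> k)) (difference_set (\<Union>a. X a))"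
    using assms schwartz_gauss_cis[of t] by (auto simp: is_diffraction_measure_def)
  show "integrable \<mu> ?\<phi>" by (rule *)
  have "((\<lambda>z. autocorr_coeff X u z * fourier ?\<phi> z) has_sum (LINT k|\<mu>. ?\<phi> k)) UNIV"
    by (rule has_sum_cong_neutral[THEN iffD1, OF _ _ _ *(2)]) (auto simp: autocorr_coeff_0)
  then show "(\<lambda>N. pair_sum u b N t / of_real (lam ^ N * len $ b)) \<longlonglongrightarrow> (LINT k|\<mu>. ?\<phi> k)"
    unfolding fourier_gauss_cis autocorr_coeff_eq by (rule pair_sum_tendsto)
qed

lemma diffraction_gauss_real:
  assumes "is_diffraction_measure X u \<mu>"
  shows "integrable \<mu> std_normal_density"
proof -
  have "integrable \<mu> (\<lambda>k. complex_of_real (std_normal_density k) * cis (0 * k))"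
    by (rule diffraction_gauss(1)[OF assms])
  from integrable_Re[OF this] show ?thesis by simp
qed

text \<open>
  By Levy's continuity theorem, the Gaussian mean of the diffraction measure is the weak limit of
  the normalised intensities of the supertiles, because the characteristic functions converge.
\<close>

lemma weak_limit_bound:
  fixes f :: "real \<Rightarrow> real"
  assumes diff: "is_diffraction_measure X u \<mu>"
    and m: "m = (LINT k|\<mu>. std_normal_density k)" "0 < m"
    and f: "\<And>k. isCont f k" "\<And>k. 0 \<le> f k" "\<And>k. f k \<le> 1"
    and c: "0 \<le> c" "\<And>k. f k \<noteq> 0 \<Longrightarrow> (norm (cocycle n k))\<^sup>2 \<le> c * lam ^ n"
  shows "(LINT k|density \<mu> (\<lambda>k. ennreal (std_normal_density k / m)). f k) \<le> c * amp_const u b / m"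
proof -
  define M' where "M' = density \<mu> (\<lambda>k. ennreal (std_normal_density k / m))"
  have sets: "sets \<mu> = sets borel" using diff by (simp add: is_diffraction_measure_def)
  have int: "integrable \<mu> std_normal_density" by (rule diffraction_gauss_real[OF diff])
  have M': "real_distribution M'"
    unfolding M'_def m(1) using m by (intro real_distribution_density[OF sets int]) auto
  define V where "V N = lam ^ N * len $ b" for N
  have V: "0 < V N" for N using lam_power_pos len_pos by (simp add: V_def)
  define a where "a N k = std_normal_density k * (cmod (amplitude u b N k))\<^sup>2 / V N" for N k
  have a_cis: "of_real (a N k) * cis (t * k) = cis (t * k) * of_real (std_normal_density k * (cmod (amplitude u b N k))\<^sup>2) / of_real (V N)" for N k t
    by (simp add: a_def)
  have inta: "integrable lborel (\<lambda>k. complex_of_real (a N k) * cis (t * k))"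
    and chara: "(LINT k|lborel. complex_of_real (a N k) * cis (t * k)) = pair_sum u b N t / of_real (V N)" for N t
    unfolding a_cis using amplitude_gauss[of t u b N] by (auto intro: integrable_divide_zero)
  have int0: "integrable lborel (a N)" for N using integrable_Re[OF inta[of N 0]] by simp
  have [measurable]: "a N \<in> borel_measurable borel" for N
    using borel_measurable_integrable[OF int0[of N]] by simp
  have a0: "0 \<le> a N k" for N k using V[of N] by (simp add: a_def)
  define mm where "mm N = integral\<^sup>L lborel (a N)" for N
  have conv: "(\<lambda>N. pair_sum u b N t / of_real (V N)) \<longlonglongrightarrow> (LINT k|\<mu>. of_real (std_normal_density k) * cis (t * k))" for t
    unfolding V_def by (rule diffraction_gauss(2)[OF diff])
  have mm: "mm \<longlonglongrightarrow> m"
  proof -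
    have "(\<lambda>N. complex_of_real (mm N)) \<longlonglongrightarrow> complex_of_real m"
      using conv[of 0] unfolding chara[symmetric] by (simp add: mm_def m)
    then show ?thesis by (simp add: tendsto_of_real_iff)
  qed
  \<comment> \<open>The normal distribution is a default for levels of mass 0, as every
    \<open>M N\<close> has to be a probability measure; eventually \<open>mm N\<close> is
    positive.\<close>
  define M where "M N = (if 0 < mm N then density lborel (\<lambda>k. ennreal (a N k / mm N)) else std_normal_distribution)" for N
  have M: "real_distribution (M N)" for N
    unfolding M_def mm_def using int0 a0 real_dist_normal_dist by (auto intro!: real_distribution_density)
  have ev: "\<forall>\<^sub>F N in sequentially. 0 < mm N" by (rule order_tendstoD(1)[OF mm m(2)])
  have lint_M: "(LINT k|M N. g k) = (LINT k|lborel. (a N k / mm N) *\<^sub>R g k)"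
    if "0 < mm N" "g \<in> borel_measurable borel" for N and g :: "real \<Rightarrow> 'z::{banach, second_countable_topology}"
    using that a0 by (simp add: M_def integral_density)
  have char_M: "char (M N) t = pair_sum u b N t / of_real (V N) / of_real (mm N)" if "0 < mm N" for N t
  proof -
    have "char (M N) t = (LINT k|lborel. (a N k / mm N) *\<^sub>R iexp (t * k))"
      unfolding char_def by (rule lint_M[OF that]) measurable
    also have "\<dots> = (LINT k|lborel. complex_of_real (a N k) * cis (t * k) / of_real (mm N))"
      by (simp add: cis_conv_exp scaleR_conv_of_real)
    finally show ?thesis by (simp add: chara)
  qed
  have char_M': "char M' t = (LINT k|\<mu>. of_real (std_normal_density k) * cis (t * k)) / of_real m" for t
  proof -
    have "char M' t = (LINT k|\<mu>. (std_normal_density k / m) *\<^sub>R iexp (t * k))"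
      unfolding char_def M'_def using m(2)
      by (intro integral_density) (auto simp: measurable_cong_sets[OF sets refl])
    also have "\<dots> = (LINT k|\<mu>. of_real (std_normal_density k) * cis (t * k) / of_real m)"
      by (simp add: cis_conv_exp scaleR_conv_of_real)
    finally show ?thesis by simp
  qed
  have "weak_conv_m M M'"
  proof (rule levy_continuity[OF M M'])
    fix t
    have "(\<lambda>N. pair_sum u b N t / of_real (V N) / of_real (mm N)) \<longlonglongrightarrow> char M' t"
      unfolding char_M' using m(2) by (intro tendsto_divide conv tendsto_of_real mm) simp
    then show "(\<lambda>N. char (M N) t) \<longlonglongrightarrow> char M' t"
      by (rule Lim_transform_eventually) (use ev in eventually_elim, simp add: char_M)
  qed
  then have lim: "(\<lambda>N. LINT k|M N. f k) \<longlonglongrightarrow> (LINT k|M'. f k)"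
    by (rule weak_conv_imp_integral_bdd_continuous_conv[OF M M', where B = 1]) (use f in auto)
  have fmeas [measurable]: "f \<in> borel_measurable borel"
    using f(1) by (intro borel_measurable_continuous_onI continuous_at_imp_continuous_on) auto
  \<comment> \<open>The level is \<open>N + n\<close> because \<open>amplitude_integral_le\<close>
    splits off \<open>n\<close> levels.\<close>
  have "\<forall>\<^sub>F N in sequentially. (LINT k|M (N + n). f k) \<le> c * amp_const u b / mm (N + n)"
    using sequentially_offset[OF ev, of n]
  proof eventually_elim
    case (elim N)
    have "(\<integral>\<^sup>+k. ennreal (f k * a (N + n) k) \<partial>lborel) \<le> ennreal (c * amp_const u b)"
      unfolding a_def V_def by (rule amplitude_integral_le[OF fmeas f(2,3) c])
    moreover have intf: "integrable lborel (\<lambda>k. f k * a (N + n) k)"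
      by (rule Bochner_Integration.integrable_bound[OF int0[of "N + n"]])
        (use f a0 in \<open>auto simp: abs_mult intro!: mult_left_le_one_le\<close>)
    moreover have "0 \<le> c * amp_const u b"
      using c(1) mean_const_nonneg len_pos[of b] by (simp add: amp_const_def)
    ultimately have "(LINT k|lborel. f k * a (N + n) k) \<le> c * amp_const u b"
      using f a0 by (simp add: nn_integral_eq_integral)
    moreover have "(LINT k|M (N + n). f k) = (LINT k|lborel. f k * a (N + n) k) / mm (N + n)"
      using lint_M[OF elim fmeas] by (simp add: mult.commute)
    ultimately show ?case using elim by (simp add: divide_right_mono)
  qed
  moreover have "(\<lambda>N. c * amp_const u b / mm (N + n)) \<longlonglongrightarrow> c * amp_const u b / m"
    using m(2) by (intro tendsto_divide tendsto_const LIMSEQ_ignore_initial_segment mm) simp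
  ultimately show ?thesis
    unfolding M'_def[symmetric]
    by (intro tendsto_le[OF _ _ LIMSEQ_ignore_initial_segment[OF lim, of n]]) auto
qed

text \<open>The set is open by continuity of the cocycle, so its indicator is a pointwise limit of
  the continuous cut-offs \<open>f j\<close>. The bound for continuous functions carries over by
  dominated convergence.\<close>

lemma diffraction_measure_le:
  assumes diff: "is_diffraction_measure X u \<mu>"
    and m: "m = (LINT k|\<mu>. std_normal_density k)" "0 < m" and c: "0 \<le> c"
  shows "measure (density \<mu> (\<lambda>k. ennreal (std_normal_density k / m))) {k. (norm (cocycle n k))\<^sup>2 < c * lam ^ n}
    \<le> c * amp_const u b / m"
proof -
  define M' where "M' = density \<mu> (\<lambda>k. ennreal (std_normal_density k / m))"
  have sets: "sets \<mu> = sets borel" using diff by (simp add: is_diffraction_measure_def)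
  interpret M': real_distribution M'
    unfolding M'_def m(1) using m by (intro real_distribution_density[OF sets diffraction_gauss_real[OF diff]]) auto
  define A where "A = {k. (norm (cocycle n k))\<^sup>2 < c * lam ^ n}"
  define f where "f j k = min 1 (real j * max 0 (c * lam ^ n - (norm (cocycle n k))\<^sup>2))" for j k
  have cont: "continuous_on UNIV (f j)" for j
    unfolding f_def[abs_def] by (intro continuous_intros continuous_cocycle)
  have [measurable]: "f j \<in> borel_measurable borel" for j
    by (rule borel_measurable_continuous_onI[OF cont])
  have [measurable]: "A \<in> sets borel"
    unfolding A_def using cocycle_measurable[of n 1] by simp
  have f01: "0 \<le> f j k" "f j k \<le> 1" for j k by (auto simp: f_def)
  have "(\<lambda>j. f j k) \<longlonglongrightarrow> indicator A k" for k
  proof (cases "k \<in> A")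
    case True
    then have pos: "0 < c * lam ^ n - (norm (cocycle n k))\<^sup>2" by (simp add: A_def)
    obtain j0 where j0: "1 < real j0 * (c * lam ^ n - (norm (cocycle n k))\<^sup>2)"
      using ex_less_of_nat_mult[OF pos] by blast
    have "f j k = 1" if "j0 \<le> j" for j
    proof -
      have "real j0 * (c * lam ^ n - (norm (cocycle n k))\<^sup>2) \<le> real j * (c * lam ^ n - (norm (cocycle n k))\<^sup>2)"
        using that pos by (intro mult_right_mono) auto
      then have "1 \<le> real j * (c * lam ^ n - (norm (cocycle n k))\<^sup>2)" using j0 by linarith
      then show ?thesis using pos by (simp add: f_def max_def min_absorb1)
    qed
    then show ?thesis using True by (intro tendsto_eventually) (auto simp: eventually_sequentially)
  next
    case False
    then show ?thesis by (simp add: f_def A_def max_def)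
  qed
  then have "(\<lambda>j. LINT k|M'. f j k) \<longlonglongrightarrow> (LINT k|M'. indicator A k)"
    by (intro integral_dominated_convergence[where w = "\<lambda>_. 1"]) (use f01 in auto)
  moreover have "(LINT k|M'. f j k) \<le> c * amp_const u b / m" for j
    unfolding M'_def
  proof (rule weak_limit_bound[OF diff m _ f01 c])
    show "isCont (f j) k" for k using cont by (simp add: continuous_on_eq_continuous_at)
    show "(norm (cocycle n k))\<^sup>2 \<le> c * lam ^ n" if "f j k \<noteq> 0" for k
      using that by (auto simp: f_def max_def split: if_splits)
  qed
  ultimately have "(LINT k|M'. indicator A k) \<le> c * amp_const u b / m"
    by (intro LIMSEQ_le_const2) auto
  then show ?thesis by (simp add: A_def M'_def sets_eq_imp_space_eq[OF sets])
qed

section \<open>Lower bound for the exponent with respect to the diffraction measure\<close>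

lemma AE_lyapunov_exponent_ge:
  assumes diff: "is_diffraction_measure X u \<mu>"
  shows "AE k in \<mu>. \<not> lyapunov_exponent \<rho> lam len k < ereal (ln (sqrt lam))"
proof -
  define m where "m = (LINT k|\<mu>. std_normal_density k)"
  have sets: "sets \<mu> = sets borel" using diff by (simp add: is_diffraction_measure_def)
  note int = diffraction_gauss_real[OF diff]
  have Gmeas: "std_normal_density \<in> borel_measurable \<mu>" using int by simp
  have "0 \<le> m" unfolding m_def by (rule integral_nonneg_AE) simp
  then consider "m = 0" | "0 < m" by linarith
  then show ?thesis
  proof cases
    \<comment> \<open>Then \<open>\<mu>\<close> is the zero measure, since the Gaussian is positive
      everywhere.\<close>
    case 1
    then have "AE k in \<mu>. std_normal_density k = 0"
      unfolding m_def using integral_nonneg_eq_0_iff_AE[OF int] by simp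
    then show ?thesis by eventually_elim (simp add: less_imp_neq[OF normal_density_pos, symmetric])
  next
    case 2
    define M' where "M' = density \<mu> (\<lambda>k. ennreal (std_normal_density k / m))"
    interpret M': real_distribution M'
      unfolding M'_def m_def using 2 by (intro real_distribution_density[OF sets int]) (auto simp: m_def)
    \<comment> \<open>By \<open>diffraction_measure_le\<close>, the mass of \<open>A q n\<close>
      decays geometrically in \<open>n\<close>, so the points that lie in all of these sets from
      some \<open>n0\<close> on form a null set.\<close>
    define A where "A q n = {k. (norm (cocycle n k))\<^sup>2 < exp (- (1 / (real q + 1))) ^ n * lam ^ n}" for q n :: nat
    have A [measurable]: "A q n \<in> sets borel" for q n
      unfolding A_def using cocycle_measurable[of n 1] by simp
    have "AE k in M'. k \<notin> (\<Inter>n\<in>{n0..}. A q n)" for q n0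
    proof -
      \<comment> \<open>Supertiles of any type can be used; \<open>undefined\<close> selects
        one.\<close>
      define K where "K = amp_const u undefined / m"
      define \<theta> where "\<theta> = exp (- (1 / (real q + 1)))"
      have \<theta>: "0 < \<theta>" "\<theta> < 1" by (auto simp: \<theta>_def)
      have le: "measure M' (\<Inter>n\<in>{n0..}. A q n) \<le> \<theta> ^ n * K" if "n0 \<le> n" for n
      proof -
        have "measure M' (\<Inter>n\<in>{n0..}. A q n) \<le> measure M' (A q n)"
          using that by (intro M'.finite_measure_mono) auto
        also have "\<dots> \<le> \<theta> ^ n * amp_const u undefined / m"
          unfolding A_def M'_def \<theta>_def[symmetric] using \<theta>
          by (intro diffraction_measure_le[OF diff m_def 2]) auto
        finally show ?thesis by (simp add: K_def)
      qed
      have "(\<lambda>n. \<theta> ^ n * K) \<longlonglongrightarrow> 0 * K" using \<theta> by (intro tendsto_mult tendsto_const LIMSEQ_realpow_zero) auto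
      then have "measure M' (\<Inter>n\<in>{n0..}. A q n) \<le> 0"
        by (intro LIMSEQ_le_const[of _ "0::real"]) (use le in auto)
      then have "emeasure M' (\<Inter>n\<in>{n0..}. A q n) = 0"
        by (simp add: M'.emeasure_eq_measure order_antisym)
      then show ?thesis by (intro AE_not_in null_setsI) auto
    qed
    then have "AE k in M'. \<forall>q n0. k \<notin> (\<Inter>n\<in>{n0..}. A q n)" by (simp add: AE_all_countable)
    then have "AE k in M'. \<not> lyapunov_exponent \<rho> lam len k < ereal (ln (sqrt lam))"
    proof eventually_elim
      case (elim k)
      then show ?case using lyapunov_less_imp[of k] by (auto simp: A_def)
    qed
    \<comment> \<open>The density of \<open>M'\<close> is positive, so null sets of
      \<open>M'\<close> are null for \<open>\<mu>\<close>.\<close>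
    then show ?thesis unfolding M'_def using Gmeas 2
      by (subst (asm) AE_density) (auto simp: zero_less_divide_iff normal_density_pos)
  qed
qed

text \<open>\<open>E\<close> is null for \<open>\<mu>\<close>, which dominates its absolutely
  continuous part, and \<open>H\<close> is Lebesgue null. If \<open>S\<close> were Lebesgue null
  too, the absolutely continuous part would vanish on the whole line.\<close>

lemma lyapunov_exponent_eq_on_positive_measure:
  assumes diff: "is_diffraction_measure X u \<mu>" and ac: "has_nontrivial_ac_part \<mu>"
  defines "S \<equiv> {k. lyapunov_exponent \<rho> lam len k = ereal (ln (sqrt lam))}"
  shows "S \<in> sets borel" "0 < emeasure lborel S"
proof -
  let ?\<chi> = "lyapunov_exponent \<rho> lam len" and ?L = "ereal (ln (sqrt lam))"
  define E where "E = {k. ?\<chi> k < ?L}"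
  define H where "H = {k. ?L < ?\<chi> k}"
  show S [measurable]: "S \<in> sets borel" unfolding S_def by measurable
  have E [measurable]: "E \<in> sets borel" and H [measurable]: "H \<in> sets borel" unfolding E_def H_def by measurable
  have sets: "sets \<mu> = sets borel" using diff by (simp add: is_diffraction_measure_def)
  obtain \<mu>ac \<mu>s where dec: "lebesgue_decomposition \<mu> \<mu>ac \<mu>s" and nz: "emeasure \<mu>ac UNIV \<noteq> 0"
    using ac unfolding has_nontrivial_ac_part_def by blast
  have sets_ac: "sets \<mu>ac = sets borel" using dec by (simp add: lebesgue_decomposition_def)
  have "emeasure \<mu> E = 0"
    using AE_lyapunov_exponent_ge[OF diff] sets sets_eq_imp_space_eq[OF sets]
    by (subst (asm) AE_iff_measurable[OF _ refl]) (auto simp: E_def)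
  then have E0: "emeasure \<mu>ac E = 0" using dec by (simp add: lebesgue_decomposition_def)
  have H0: "emeasure lborel H = 0"
    using AE_lyapunov_exponent_le by (subst (asm) AE_iff_measurable[OF _ refl]) (auto simp: H_def not_le)
  show "0 < emeasure lborel S"
  proof (rule ccontr)
    assume "\<not> ?thesis"
    then have "S \<union> H \<in> null_sets lborel" using H0 by (intro null_sets.Un) (auto simp: null_sets_def)
    then have "S \<union> H \<in> null_sets \<mu>ac"
      using dec by (auto simp: lebesgue_decomposition_def absolutely_continuous_def)
    moreover have "E \<in> null_sets \<mu>ac" using E0 sets_ac by (auto simp: null_sets_def)
    ultimately have "E \<union> (S \<union> H) \<in> null_sets \<mu>ac" by (rule null_sets.Un[rotated])
    moreover have "E \<union> (S \<union> H) = UNIV" by (auto simp: E_def S_def H_def not_less)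
    ultimately show False using nz by auto
  qed
qed

end

theorem corollary3p35:
  fixes \<rho> :: "'a::finite \<Rightarrow> 'a list"
    and lam :: real
    and len :: "real^'a"
    and X0 X :: "'a \<Rightarrow> real set"
  assumes rule: "primitive_inflation_rule \<rho> lam len"
    and fixed: "fixed_point_tiling \<rho> lam len X0"
    and in_hull: "X \<in> tiling_hull X0"
    and nonsingular: "\<exists>k. det (fourier_matrix \<rho> len k) \<noteq> 0"
    and ac: "\<exists>u \<mu>. is_diffraction_measure X u \<mu> \<and> has_nontrivial_ac_part \<mu>"
  shows "(\<exists>S\<in>sets lebesgue. 0 < emeasure lebesgue S \<and>
            (\<forall>k\<in>S. lyapunov_exponent \<rho> lam len k = ereal (ln (sqrt lam))))
       \<and> ((\<exists>c. AE k in lebesgue. lyapunov_exponent \<rho> lam len k = c) \<longrightarrow>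
            (AE k in lebesgue. lyapunov_exponent \<rho> lam len k = ereal (ln (sqrt lam))))"
proof -
  interpret inflation_hull \<rho> lam len X0 X
  proof
    show "1 < lam" using rule by (simp add: primitive_inflation_rule_def)
    show "0 < len $ i" for i
      using rule by (simp add: primitive_inflation_rule_def left_pf_eigenvector_def)
    show "(\<Sum>a\<leftarrow>\<rho> j. len $ a) = lam * len $ j" for j
    proof -
      have "len v* subst_matrix \<rho> = lam *s len"
        using rule by (simp add: primitive_inflation_rule_def left_pf_eigenvector_def)
      then have "(len v* subst_matrix \<rho>) $ j = lam * len $ j" by simp
      moreover have "(len v* subst_matrix \<rho>) $ j = (\<Sum>i\<in>UNIV. real (count_list (\<rho> j) i) * len $ i)"
        by (simp add: vector_matrix_mult_def subst_matrix_def mult.commute)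
      \<comment> \<open>The eigenvector equation groups the letters by type, while the locale sums
        along the word; a general word \<open>xs\<close> allows induction.\<close>
      moreover have "(\<Sum>a\<leftarrow>xs. len $ a) = (\<Sum>i\<in>UNIV. real (count_list xs i) * len $ i)" for xs
      proof (induction xs)
        case (Cons x xs)
        have "(\<Sum>i\<in>UNIV. real (count_list (x # xs) i) * len $ i)
          = (\<Sum>i\<in>UNIV. (if i = x then len $ i else 0) + real (count_list xs i) * len $ i)"
          by (intro sum.cong) (auto simp: algebra_simps)
        then show ?case using Cons by (simp add: sum.distrib)
      qed simp
      ultimately show ?thesis by simp
    qed
    show "\<exists>q. \<forall>i j. 0 < mat_power (subst_matrix \<rho>) q $ i $ j"
      using rule by (auto simp: primitive_inflation_rule_def primitive_substitution_def primitive_matrix_def)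
  qed (rule fixed in_hull)+
  let ?\<chi> = "lyapunov_exponent \<rho> lam len" and ?L = "ereal (ln (sqrt lam))"
  obtain u \<mu> where "is_diffraction_measure X u \<mu>" "has_nontrivial_ac_part \<mu>" using ac by blast
  note S = lyapunov_exponent_eq_on_positive_measure[OF this]
  define S where "S = {k. ?\<chi> k = ?L}"
  have S: "S \<in> sets lborel" "0 < emeasure lebesgue S" using S by (auto simp: S_def)
  \<comment> \<open>A value taken almost everywhere is taken somewhere on \<open>S\<close>, which
    has positive measure.\<close>
  have "c = ?L" if c: "AE k in lebesgue. ?\<chi> k = c" for c
  proof (rule ccontr)
    assume "c \<noteq> ?L"
    have "AE k in lebesgue. k \<notin> S" using c by eventually_elim (use \<open>c \<noteq> ?L\<close> in \<open>auto simp: S_def\<close>)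
    then have "emeasure lebesgue S = 0"
      using S(1) by (subst (asm) AE_iff_measurable[of S]) auto
    then show False using S(2) by simp
  qed
  moreover have "\<exists>S\<in>sets lebesgue. 0 < emeasure lebesgue S \<and> (\<forall>k\<in>S. ?\<chi> k = ?L)"
    using S by (intro bexI[of _ S]) (auto simp: S_def)
  ultimately show ?thesis by blast
qed

end
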